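(* Let $n\ge1$ be an integer. Let $X_1=(\Omega_1,\Sigma_1,\mu_1)$ and $X_2=(\Omega_2,\Sigma_2,\mu_2)$ be two measure spaces with $\mu_1(\Omega_1)=\mu_2(\Omega_2)<+\infty$, where $\Omega_1$ is a Polish space and $\Sigma_1$ is its Borel $\sigma$-algebra. Let $A:L^2(X_1,\mathbb{R}^n)\to L^2(X_2,\mathbb{R}^n)$ be a continuous linear operator such that (i) $\|A\|\le 1$; (ii) for every $v_0\in\mathbb{R}^n$, $A$ sends the constant function $\Omega_1\ni s\mapsto v_0$ to the constant function $\Omega_2\ni t\mapsto v_0$. Let $\{f_s\}_{s\in\Omega_1}$ and $\{g_t\}_{t\in\Omega_2}$ be two families of Borel functions from $\mathbb{R}^n$ to $\mathbb{R}\cup\{+\infty\}$ such that (iii) $(s,x)\mapsto f_s(x)$ is $\Sigma_1\otimes\mathcal{B}_{\mathbb{R}^n}$-measurable and $(t,x)\mapsto g_t(x)$ is $\Sigma_2\otimes\mathcal{B}_{\mathbb{R}^n}$-measurable; (iv) the functions $s\mapsto\log\bigl(\int_{\mathbb{R}^n}e^{-f_s(x)}\,dx\bigr)$ and $t\mapsto\log\bigl(\int_{\mathbb{R}^n}e^{-g_t(x)}\,dx\bigr)$ are semi-integrable with respect to $\mu_1$ and $\mu_2$ respectively; (v) for every $s\in\Omega_1$ the function $f_s$ is non-negative, and for every $t\in\Omega_2$ the function $g_t$ is non-negative and lower semicontinuous; (vi) for some $\varepsilon_0>0$, \[ \int_{\Omega_1}\log^-\Bigl(\int_{\mathbb{R}^n}\exp\bigl(-f_s(x)-\varepsilon_0|x|^2\bigr)\,dx\Bigr)\,d\mu_1(s)<+\infty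 . \] If for every $\alpha\in L^2(X_1,\mathbb{R}^n)$ we have \[ \int_{\Omega_2}g_t\bigl((A\alpha)(t)\bigr)\,d\mu_2(t)\le\int_{\Omega_1}f_s(\alpha(s))\,d\mu_1(s), \] then \[ \int_{\Omega_2}-\log\Bigl(\int_{\mathbb{R}^n}e^{-g_t(x)}\,dx\Bigr)\,d\mu_2(t)\le\int_{\Omega_1}-\log\Bigl(\int_{\mathbb{R}^n}e^{-f_s(x)}\,dx\Bigr)\,d\mu_1(s). \]
   Context: $|\cdot|$ is the Euclidean norm on $\mathbb{R}^n$, $\mathcal{B}_{\mathbb{R}^n}$ is the Borel $\sigma$-algebra of $\mathbb{R}^n$. The $L^2$-norms of $\mathbb{R}^n$-valued functions are computed with respect to $|\cdot|$ and the measures $\mu_1,\mu_2$, and $\|A\|$ is the corresponding operator norm. An extended-real measurable function $F$ on a measure space with measure $\mu$ is called $\mu$-semi-integrable if at least one of $F^+=\max(F,0)$, $F^-=\max(-F,0)$ is $\mu$-integrable; its integral is then well defined in $[-\infty,+\infty]$. Conventions: $e^{-\infty}=0$, $\log 0=-\infty$, $\log(+\infty)=+\infty$, $\log^-=\max(-\log,0)$. *)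

theory Defs
  imports "HOL-Analysis.Analysis"
begin

text \<open>
  The extended-real integral. The two parts are Lebesgue integrals of nonnegative functions;
  the value of \<open>semi_integral\<close> is meaningful only for semi-integrable functions, since
  \<open>\<infinity> - \<infinity> = \<infinity>\<close> in type \<open>ereal\<close>.
\<close>

definition semi_integrable :: "'a measure \<Rightarrow> ('a \<Rightarrow> ereal) \<Rightarrow> bool" where
  "semi_integrable M F \<longleftrightarrow> F \<in> borel_measurable M \<and>
     ((\<integral>\<^sup>+ x. e2ennreal (max (F x) 0) \<partial>M) < \<infinity> \<or> (\<integral>\<^sup>+ x. e2ennreal (max (- F x) 0) \<partial>M) < \<infinity>)"

definition semi_integral :: "'a measure \<Rightarrow> ('a \<Rightarrow> ereal) \<Rightarrow> ereal" where
  "semi_integral M F =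
     enn2ereal (\<integral>\<^sup>+ x. e2ennreal (max (F x) 0) \<partial>M) - enn2ereal (\<integral>\<^sup>+ x. e2ennreal (max (- F x) 0) \<partial>M)"

definition exp_ext :: "ereal \<Rightarrow> ennreal" where
  "exp_ext x = (case x of ereal r \<Rightarrow> ennreal (exp r) | PInfty \<Rightarrow> \<infinity> | MInfty \<Rightarrow> 0)"

definition log_ext :: "ennreal \<Rightarrow> ereal" where
  "log_ext y = (if y = 0 then - \<infinity> else if y = \<infinity> then \<infinity> else ereal (ln (enn2real y)))"

definition log_minus :: "ennreal \<Rightarrow> ereal" where
  "log_minus y = max (- log_ext y) 0"

definition lower_semicontinuous :: "('a::topological_space \<Rightarrow> ereal) \<Rightarrow> bool" where
  "lower_semicontinuous g \<longleftrightarrow> (\<forall>x. \<forall>a < g x. eventually (\<lambda>y. a < g y) (nhds x))"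

text \<open>
  \<open>L\<^sup>2\<close> spaces are represented by square-integrable functions rather than by their classes modulo
  equality almost everywhere, so \<open>L2_norm\<close> is only a seminorm. An operator between \<open>L\<^sup>2\<close> spaces
  is a map on representatives that respects equality almost everywhere; its values outside
  \<open>L2_space M\<close> are irrelevant.
\<close>

definition L2_space :: "'a measure \<Rightarrow> ('a \<Rightarrow> 'v::euclidean_space) set" where
  "L2_space M = {f \<in> borel_measurable M. integrable M (\<lambda>x. (norm (f x))\<^sup>2)}"

definition L2_norm :: "'a measure \<Rightarrow> ('a \<Rightarrow> 'v::euclidean_space) \<Rightarrow> real" where
  "L2_norm M f = sqrt (\<integral>x. (norm (f x))\<^sup>2 \<partial>M)"

definition L2_continuous_linear ::
  "'a measure \<Rightarrow> 'b measure \<Rightarrow> (('a \<Rightarrow> 'v::euclidean_space) \<Rightarrow> ('b \<Rightarrow> 'v)) \<Rightarrow> bool" where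
  "L2_continuous_linear M N A \<longleftrightarrow>
     (\<forall>\<alpha>\<in>L2_space M. A \<alpha> \<in> L2_space N) \<and>
     (\<forall>\<alpha>\<in>L2_space M. \<forall>\<beta>\<in>L2_space M.
        (AE s in M. \<alpha> s = \<beta> s) \<longrightarrow> (AE t in N. A \<alpha> t = A \<beta> t)) \<and>
     (\<forall>\<alpha>\<in>L2_space M. \<forall>\<beta>\<in>L2_space M. AE t in N. A (\<lambda>s. \<alpha> s + \<beta> s) t = A \<alpha> t + A \<beta> t) \<and>
     (\<forall>c. \<forall>\<alpha>\<in>L2_space M. AE t in N. A (\<lambda>s. c *\<^sub>R \<alpha> s) t = c *\<^sub>R A \<alpha> t) \<and>
     (\<forall>\<alpha>\<in>L2_space M. \<forall>e>0. \<exists>d>0. \<forall>\<beta>\<in>L2_space M.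
        L2_norm M (\<lambda>s. \<beta> s - \<alpha> s) < d \<longrightarrow> L2_norm N (\<lambda>t. A \<beta> t - A \<alpha> t) < e)"

text \<open>As in the library's \<open>onorm\<close>, with \<open>r / 0 = 0\<close>; the supremum is over a bounded set
  for continuous linear operators.\<close>

definition L2_onorm ::
  "'a measure \<Rightarrow> 'b measure \<Rightarrow> (('a \<Rightarrow> 'v::euclidean_space) \<Rightarrow> ('b \<Rightarrow> 'v)) \<Rightarrow> real" where
  "L2_onorm M N A = (SUP \<alpha>\<in>L2_space M. L2_norm N (A \<alpha>) / L2_norm M \<alpha>)"

end

(*
  Adding Gaussian noise with covariance h I sends an energy phi to soft_avg h phi x = - log E exp (- phi (x + noise)),
  whose limit for large h is - log of the integral of exp (- phi), up to a constant depending only on h.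
  By Girsanov's formula soft_avg h phi x is at most the cost E phi (x + v + noise) + |v|^2 / (2 h) of any
  drift v. If the hypothesis holds for (g, f), then choosing a good drift v(s) for f_s and using the drift
  (A v)(t) for g_t, which is cheaper since A is a contraction and which sees the same noise since A fixes
  constants, the hypothesis holds for soft_avg h g and ctrl_avg h f, where ctrl_avg is the infimum of the cost
  over all drifts. Iterating N times with h = T / N gives soft_avg T g on the left by the semigroup
  property, and on the right a discretised stochastic control problem, whose value tends to soft_avg T f when f
  is regular (Borell's formula).

  Regularity comes from replacing f and g by envelopes inf_y f(y) + k / 2 |x - y|^2, an operation that also
  preserves the hypothesis; as k tends to infinity the envelopes of g recover g by lower semicontinuity,
  and no convergence is needed for f. Infima over uncountable families are replaced by essential infima,
  attained by countable subfamilies, so that no measurable selection theorem is used.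
*)
theory Submission
  imports Defs "HOL-Probability.Probability"
begin

text \<open>Three limits are taken in a fixed order: the number of steps N to infinity for fixed T
  and k, then k to infinity, then T = 1 / (2 \<epsilon>) to infinity. The first needs a one-step
  error of order h^2, uniform in x and along the iteration. This is why the envelopes are built from
  paraboloids of one common curvature: a finite minimum of them is a fixed quadratic plus a minimum
  of affine functions, which can be smoothed with bounded gradient. Turning the limsup at each s
  into a limsup of integrals needs a dominating function; condition (vi) supplies it by making the
  envelope of f_s at 0 integrable in s. The operator A acts on functions of s only, and modulo null
  sets. So the noise has to be frozen while A acts, and the comparison of envelope and f holds, for
  each x, off a null set that depends on x. Since f enters the conclusion only through integrals in
  x, Fubini's theorem makes this sufficient. All quantities live in [0, \<infinity>], with
  logarithms split into positive and negative parts, so that no difference is formed before the very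
  end.\<close>

section \<open>Centred Gaussian measures\<close>

definition gdens :: "real \<Rightarrow> 'v::euclidean_space \<Rightarrow> real" where
  "gdens h x = exp (- ((norm x)\<^sup>2 / (2 * h))) / sqrt (2 * pi * h) ^ DIM('v)"

definition gauss :: "real \<Rightarrow> 'v::euclidean_space measure" where
  "gauss h = density lborel (\<lambda>x. ennreal (gdens h x))"

lemma gdens_measurable [measurable]: "gdens h \<in> borel_measurable borel"
  unfolding gdens_def by measurable

lemma gdens_nonneg [simp]: "h > 0 \<Longrightarrow> 0 \<le> gdens h x"
  unfolding gdens_def by (intro divide_nonneg_nonneg zero_le_power) auto

lemma sets_gauss [simp, measurable_cong]: "sets (gauss h) = sets borel"
  and space_gauss [simp]: "space (gauss h) = UNIV"
  by (simp_all add: gauss_def)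

lemma nn_integral_gauss:
  "f \<in> borel_measurable borel \<Longrightarrow>
    (\<integral>\<^sup>+ x. f x \<partial>gauss h) = (\<integral>\<^sup>+ x. ennreal (gdens h x) * f x \<partial>lborel)"
  unfolding gauss_def by (subst nn_integral_density) auto

lemma nn_integral_exp_square:
  assumes "h > 0"
  shows "(\<integral>\<^sup>+ x. ennreal (exp (- (x\<^sup>2 / (2 * h)))) \<partial>lborel) = ennreal (sqrt (2 * pi * h))"
proof -
  have e: "exp (- (x\<^sup>2 / (2 * h))) = sqrt (2 * pi * h) * normal_density 0 (sqrt h) x" for x
    using assms by (simp add: normal_density_def)
  have "(\<integral>\<^sup>+ x. ennreal (exp (- (x\<^sup>2 / (2 * h)))) \<partial>lborel)
      = (\<integral>\<^sup>+ x. ennreal (sqrt (2 * pi * h)) * ennreal (normal_density 0 (sqrt h) x) \<partial>lborel)"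
    unfolding e using assms by (intro nn_integral_cong) (simp add: ennreal_mult normal_density_nonneg)
  also have "\<dots> = ennreal (sqrt (2 * pi * h)) * (\<integral>\<^sup>+ x. ennreal (normal_density 0 (sqrt h) x) \<partial>lborel)"
    by (rule nn_integral_cmult) simp
  also have "(\<integral>\<^sup>+ x. ennreal (normal_density 0 (sqrt h) x) \<partial>lborel) = 1"
    using assms by (subst nn_integral_eq_integral) (auto simp: normal_density_nonneg)
  finally show ?thesis by simp
qed

lemma nn_integral_exp_norm:
  assumes "h > 0"
  shows "(\<integral>\<^sup>+ (x::'v::euclidean_space). ennreal (exp (- ((norm x)\<^sup>2 / (2 * h)))) \<partial>lborel)
    = ennreal (sqrt (2 * pi * h) ^ DIM('v))"
proof -
  have "ennreal (exp (- ((norm x)\<^sup>2 / (2 * h))))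
      = (\<Prod>b\<in>Basis. ennreal (exp (- ((x \<bullet> b)\<^sup>2 / (2 * h)))))" for x :: 'v
  proof -
    have "(norm x)\<^sup>2 = (\<Sum>b\<in>Basis. (x \<bullet> b)\<^sup>2)"
      by (simp add: norm_eq_sqrt_inner euclidean_inner[of x x] power2_eq_square sum_nonneg)
    then have "exp (- ((norm x)\<^sup>2 / (2 * h))) = (\<Prod>b\<in>Basis. exp (- ((x \<bullet> b)\<^sup>2 / (2 * h))))"
      by (simp flip: exp_sum add: sum_negf sum_divide_distrib)
    then show ?thesis by (simp add: prod_ennreal)
  qed
  then have "(\<integral>\<^sup>+ (x::'v). ennreal (exp (- ((norm x)\<^sup>2 / (2 * h)))) \<partial>lborel)
      = (\<integral>\<^sup>+ (x::'v). (\<Prod>b\<in>Basis. (\<lambda>b r. ennreal (exp (- (r\<^sup>2 / (2 * h))))) b (x \<bullet> b)) \<partial>lborel)"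
    by simp
  also have "\<dots> = (\<Prod>b\<in>(Basis::'v set). \<integral>\<^sup>+ x. ennreal (exp (- (x\<^sup>2 / (2 * h)))) \<partial>lborel)"
    by (rule nn_integral_lborel_prod) auto
  also have "\<dots> = ennreal (sqrt (2 * pi * h) ^ DIM('v))"
    using assms by (simp add: nn_integral_exp_square prod_ennreal ennreal_power)
  finally show ?thesis .
qed

lemma prob_space_gauss: "h > 0 \<Longrightarrow> prob_space (gauss h :: 'v::euclidean_space measure)"
proof
  assume h: "h > 0"
  have "emeasure (gauss h :: 'v measure) (space (gauss h)) = (\<integral>\<^sup>+ (x::'v). 1 \<partial>gauss h)"
    by simp
  also have "\<dots> = (\<integral>\<^sup>+ (x::'v). ennreal (gdens h x) * 1 \<partial>lborel)"
    by (rule nn_integral_gauss) simp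
  also have "\<dots> = (\<integral>\<^sup>+ (x::'v). ennreal (exp (- ((norm x)\<^sup>2 / (2 * h))))
      * ennreal (1 / sqrt (2 * pi * h) ^ DIM('v)) \<partial>lborel)"
    using h by (intro nn_integral_cong) (simp add: gdens_def flip: ennreal_mult)
  also have "\<dots> = ennreal (sqrt (2 * pi * h) ^ DIM('v)) * ennreal (1 / sqrt (2 * pi * h) ^ DIM('v))"
    by (subst nn_integral_multc) (simp_all add: nn_integral_exp_norm h)
  also have "\<dots> = 1"
    using h by (simp flip: ennreal_mult)
  finally show "emeasure (gauss h :: 'v measure) (space (gauss h)) = 1" .
qed

section \<open>Translations and convolutions of Gaussian measures\<close>

lemma nn_integral_lborel_plus:
  fixes v :: "'v::euclidean_space"
  assumes [measurable]: "f \<in> borel_measurable borel"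
  shows "(\<integral>\<^sup>+ x. f (x + v) \<partial>lborel) = (\<integral>\<^sup>+ x. f x \<partial>lborel)"
proof -
  have "(\<integral>\<^sup>+ x. f x \<partial>lborel) = (\<integral>\<^sup>+ x. f x \<partial>distr lborel borel ((+) v))"
    by (simp add: lborel_distr_plus)
  also have "\<dots> = (\<integral>\<^sup>+ x. f (v + x) \<partial>lborel)"
    by (subst nn_integral_distr) auto
  finally show ?thesis by (simp add: add.commute)
qed

text \<open>Cameron-Martin formula for a constant shift: translate Lebesgue measure by
  \<open>v\<close> and expand \<open>(norm (z + v))\<^sup>2\<close> in the density. It is used with
  a candidate drift as \<open>v\<close>.\<close>

lemma nn_integral_gauss_shift:
  fixes v :: "'v::euclidean_space"
  assumes h: "h > 0" and [measurable]: "f \<in> borel_measurable borel"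
  shows "(\<integral>\<^sup>+ z. f z \<partial>gauss h)
    = (\<integral>\<^sup>+ z. f (z + v) * ennreal (exp (- (z \<bullet> v / h) - (norm v)\<^sup>2 / (2 * h))) \<partial>gauss h)"
proof -
  have e: "gdens h (z + v) = gdens h z * exp (- (z \<bullet> v / h) - (norm v)\<^sup>2 / (2 * h))" for z
  proof -
    have "- ((norm (z + v))\<^sup>2 / (2 * h))
        = - ((norm z)\<^sup>2 / (2 * h)) + (- (z \<bullet> v / h) - (norm v)\<^sup>2 / (2 * h))"
      using h by (simp add: power2_norm_eq_inner inner_simps inner_commute field_simps)
    then show ?thesis unfolding gdens_def by (simp only: exp_add times_divide_eq_left)
  qed
  have "(\<integral>\<^sup>+ z. f z \<partial>gauss h) = (\<integral>\<^sup>+ x. ennreal (gdens h (x + v)) * f (x + v) \<partial>lborel)"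
    by (simp add: nn_integral_gauss nn_integral_lborel_plus[of "\<lambda>x. ennreal (gdens h x) * f x"])
  also have "\<dots> = (\<integral>\<^sup>+ x. ennreal (gdens h x)
      * (f (x + v) * ennreal (exp (- (x \<bullet> v / h) - (norm v)\<^sup>2 / (2 * h)))) \<partial>lborel)"
    unfolding e using h by (intro nn_integral_cong) (simp add: ennreal_mult mult_ac)
  also have "\<dots> = (\<integral>\<^sup>+ z. f (z + v) * ennreal (exp (- (z \<bullet> v / h) - (norm v)\<^sup>2 / (2 * h))) \<partial>gauss h)"
    by (rule nn_integral_gauss[symmetric]) simp
  finally show ?thesis .
qed

text \<open>The centre and the variance on the right are the conditional mean and variance of the
  first of two independent centred Gaussians, of variances \<open>a\<close> and \<open>b\<close>,
  given that their sum is \<open>y\<close>.\<close>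

lemma complete_square:
  fixes y z :: "'v::real_inner"
  assumes "a > 0" "b > 0"
  shows "(norm z)\<^sup>2 / (2 * a) + (norm (y - z))\<^sup>2 / (2 * b)
    = (norm (z - (a / (a + b)) *\<^sub>R y))\<^sup>2 / (2 * (a * b / (a + b))) + (norm y)\<^sup>2 / (2 * (a + b))"
proof -
  have ab: "a + b \<noteq> 0" "a \<noteq> 0" "b \<noteq> 0" using assms by auto
  define p q r where "p = z \<bullet> z" "q = z \<bullet> y" "r = y \<bullet> y"
  have "p / (2 * a) + (p - 2 * q + r) / (2 * b)
      = (p - 2 * (a / (a + b)) * q + (a / (a + b))\<^sup>2 * r) / (2 * (a * b / (a + b))) + r / (2 * (a + b))"
    using ab by (simp add: divide_simps power2_eq_square) algebra
  moreover have "(norm (z - t *\<^sub>R y))\<^sup>2 = p - 2 * t * q + t\<^sup>2 * r" for t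
    unfolding power2_norm_eq_inner p_q_r_def
    by (simp add: inner_simps inner_commute power2_eq_square algebra_simps)
  moreover have "(norm (y - z))\<^sup>2 = p - 2 * q + r"
    by (simp add: p_q_r_def power2_norm_eq_inner inner_simps inner_commute algebra_simps)
  moreover have "(norm z)\<^sup>2 = p" "(norm y)\<^sup>2 = r"
    by (simp_all add: p_q_r_def power2_norm_eq_inner)
  ultimately show ?thesis by simp
qed

lemma gdens_convolution:
  fixes y :: "'v::euclidean_space"
  assumes h: "h > 0" "k > 0"
  shows "(\<integral>\<^sup>+ z. ennreal (gdens h z) * ennreal (gdens k (y - z)) \<partial>lborel) = ennreal (gdens (h + k) y)"
proof -
  define \<rho> c where "\<rho> = h * k / (h + k)" and "c = (h / (h + k)) *\<^sub>R y"
  define C where "C = exp (- ((norm y)\<^sup>2 / (2 * (h + k))))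
    / (sqrt (2 * pi * h) ^ DIM('v) * sqrt (2 * pi * k) ^ DIM('v))"
  have \<rho>: "\<rho> > 0" using h by (simp add: \<rho>_def)
  have C: "C \<ge> 0" using h by (simp add: C_def)
  have "ennreal (gdens h z) * ennreal (gdens k (y - z))
      = ennreal C * ennreal (exp (- ((norm (z + - c))\<^sup>2 / (2 * \<rho>))))" for z
  proof -
    have "exp (- ((norm z)\<^sup>2 / (2 * h))) * exp (- ((norm (y - z))\<^sup>2 / (2 * k)))
      = exp (- ((norm y)\<^sup>2 / (2 * (h + k)))) * exp (- ((norm (z - c))\<^sup>2 / (2 * \<rho>)))"
      using complete_square[OF h, of z y] by (simp add: \<rho>_def c_def flip: exp_add)
    then have "gdens h z * gdens k (y - z) = C * exp (- ((norm (z - c))\<^sup>2 / (2 * \<rho>)))"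
      by (simp add: gdens_def C_def)
    then show ?thesis using h C by (simp flip: ennreal_mult)
  qed
  then have "(\<integral>\<^sup>+ z. ennreal (gdens h z) * ennreal (gdens k (y - z)) \<partial>lborel)
      = ennreal C * (\<integral>\<^sup>+ z. ennreal (exp (- ((norm (z + - c))\<^sup>2 / (2 * \<rho>)))) \<partial>lborel)"
    by (simp add: nn_integral_cmult)
  also have "(\<integral>\<^sup>+ z. ennreal (exp (- ((norm (z + - c))\<^sup>2 / (2 * \<rho>)))) \<partial>lborel)
      = ennreal (sqrt (2 * pi * \<rho>) ^ DIM('v))"
    using nn_integral_lborel_plus[of "\<lambda>z. ennreal (exp (- ((norm z)\<^sup>2 / (2 * \<rho>))))" "- c"]
    by (simp add: nn_integral_exp_norm[OF \<rho>])
  also have "ennreal C * ennreal (sqrt (2 * pi * \<rho>) ^ DIM('v)) = ennreal (gdens (h + k) y)"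
  proof -
    have "sqrt (2 * pi * \<rho>) * sqrt (2 * pi * (h + k)) = sqrt (2 * pi * h) * sqrt (2 * pi * k)"
      using h by (simp add: \<rho>_def field_simps flip: real_sqrt_mult)
    then have "sqrt (2 * pi * \<rho>) ^ DIM('v) * sqrt (2 * pi * (h + k)) ^ DIM('v)
        = sqrt (2 * pi * h) ^ DIM('v) * sqrt (2 * pi * k) ^ DIM('v)"
      by (metis power_mult_distrib)
    moreover have "sqrt (2 * pi * (h + k)) ^ DIM('v) > 0" using h by simp
    ultimately have "sqrt (2 * pi * \<rho>) ^ DIM('v) / (sqrt (2 * pi * h) ^ DIM('v) * sqrt (2 * pi * k) ^ DIM('v))
        = 1 / sqrt (2 * pi * (h + k)) ^ DIM('v)"
      using h by (subst frac_eq_eq) simp_all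
    then have "C * sqrt (2 * pi * \<rho>) ^ DIM('v) = gdens (h + k) y"
      unfolding C_def gdens_def by (metis (no_types, lifting) mult.right_neutral times_divide_eq_left times_divide_eq_right)
    then show ?thesis using C \<rho> by (simp flip: ennreal_mult)
  qed
  finally show ?thesis .
qed

lemma sigma_finite_gauss: "h > 0 \<Longrightarrow> sigma_finite_measure (gauss h)"
  by (intro prob_space_imp_sigma_finite prob_space_gauss)

lemma nn_integral_gauss_convolution:
  fixes f :: "'v::euclidean_space \<Rightarrow> ennreal"
  assumes h: "h > 0" "k > 0" and [measurable]: "f \<in> borel_measurable borel"
  shows "(\<integral>\<^sup>+ z. (\<integral>\<^sup>+ w. f (z + w) \<partial>gauss k) \<partial>gauss h) = (\<integral>\<^sup>+ z. f z \<partial>gauss (h + k))"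
proof -
  interpret k: sigma_finite_measure "gauss k :: 'v measure" by (rule sigma_finite_gauss[OF h(2)])
  have [measurable]: "(\<lambda>z. \<integral>\<^sup>+ w. f (z + w) \<partial>gauss k) \<in> borel_measurable borel"
    by measurable
  have "(\<integral>\<^sup>+ z. (\<integral>\<^sup>+ w. f (z + w) \<partial>gauss k) \<partial>gauss h)
      = (\<integral>\<^sup>+ z. ennreal (gdens h z) * (\<integral>\<^sup>+ w. ennreal (gdens k w) * f (z + w) \<partial>lborel) \<partial>lborel)"
    by (subst nn_integral_gauss) (simp_all add: nn_integral_gauss)
  also have "\<dots> = (\<integral>\<^sup>+ z. (\<integral>\<^sup>+ w. ennreal (gdens h z) * ennreal (gdens k (w - z)) * f w \<partial>lborel) \<partial>lborel)"
  proof (intro nn_integral_cong)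
    fix z :: 'v
    have "(\<integral>\<^sup>+ w. ennreal (gdens k w) * f (z + w) \<partial>lborel)
        = (\<integral>\<^sup>+ w. ennreal (gdens k (w - z)) * f w \<partial>lborel)"
      using nn_integral_lborel_plus[of "\<lambda>w. ennreal (gdens k (w - z)) * f w" z]
      by (simp add: add.commute)
    then show "ennreal (gdens h z) * (\<integral>\<^sup>+ w. ennreal (gdens k w) * f (z + w) \<partial>lborel)
        = (\<integral>\<^sup>+ w. ennreal (gdens h z) * ennreal (gdens k (w - z)) * f w \<partial>lborel)"
      by (simp add: nn_integral_cmult mult.assoc)
  qed
  also have "\<dots> = (\<integral>\<^sup>+ w. (\<integral>\<^sup>+ z. ennreal (gdens h z) * ennreal (gdens k (w - z)) * f w \<partial>lborel) \<partial>lborel)"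
    by (rule lborel_pair.Fubini') simp
  also have "\<dots> = (\<integral>\<^sup>+ w. ennreal (gdens (h + k) w) * f w \<partial>lborel)"
    by (simp add: nn_integral_multc gdens_convolution h)
  also have "\<dots> = (\<integral>\<^sup>+ z. f z \<partial>gauss (h + k))"
    by (simp add: nn_integral_gauss)
  finally show ?thesis .
qed

text \<open>The exponent is half the critical one, so the integrand against Lebesgue measure is a
  Gaussian of variance \<open>2 * h\<close> with the wrong normalisation. The value does not depend
  on \<open>h\<close>; it becomes the dimensional constant of the one-step error.\<close>

lemma nn_integral_gauss_exp_square:
  assumes h: "h > 0"
  shows "(\<integral>\<^sup>+ (z::'v::euclidean_space). ennreal (exp ((norm z)\<^sup>2 / (4 * h))) \<partial>gauss h) = ennreal (sqrt 2 ^ DIM('v))"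
proof -
  have "ennreal (gdens h z) * ennreal (exp ((norm z)\<^sup>2 / (4 * h)))
      = ennreal (1 / sqrt (2 * pi * h) ^ DIM('v)) * ennreal (exp (- ((norm z)\<^sup>2 / (2 * (2 * h)))))" for z :: 'v
  proof -
    have "- ((norm z)\<^sup>2 / (2 * (2 * h))) = - ((norm z)\<^sup>2 / (2 * h)) + (norm z)\<^sup>2 / (4 * h)"
      using h by (simp add: field_simps)
    then have "exp (- ((norm z)\<^sup>2 / (2 * (2 * h))))
        = exp (- ((norm z)\<^sup>2 / (2 * h))) * exp ((norm z)\<^sup>2 / (4 * h))"
      by (simp only: exp_add)
    then show ?thesis using h by (simp add: gdens_def flip: ennreal_mult)
  qed
  then have "(\<integral>\<^sup>+ (z::'v). ennreal (exp ((norm z)\<^sup>2 / (4 * h))) \<partial>gauss h)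
      = ennreal (1 / sqrt (2 * pi * h) ^ DIM('v)) * ennreal (sqrt (2 * pi * (2 * h)) ^ DIM('v))"
    using h nn_integral_exp_norm[of "2 * h", where 'v = 'v]
    by (simp add: nn_integral_gauss nn_integral_cmult del: times_divide_eq_left)
  also have "\<dots> = ennreal (sqrt 2 ^ DIM('v))"
  proof -
    have "sqrt (2 * pi * (2 * h)) = sqrt 2 * sqrt (2 * pi * h)"
      by (simp flip: real_sqrt_mult)
    then show ?thesis using h by (simp add: power_mult_distrib flip: ennreal_mult)
  qed
  finally show ?thesis .
qed

section \<open>Integrability and vanishing first moment\<close>

lemma integrable_gauss_exp_square:
  "h > 0 \<Longrightarrow> integrable (gauss h) (\<lambda>z::'v::euclidean_space. exp ((norm z)\<^sup>2 / (4 * h)))"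
  by (intro integrableI_nonneg) (simp_all add: nn_integral_gauss_exp_square)

lemma integrable_gauss_norm_square:
  assumes h: "h > 0"
  shows "integrable (gauss h) (\<lambda>z::'v::euclidean_space. (norm z)\<^sup>2)"
proof (rule Bochner_Integration.integrable_bound)
  show "integrable (gauss h) (\<lambda>z::'v. 4 * h * exp ((norm z)\<^sup>2 / (4 * h)))"
    by (intro integrable_mult_right integrable_gauss_exp_square h)
  show "AE z::'v in gauss h. norm ((norm z)\<^sup>2) \<le> norm (4 * h * exp ((norm z)\<^sup>2 / (4 * h)))"
  proof (rule AE_I2)
    fix z :: 'v
    have "(norm z)\<^sup>2 / (4 * h) \<le> exp ((norm z)\<^sup>2 / (4 * h))"
      using exp_ge_add_one_self[of "(norm z)\<^sup>2 / (4 * h)"] by linarith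
    then show "norm ((norm z)\<^sup>2) \<le> norm (4 * h * exp ((norm z)\<^sup>2 / (4 * h)))"
      using h by (simp add: field_simps)
  qed
qed simp

lemma integrable_gauss_norm:
  assumes h: "h > 0"
  shows "integrable (gauss h) (\<lambda>z::'v::euclidean_space. norm z)"
proof (rule Bochner_Integration.integrable_bound)
  interpret prob_space "gauss h :: 'v measure" by (rule prob_space_gauss[OF h])
  show "integrable (gauss h) (\<lambda>z::'v. 1 + (norm z)\<^sup>2)"
    by (intro Bochner_Integration.integrable_add integrable_gauss_norm_square h) simp
  have "norm z \<le> 1 + (norm z)\<^sup>2" for z :: 'v
    using sum_squares_bound[of 1 "norm z"] norm_ge_zero[of z] by (simp only: power_one)
  then show "AE z::'v in gauss h. norm (norm z) \<le> norm (1 + (norm z)\<^sup>2)"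
    by (auto intro!: AE_I2)
qed simp

lemma integrable_gauss_inner:
  fixes p :: "'v::euclidean_space"
  assumes h: "h > 0"
  shows "integrable (gauss h) (\<lambda>z. z \<bullet> p)"
proof (rule Bochner_Integration.integrable_bound)
  show "integrable (gauss h) (\<lambda>z::'v. norm z * norm p)"
    by (intro integrable_mult_left integrable_gauss_norm h)
qed (auto intro!: AE_I2 simp: Cauchy_Schwarz_ineq2)

lemma distr_gauss_uminus:
  assumes h: "h > 0"
  shows "distr (gauss h) borel uminus = (gauss h :: 'v::euclidean_space measure)"
proof -
  have u: "distr lborel borel uminus = (lborel :: 'v measure)"
    by (subst lborel_affine[of "-1" "0::'v"]) (auto simp: density_1 one_ennreal_def[symmetric])
  have "(gauss h :: 'v measure) = density (distr lborel borel uminus) (\<lambda>x. ennreal (gdens h x))"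
    by (simp add: u gauss_def)
  also have "\<dots> = distr (density lborel (\<lambda>x. ennreal (gdens h (- x)))) borel uminus"
    by (subst density_distr) auto
  finally show ?thesis by (simp add: gauss_def gdens_def)
qed

lemma integral_gauss_inner:
  fixes p :: "'v::euclidean_space"
  assumes h: "h > 0"
  shows "(\<integral>z. z \<bullet> p \<partial>gauss h) = 0"
proof -
  have "(\<integral>z. z \<bullet> p \<partial>gauss h) = (\<integral>z. z \<bullet> p \<partial>distr (gauss h) borel uminus)"
    by (simp add: distr_gauss_uminus h)
  also have "\<dots> = (\<integral>z. (- z) \<bullet> p \<partial>gauss h)"
    by (rule integral_distr) auto
  finally show ?thesis by simp
qed

section \<open>The exponential transform of nonnegative extended reals\<close>

definition en :: "ennreal \<Rightarrow> ennreal" where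
  "en y = (if y = \<top> then 0 else ennreal (exp (- enn2real y)))"

text \<open>The positive part of \<open>- log y\<close>: \<open>ennreal\<close> truncates negative
  values, and the conventions \<open>enn2real \<top> = 0\<close> and \<open>ln 0 = 0\<close> give
  the value 0 at \<open>\<top>\<close>.\<close>

definition nlog :: "ennreal \<Rightarrow> ennreal" where
  "nlog y = (if y = 0 then \<top> else ennreal (- ln (enn2real y)))"

lemma en_top [simp]: "en \<top> = 0"
  and en_ennreal [simp]: "r \<ge> 0 \<Longrightarrow> en (ennreal r) = ennreal (exp (- r))"
  by (auto simp: en_def)

lemma en_0 [simp]: "en 0 = 1"
  by (simp add: en_def)

lemma en_measurable [measurable]: "en \<in> borel_measurable borel"
  unfolding en_def by measurable

lemma nlog_measurable [measurable]: "nlog \<in> borel_measurable borel"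
  unfolding nlog_def by measurable

lemma en_le_1: "en y \<le> 1"
  by (cases y) (auto simp: ennreal_le_1)

lemma nlog_exp: "nlog (ennreal (exp (- r))) = ennreal r"
  by (simp add: nlog_def ennreal_eq_0_iff not_le)

text \<open>This is the Galois connection between the two antitone maps. It holds also for
  \<open>y\<close> above 1, where \<open>nlog\<close> is truncated to 0, because \<open>en\<close>
  never exceeds 1.\<close>

lemma less_nlog_iff: "c < nlog y \<longleftrightarrow> y < en c"
proof (cases "y = 0")
  case True
  then show ?thesis
    by (cases c) (auto simp: nlog_def top.not_eq_extremum)
next
  case y: False
  show ?thesis
  proof (cases y)
    case (real r)
    then have r: "r > 0" using y by (cases "r = 0") auto
    show ?thesis
    proof (cases c)
      case (real d)
      have "d < - ln r \<longleftrightarrow> r < exp (- d)"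
        using r by (metis exp_less_cancel_iff exp_ln minus_less_iff neg_less_iff_less)
      then show ?thesis using real \<open>y = ennreal r\<close> r
        by (auto simp: nlog_def ennreal_less_iff ennreal_eq_0_iff)
    qed (auto simp: \<open>y = ennreal r\<close>)
  next
    case top
    then show ?thesis by (cases c) (auto simp: nlog_def)
  qed
qed

lemma nlog_le_iff: "nlog y \<le> c \<longleftrightarrow> en c \<le> y"
  using less_nlog_iff[of c y] by (auto simp: not_less[symmetric])

lemma en_nlog: "y \<le> 1 \<Longrightarrow> en (nlog y) = y"
proof (cases "y = 0")
  case False
  assume y: "y \<le> 1"
  then obtain r where r: "r > 0" "r \<le> 1" "y = ennreal r"
    using False by (cases y) (auto simp: top_unique less_le)
  then show ?thesis by (simp add: nlog_def ennreal_eq_0_iff)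
qed (simp add: nlog_def)

lemma nlog_en: "nlog (en y) = y"
  by (cases y) (auto simp: nlog_exp, simp add: nlog_def)

lemma en_le_iff: "en x \<le> en y \<longleftrightarrow> y \<le> x"
  by (metis nlog_le_iff nlog_en)

lemma nlog_antimono: "x \<le> y \<Longrightarrow> nlog y \<le> nlog x"
  by (metis nlog_le_iff order.trans order_refl)

lemma en_add: "en (x + y) = en x * en y"
  by (cases x; cases y) (auto simp: mult_exp_exp simp flip: ennreal_plus ennreal_mult)

lemma en_INF: "en (INF i\<in>I. f i) = (SUP i\<in>I. en (f i))"
proof (rule antisym)
  show "en (INF i\<in>I. f i) \<le> (SUP i\<in>I. en (f i))"
    unfolding nlog_le_iff[symmetric] 
    by (intro INF_greatest) (auto simp: nlog_le_iff intro!: SUP_upper)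
  show "(SUP i\<in>I. en (f i)) \<le> en (INF i\<in>I. f i)"
    by (intro SUP_least) (simp add: en_le_iff INF_lower)
qed

section \<open>Square-integrable functions\<close>

lemma L2_space_iff:
  "\<alpha> \<in> L2_space M \<longleftrightarrow> \<alpha> \<in> borel_measurable M \<and> (\<integral>\<^sup>+ s. ennreal ((norm (\<alpha> s))\<^sup>2) \<partial>M) < \<infinity>"
  unfolding L2_space_def by (auto simp: integrable_iff_bounded)

lemma L2_space_measurable: "\<alpha> \<in> L2_space M \<Longrightarrow> \<alpha> \<in> borel_measurable M"
  by (simp add: L2_space_def)

lemma norm_add_square_le: "(norm (x + y))\<^sup>2 \<le> 2 * (norm x)\<^sup>2 + 2 * (norm (y :: 'v::real_normed_vector))\<^sup>2"
proof -
  have "(norm (x + y))\<^sup>2 \<le> (norm x + norm y)\<^sup>2"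
    by (intro power_mono norm_triangle_ineq) simp
  also have "\<dots> \<le> 2 * (norm x)\<^sup>2 + 2 * (norm y)\<^sup>2"
    using sum_squares_bound[of "norm x" "norm y"] by (simp add: power2_sum)
  finally show ?thesis .
qed

lemma L2_space_add:
  assumes "\<alpha> \<in> L2_space M" "\<beta> \<in> L2_space M"
  shows "(\<lambda>s. \<alpha> s + \<beta> s) \<in> L2_space M"
  unfolding L2_space_def mem_Collect_eq
proof (intro conjI)
  have [measurable]: "\<alpha> \<in> borel_measurable M" "\<beta> \<in> borel_measurable M"
    using assms by (auto simp: L2_space_def)
  show "(\<lambda>s. \<alpha> s + \<beta> s) \<in> borel_measurable M" by measurable
  show "integrable M (\<lambda>s. (norm (\<alpha> s + \<beta> s))\<^sup>2)"
  proof (rule Bochner_Integration.integrable_bound)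
    show "integrable M (\<lambda>s. 2 * (norm (\<alpha> s))\<^sup>2 + 2 * (norm (\<beta> s))\<^sup>2)"
      using assms by (auto simp: L2_space_def)
  qed (auto intro!: AE_I2 norm_add_square_le)
qed

lemma L2_space_scale: "\<alpha> \<in> L2_space M \<Longrightarrow> (\<lambda>s. c *\<^sub>R \<alpha> s) \<in> L2_space M"
  by (auto simp: L2_space_def power_mult_distrib)

lemma L2_space_diff:
  "\<alpha> \<in> L2_space M \<Longrightarrow> \<beta> \<in> L2_space M \<Longrightarrow> (\<lambda>s. \<alpha> s - \<beta> s) \<in> L2_space M"
  using L2_space_add[of \<alpha> M "\<lambda>s. (-1) *\<^sub>R \<beta> s"] L2_space_scale[of \<beta> M "-1"] by simp

lemma L2_space_const: "finite_measure M \<Longrightarrow> (\<lambda>s. v) \<in> L2_space M"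
  by (auto simp: L2_space_def finite_measure.integrable_const)

lemma measurable_joint:
  assumes "(\<lambda>(s, x). F s x) \<in> borel_measurable (M \<Otimes>\<^sub>M borel)"
    and "a \<in> measurable N M" and "b \<in> borel_measurable N"
  shows "(\<lambda>\<omega>. F (a \<omega>) (b \<omega>)) \<in> borel_measurable N"
  using measurable_compose[OF measurable_Pair[OF assms(2,3)] assms(1)] by simp

text \<open>For a countable family the least index that comes within \<open>\<delta>\<close> of the
  infimum depends measurably on \<open>s\<close>; this takes the place of a measurable selection.
  Where the infimum is \<open>\<top>\<close> every index qualifies.\<close>

lemma measurable_approx_INF:
  fixes c :: "nat \<Rightarrow> 'a \<Rightarrow> ennreal"
  assumes [measurable]: "\<And>i. c i \<in> borel_measurable M" and \<delta>: "\<delta> > 0"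
  obtains N where "N \<in> measurable M (count_space UNIV)"
    and "\<And>s. c (N s) s \<le> (INF i. c i s) + ennreal \<delta>"
proof
  define N where "N s = (LEAST i. c i s \<le> (INF i. c i s) + ennreal \<delta>)" for s
  show "N \<in> measurable M (count_space UNIV)"
    unfolding N_def by measurable
  fix s
  have "\<exists>i. c i s \<le> (INF i. c i s) + ennreal \<delta>"
  proof (cases "(INF i. c i s) = \<top>")
    case False
    then have "(INF i. c i s) < (INF i. c i s) + ennreal \<delta>"
      using \<delta> by (metis add.right_neutral ennreal_add_left_cancel_less ennreal_less_zero_iff infinity_ennreal_def)
    then show ?thesis unfolding INF_less_iff by (auto intro: less_imp_le)
  qed auto
  then show "c (N s) s \<le> (INF i. c i s) + ennreal \<delta>"
    unfolding N_def by (rule LeastI_ex)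
qed

section \<open>Essential infima of paraboloids\<close>

lemma countable_essential_infimum:
  fixes H :: "'i \<Rightarrow> 'c \<Rightarrow> ennreal"
  assumes M: "finite_measure M" and I: "I \<noteq> {}"
    and meas: "\<And>i. i \<in> I \<Longrightarrow> H i \<in> borel_measurable M"
  obtains u :: "nat \<Rightarrow> 'i" where "range u \<subseteq> I"
    and "\<And>i. i \<in> I \<Longrightarrow> AE s in M. (INF n. H (u n) s) \<le> H i s"
proof -
  interpret finite_measure M by fact
  \<comment> \<open>A sequence \<open>u\<close> maximising \<open>\<Phi>\<close> cannot be improved by adding one more index.\<close>
  define \<Phi> where "\<Phi> u = (\<integral>\<^sup>+ s. (SUP n. en (H (u n) s)) \<partial>M)" for u :: "nat \<Rightarrow> 'i"
  define U where "U = {u :: nat \<Rightarrow> 'i. range u \<subseteq> I}"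
  have U: "U \<noteq> {}" using I by (auto simp: U_def intro!: exI[of _ "\<lambda>_. SOME i. i \<in> I"] some_in_eq[THEN iffD2])
  have meas': "(\<lambda>s. SUP n. en (H (u n) s)) \<in> borel_measurable M" if "u \<in> U" for u
    using that by (intro borel_measurable_SUP measurable_compose[OF meas en_measurable]) (auto simp: U_def)
  obtain w where w: "range w \<subseteq> \<Phi> ` U" "(SUP n::nat. w n) = Sup (\<Phi> ` U)"
    using ennreal_Sup_countable_SUP[of "\<Phi> ` U"] U by (metis image_is_empty)
  then have "\<forall>n. \<exists>u\<in>U. w n = \<Phi> u" by auto
  then obtain us where us: "\<And>n. us n \<in> U" "\<And>n. w n = \<Phi> (us n)" by metis
  \<comment> \<open>One sequence enumerating all members of all \<open>us n\<close>; its value of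
    \<open>\<Phi>\<close> is therefore at least each \<open>w n\<close>, so the supremum is
    attained.\<close>
  define u where "u n = us (fst (prod_decode n)) (snd (prod_decode n))" for n
  have u: "u \<in> U" using us(1) by (auto simp: U_def u_def image_subset_iff)
  have "\<Phi> (us n) \<le> \<Phi> u" for n
    unfolding \<Phi>_def
  proof (intro nn_integral_mono SUP_least)
    fix s m show "en (H (us n m) s) \<le> (SUP n. en (H (u n) s))"
      by (rule SUP_upper2[of "prod_encode (n, m)"]) (auto simp: u_def)
  qed
  then have top: "\<Phi> v \<le> \<Phi> u" if "v \<in> U" for v
    using that w us(2) by (metis SUP_least SUP_upper order_trans)
  have fin: "\<Phi> v \<noteq> \<infinity>" for v
  proof -
    have "\<Phi> v \<le> (\<integral>\<^sup>+ s. 1 \<partial>M)"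
      unfolding \<Phi>_def by (intro nn_integral_mono SUP_least en_le_1)
    then show ?thesis using emeasure_finite[of "space M"] by (auto simp: top_unique)
  qed
  show ?thesis
  proof
    show "range u \<subseteq> I" using u by (simp add: U_def)
    fix i assume i: "i \<in> I"
    define v where "v n = (case n of 0 \<Rightarrow> i | Suc m \<Rightarrow> u m)" for n
    have v: "v \<in> U" using u i by (auto simp: U_def v_def image_subset_iff split: nat.split)
    have uv: "(SUP n. en (H (u n) s)) \<le> (SUP n. en (H (v n) s))" for s
    proof (rule SUP_least)
      fix n show "en (H (u n) s) \<le> (SUP n. en (H (v n) s))"
        by (rule SUP_upper2[of "Suc n"]) (auto simp: v_def)
    qed
    \<comment> \<open>\<open>v\<close> is \<open>u\<close> with \<open>i\<close> put in front. A
      gain on a set of positive measure would make \<open>\<Phi> v\<close> strictly larger than the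
      maximum \<open>\<Phi> u\<close>; this uses that \<open>\<Phi> u\<close> is finite, which the
      bound \<open>en \<le> 1\<close> guarantees.\<close>
    have "AE s in M. (SUP n. en (H (v n) s)) \<le> (SUP n. en (H (u n) s))"
    proof (rule ccontr)
      assume "\<not> ?thesis"
      then have "\<Phi> u < \<Phi> v"
        unfolding \<Phi>_def using fin[of u] uv by (intro nn_integral_less meas' u v) (auto simp: \<Phi>_def)
      then show False using top[OF v] by simp
    qed
    then show "AE s in M. (INF n. H (u n) s) \<le> H i s"
    proof eventually_elim
      case (elim s)
      have "en (H i s) \<le> (SUP n. en (H (v n) s))"
        by (rule SUP_upper2[of 0]) (auto simp: v_def)
      also have "\<dots> \<le> en (INF n. H (u n) s)" using elim by (simp add: en_INF)
      finally show ?case by (simp add: en_le_iff)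
    qed
  qed
qed

text \<open>The inf-convolution with \<open>k / 2 |\<cdot>|\<^sup>2\<close> of the function with values \<open>c i\<close> at the points \<open>y i\<close>
  and \<open>\<infinity>\<close> elsewhere.\<close>

definition env :: "real \<Rightarrow> (nat \<Rightarrow> ennreal) \<Rightarrow> (nat \<Rightarrow> 'v::euclidean_space) \<Rightarrow> 'v \<Rightarrow> ennreal" where
  "env k c y x = (INF i. c i + ennreal (k / 2 * (norm (x - y i))\<^sup>2))"

text \<open>Young's inequality with a free weight. Letting \<open>\<eta>\<close> tend to 0 brings
  the first factor to 1, which yields sharp bounds in a limit; \<open>\<eta> = 1\<close> gives
  quadratic growth.\<close>

lemma norm_add_square_le_weighted:
  fixes a b :: "'v::real_inner"
  assumes "\<eta> > 0"
  shows "(norm (a + b))\<^sup>2 \<le> (1 + \<eta>) * (norm a)\<^sup>2 + (1 + 1 / \<eta>) * (norm b)\<^sup>2"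
proof -
  have "0 \<le> (norm (sqrt \<eta> *\<^sub>R a - (1 / sqrt \<eta>) *\<^sub>R b))\<^sup>2" by simp
  also have "\<dots> = \<eta> * (a \<bullet> a) - 2 * (a \<bullet> b) + (1 / \<eta>) * (b \<bullet> b)"
    unfolding power2_norm_eq_inner using assms
    by (simp add: inner_simps inner_commute algebra_simps flip: mult.assoc)
  finally show ?thesis
    unfolding power2_norm_eq_inner by (simp add: inner_simps inner_commute algebra_simps)
qed

lemma INF_cmult_ennreal:
  fixes t :: "nat \<Rightarrow> ennreal"
  assumes "a > 0"
  shows "(INF i. ennreal a * t i) = ennreal a * (INF i. t i)"
proof (rule antisym)
  have inv: "ennreal a * ennreal (1 / a) = 1" using assms by (simp flip: ennreal_mult)
  have "ennreal (1 / a) * (INF i. ennreal a * t i) \<le> (INF i. t i)"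
  proof (rule INF_greatest)
    fix j
    have "ennreal (1 / a) * (INF i. ennreal a * t i) \<le> ennreal (1 / a) * (ennreal a * t j)"
      by (intro mult_left_mono INF_lower) auto
    also have "\<dots> = t j" using inv by (simp add: mult.assoc[symmetric] mult.commute)
    finally show "ennreal (1 / a) * (INF i. ennreal a * t i) \<le> t j" .
  qed
  then have "ennreal a * (ennreal (1 / a) * (INF i. ennreal a * t i)) \<le> ennreal a * (INF i. t i)"
    by (rule mult_left_mono) simp
  then show "(INF i. ennreal a * t i) \<le> ennreal a * (INF i. t i)"
    using inv by (simp add: mult.assoc[symmetric])
  show "ennreal a * (INF i. t i) \<le> (INF i. ennreal a * t i)"
    by (intro INF_greatest mult_left_mono INF_lower) auto
qed

text \<open>The points \<open>y i\<close> may be unbounded, so moving the argument changes the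
  paraboloids by amounts that are not uniform in \<open>i\<close>. The factor
  \<open>1 + \<eta>\<close> absorbs this, and infinite values are covered.\<close>

lemma env_perturb:
  assumes k: "k > 0" and \<eta>: "\<eta> > 0"
  shows "env k c y x \<le> ennreal (1 + \<eta>) * env k c y x'
    + ennreal ((1 + 1 / \<eta>) * (k / 2 * (norm (x - x'))\<^sup>2))"
proof -
  have "env k c y x \<le> ennreal (1 + \<eta>) * (c i + ennreal (k / 2 * (norm (x' - y i))\<^sup>2))
      + ennreal ((1 + 1 / \<eta>) * (k / 2 * (norm (x - x'))\<^sup>2))" for i
  proof -
    have "(norm (x - y i))\<^sup>2 \<le> (1 + \<eta>) * (norm (x' - y i))\<^sup>2 + (1 + 1 / \<eta>) * (norm (x - x'))\<^sup>2"
      using norm_add_square_le_weighted[OF \<eta>, of "x' - y i" "x - x'"] by simp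
    then have "k / 2 * (norm (x - y i))\<^sup>2
        \<le> k / 2 * ((1 + \<eta>) * (norm (x' - y i))\<^sup>2 + (1 + 1 / \<eta>) * (norm (x - x'))\<^sup>2)"
      using k by (intro mult_left_mono) auto
    then have *: "k / 2 * (norm (x - y i))\<^sup>2
        \<le> (1 + \<eta>) * (k / 2 * (norm (x' - y i))\<^sup>2) + (1 + 1 / \<eta>) * (k / 2 * (norm (x - x'))\<^sup>2)"
      by (simp add: distrib_left mult.left_commute)
    have c: "1 * c i \<le> ennreal (1 + \<eta>) * c i"
      using \<eta> by (intro mult_right_mono) (simp_all flip: ennreal_1)
    have "env k c y x \<le> c i + ennreal (k / 2 * (norm (x - y i))\<^sup>2)"
      unfolding env_def by (rule INF_lower) simp
    also have "\<dots> \<le> ennreal (1 + \<eta>) * c i + (ennreal (1 + \<eta>) * ennreal (k / 2 * (norm (x' - y i))\<^sup>2)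
        + ennreal ((1 + 1 / \<eta>) * (k / 2 * (norm (x - x'))\<^sup>2)))"
      using c * k \<eta> by (intro add_mono) (auto simp flip: ennreal_mult ennreal_plus intro!: ennreal_leI)
    finally show ?thesis by (simp add: distrib_left add.assoc)
  qed
  then have "env k c y x \<le> (INF i. ennreal (1 + \<eta>) * (c i + ennreal (k / 2 * (norm (x' - y i))\<^sup>2))
      + ennreal ((1 + 1 / \<eta>) * (k / 2 * (norm (x - x'))\<^sup>2)))"
    by (rule INF_greatest)
  also have "\<dots> = ennreal (1 + \<eta>) * env k c y x'
      + ennreal ((1 + 1 / \<eta>) * (k / 2 * (norm (x - x'))\<^sup>2))"
    unfolding env_def INF_ennreal_add_const using \<eta> by (subst INF_cmult_ennreal) simp_all
  finally show ?thesis .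
qed

lemma ennreal_le_mult_epsilon:
  assumes "\<And>\<eta>. \<eta> > 0 \<Longrightarrow> e \<le> ennreal ((1 + \<eta>) * R)" and "R \<ge> 0"
  shows "e \<le> ennreal R"
proof (rule ennreal_le_epsilon)
  fix \<epsilon> :: real assume "0 < \<epsilon>"
  have "e \<le> ennreal ((1 + \<epsilon> / (R + 1)) * R)"
    using \<open>0 < \<epsilon>\<close> assms(2) by (intro assms(1)) (simp add: field_simps)
  also have "\<dots> \<le> ennreal (R + \<epsilon>)"
    using \<open>0 < \<epsilon>\<close> assms(2) by (intro ennreal_leI) (simp add: field_simps)
  finally show "e \<le> ennreal R + ennreal \<epsilon>"
    using \<open>0 < \<epsilon>\<close> assms(2) by simp
qed

text \<open>Continuity of the extended-valued envelope is bypassed: \<open>env_perturb\<close> moves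
  the bound from \<open>d j\<close> to \<open>x\<close> at the price of a function of
  \<open>d j\<close> that is continuous, so the bound survives passage to \<open>x\<close>, where
  the price reduces to the factor \<open>1 + \<eta>\<close>.\<close>

lemma env_le_dense:
  fixes d :: "nat \<Rightarrow> 'v::euclidean_space"
  assumes k: "k > 0" and d: "closure (range d) = UNIV"
    and le: "\<And>j. env k c y (d j) \<le> r + ennreal (k / 2 * (norm (d j - z))\<^sup>2)"
  shows "env k c y x \<le> r + ennreal (k / 2 * (norm (x - z))\<^sup>2)"
proof (cases r)
  case (real r')
  have "env k c y x \<le> ennreal ((1 + \<eta>) * (r' + k / 2 * (norm (x - z))\<^sup>2))" if \<eta>: "\<eta> > 0" for \<eta>
  proof -
    define \<phi> where "\<phi> x' = (1 + \<eta>) * (r' + k / 2 * (norm (x' - z))\<^sup>2)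
      + (1 + 1 / \<eta>) * (k / 2 * (norm (x - x'))\<^sup>2)" for x'
    have "closed {x'. env k c y x \<le> ennreal (\<phi> x')}"
      unfolding \<phi>_def by (intro closed_Collect_le continuous_on_const continuous_on_ennreal continuous_intros)
    moreover have "range d \<subseteq> {x'. env k c y x \<le> ennreal (\<phi> x')}"
    proof safe
      fix j
      have "env k c y x \<le> ennreal (1 + \<eta>) * env k c y (d j)
          + ennreal ((1 + 1 / \<eta>) * (k / 2 * (norm (x - d j))\<^sup>2))"
        by (rule env_perturb[OF k \<eta>])
      also have "\<dots> \<le> ennreal (1 + \<eta>) * (r + ennreal (k / 2 * (norm (d j - z))\<^sup>2))
          + ennreal ((1 + 1 / \<eta>) * (k / 2 * (norm (x - d j))\<^sup>2))"
        by (intro add_mono mult_left_mono le) auto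
      also have "\<dots> = ennreal (\<phi> (d j))"
        unfolding \<phi>_def using real k \<eta> by (simp flip: ennreal_mult ennreal_plus)
      finally show "env k c y x \<le> ennreal (\<phi> (d j))" .
    qed
    ultimately have "x \<in> {x'. env k c y x \<le> ennreal (\<phi> x')}"
      using d closure_minimal by (metis UNIV_I subsetD)
    then show ?thesis by (simp add: \<phi>_def)
  qed
  moreover have "0 \<le> r' + k / 2 * (norm (x - z))\<^sup>2"
    using k real by simp
  ultimately have "env k c y x \<le> ennreal (r' + k / 2 * (norm (x - z))\<^sup>2)"
    by (rule ennreal_le_mult_epsilon)
  then show ?thesis using real k by simp
qed simp

text \<open>The sequence will be the set of admissible drifts of one step; containing 0 makes the
  absence of drift admissible.\<close>

lemma dense_sequence:
  obtains d :: "nat \<Rightarrow> 'v::euclidean_space" where "closure (range d) = UNIV" "d 0 = 0"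
proof -
  obtain D :: "'v set" where D: "countable D" "\<And>X. open X \<Longrightarrow> X \<noteq> {} \<Longrightarrow> \<exists>d \<in> D. d \<in> X"
    using countable_dense_exists by blast
  define d where "d n = (case n of 0 \<Rightarrow> 0 | Suc m \<Rightarrow> from_nat_into D m)" for n
  have sub: "D \<subseteq> range d"
  proof
    fix e assume "e \<in> D"
    then obtain m where "e = from_nat_into D m" using from_nat_into_surj[OF D(1)] by metis
    then have "e = d (Suc m)" by (simp add: d_def)
    then show "e \<in> range d" by simp
  qed
  have "closure (range d) = UNIV"
  proof (rule ccontr)
    assume "closure (range d) \<noteq> UNIV"
    then have "- closure (range d) \<noteq> {}" by auto
    then obtain e where "e \<in> D" "e \<in> - closure (range d)" using D(2)[of "- closure (range d)"] by auto
    then show False using sub closure_subset[of "range d"] by auto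
  qed
  then show ?thesis using that by (simp add: d_def)
qed

text \<open>Essential infima are taken at the points of a dense sequence only and their countable
  index families are merged. For fixed \<open>i\<close> countably many null sets occur, and
  \<open>env_le_dense\<close> extends the inequality off their union to every
  \<open>x\<close>.\<close>

lemma essential_envelope:
  fixes c :: "'i \<Rightarrow> 'c \<Rightarrow> ennreal" and Y :: "'i \<Rightarrow> 'c \<Rightarrow> 'v::euclidean_space"
  assumes M: "finite_measure M" and I: "I \<noteq> {}" and k: "k > 0"
    and c: "\<And>i. i \<in> I \<Longrightarrow> c i \<in> borel_measurable M"
    and Y: "\<And>i. i \<in> I \<Longrightarrow> Y i \<in> borel_measurable M"
  obtains u :: "nat \<Rightarrow> 'i" where "range u \<subseteq> I"
    and "\<And>i. i \<in> I \<Longrightarrow> AE s in M. \<forall>x. env k (\<lambda>n. c (u n) s) (\<lambda>n. Y (u n) s) x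
            \<le> c i s + ennreal (k / 2 * (norm (x - Y i s))\<^sup>2)"
proof -
  obtain d :: "nat \<Rightarrow> 'v" where d: "closure (range d) = UNIV" using dense_sequence by blast
  define H where "H x i s = c i s + ennreal (k / 2 * (norm (x - Y i s))\<^sup>2)" for x i s
  have H: "H x i \<in> borel_measurable M" if "i \<in> I" for x i
    using c[OF that] Y[OF that] unfolding H_def by measurable
  have "\<exists>u::nat \<Rightarrow> 'i. range u \<subseteq> I \<and> (\<forall>i\<in>I. AE s in M. (INF n. H (d j) (u n) s) \<le> H (d j) i s)" for j
    by (rule countable_essential_infimum[OF M I, of "H (d j)"]) (auto intro: H)
  then obtain us :: "nat \<Rightarrow> nat \<Rightarrow> 'i" where us: "\<And>j. range (us j) \<subseteq> I"
    "\<And>j i. i \<in> I \<Longrightarrow> AE s in M. (INF n. H (d j) (us j n) s) \<le> H (d j) i s"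
    by metis
  define u where "u n = us (fst (prod_decode n)) (snd (prod_decode n))" for n
  have le: "(INF n. H x (u n) s) \<le> (INF n. H x (us j n) s)" for x s j
  proof (rule INF_greatest)
    fix n show "(INF n. H x (u n) s) \<le> H x (us j n) s"
      by (rule INF_lower2[of "prod_encode (j, n)"]) (auto simp: u_def)
  qed
  show ?thesis
  proof
    show "range u \<subseteq> I" using us(1) by (auto simp: u_def image_subset_iff)
    fix i assume i: "i \<in> I"
    then have "AE s in M. \<forall>j. (INF n. H (d j) (us j n) s) \<le> H (d j) i s"
      using us(2) by (simp add: AE_all_countable)
    then show "AE s in M. \<forall>x. env k (\<lambda>n. c (u n) s) (\<lambda>n. Y (u n) s) x
            \<le> c i s + ennreal (k / 2 * (norm (x - Y i s))\<^sup>2)"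
    proof eventually_elim
      case (elim s)
      have "env k (\<lambda>n. c (u n) s) (\<lambda>n. Y (u n) s) (d j) \<le> c i s + ennreal (k / 2 * (norm (d j - Y i s))\<^sup>2)" for j
      proof -
        have "env k (\<lambda>n. c (u n) s) (\<lambda>n. Y (u n) s) (d j) = (INF n. H (d j) (u n) s)"
          by (simp add: env_def H_def)
        also have "\<dots> \<le> H (d j) i s" using le elim order_trans by blast
        finally show ?thesis by (simp only: H_def)
      qed
      then show ?case using env_le_dense[OF k d] by blast
    qed
  qed
qed

lemma env_joint_measurable:
  fixes c :: "nat \<Rightarrow> 'c \<Rightarrow> ennreal" and y :: "nat \<Rightarrow> 'c \<Rightarrow> 'v::euclidean_space"
  assumes [measurable]: "\<And>i. c i \<in> borel_measurable M" "\<And>i. y i \<in> borel_measurable M"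
  shows "(\<lambda>(s, x). env k (\<lambda>i. c i s) (\<lambda>i. y i s) x) \<in> borel_measurable (M \<Otimes>\<^sub>M borel)"
  unfolding env_def by measurable

section \<open>Soft and controlled Gaussian averages\<close>

definition soft_avg :: "real \<Rightarrow> ('v::euclidean_space \<Rightarrow> ennreal) \<Rightarrow> 'v \<Rightarrow> ennreal" where
  "soft_avg h \<phi> x = nlog (\<integral>\<^sup>+ z. en (\<phi> (x + z)) \<partial>gauss h)"

text \<open>The drift is constant during a step and ranges over a sequence instead of the whole
  space, so that the infimum is measurable and has measurable near-minimisers.\<close>

definition ctrl_avg :: "(nat \<Rightarrow> 'v) \<Rightarrow> real \<Rightarrow> ('v::euclidean_space \<Rightarrow> ennreal) \<Rightarrow> 'v \<Rightarrow> ennreal" where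
  "ctrl_avg d h \<phi> x = (INF i. (\<integral>\<^sup>+ z. \<phi> (x + d i + z) \<partial>gauss h) + ennreal ((norm (d i))\<^sup>2 / (2 * h)))"

lemma nn_integral_en_le_1: "h > 0 \<Longrightarrow> (\<integral>\<^sup>+ z. en (\<phi> (x + z)) \<partial>(gauss h :: 'v::euclidean_space measure)) \<le> 1"
proof -
  assume h: "h > 0"
  interpret prob_space "gauss h :: 'v measure" by (rule prob_space_gauss[OF h])
  have "(\<integral>\<^sup>+ z. en (\<phi> (x + z)) \<partial>(gauss h :: 'v measure)) \<le> (\<integral>\<^sup>+ z. 1 \<partial>(gauss h :: 'v measure))"
    by (intro nn_integral_mono en_le_1)
  then show ?thesis using emeasure_space_1 by simp
qed

lemma en_soft_avg: "h > 0 \<Longrightarrow> en (soft_avg h \<phi> x) = (\<integral>\<^sup>+ z. en (\<phi> (x + z)) \<partial>gauss h)"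
  unfolding soft_avg_def by (rule en_nlog) (rule nn_integral_en_le_1)

text \<open>Jensen's inequality, from the tangent line of \<open>exp (- w)\<close> at the mean
  \<open>m\<close>. The tangent is replaced by its positive part so that the right-hand side can be
  a nonnegative integral, finite or not.\<close>

lemma exp_integral_le_nn_integral:
  assumes "prob_space M" and W: "integrable M W"
  shows "ennreal (exp (- (\<integral>x. W x \<partial>M))) \<le> (\<integral>\<^sup>+ x. ennreal (exp (- W x)) \<partial>M)"
proof -
  interpret prob_space M by fact
  define m where "m = (\<integral>x. W x \<partial>M)"
  have i: "integrable M (\<lambda>x. exp (- m) * (1 - (W x - m)))" using W by simp
  have "exp (- m) * (1 - (w - m)) \<le> exp (- w)" for w
  proof -
    have "exp (- m) * (1 - (w - m)) \<le> exp (- m) * exp (- (w - m))"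
      using exp_ge_add_one_self[of "- (w - m)"] by (intro mult_left_mono) (simp_all del: minus_diff_eq)
    then show ?thesis by (simp add: mult_exp_exp)
  qed
  then have le: "ennreal (max 0 (exp (- m) * (1 - (W x - m)))) \<le> ennreal (exp (- W x))" for x
    by (intro ennreal_leI) simp
  have "exp (- m) = (\<integral>x. exp (- m) * (1 - (W x - m)) \<partial>M)"
    using W by (simp add: m_def prob_space)
  also have "\<dots> \<le> (\<integral>x. max 0 (exp (- m) * (1 - (W x - m))) \<partial>M)"
    using i by (intro integral_mono integrable_max) auto
  finally have "ennreal (exp (- m)) \<le> ennreal (\<integral>x. max 0 (exp (- m) * (1 - (W x - m))) \<partial>M)"
    by (rule ennreal_leI)
  also have "\<dots> = (\<integral>\<^sup>+ x. ennreal (max 0 (exp (- m) * (1 - (W x - m)))) \<partial>M)"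
    using i by (intro nn_integral_eq_integral[symmetric] integrable_max) auto
  also have "\<dots> \<le> (\<integral>\<^sup>+ x. ennreal (exp (- W x)) \<partial>M)"
    by (intro nn_integral_mono le)
  finally show ?thesis by (simp add: m_def)
qed

text \<open>Gibbs' variational principle, tested with the translate of \<open>gauss h\<close> by \<open>v\<close>, whose relative
  entropy is \<open>|v|\<^sup>2 / (2 h)\<close>.\<close>

lemma soft_avg_le_shifted_average:
  fixes v :: "'v::euclidean_space"
  assumes h: "h > 0" and [measurable]: "\<phi> \<in> borel_measurable borel"
  shows "soft_avg h \<phi> x \<le> (\<integral>\<^sup>+ z. \<phi> (x + v + z) \<partial>gauss h) + ennreal ((norm v)\<^sup>2 / (2 * h))"
proof (cases "(\<integral>\<^sup>+ z. \<phi> (x + v + z) \<partial>gauss h) = \<infinity>")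
  case False
  interpret prob_space "gauss h :: 'v measure" by (rule prob_space_gauss[OF h])
  define w where "w z = enn2real (\<phi> (x + v + z))" for z
  have [measurable]: "w \<in> borel_measurable borel" unfolding w_def by measurable
  have fin: "AE z in gauss h. \<phi> (x + v + z) = ennreal (w z)"
    using nn_integral_noteq_infinite[OF _ False] unfolding w_def by (auto simp: less_top)
  have I: "(\<integral>\<^sup>+ z. ennreal (w z) \<partial>gauss h) = (\<integral>\<^sup>+ z. \<phi> (x + v + z) \<partial>gauss h)"
    using fin by (intro nn_integral_cong_AE) auto
  have w: "integrable (gauss h) w"
    using False by (intro integrableI_nonneg) (auto simp: I less_top, simp add: w_def)
  \<comment> \<open>Minus the logarithm of the integrand after the shift by \<open>v\<close>. Its
    linear term has mean zero, so its mean is exactly the cost of the drift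
    \<open>v\<close>.\<close>
  define W where "W z = w z + (z \<bullet> v) / h + (norm v)\<^sup>2 / (2 * h)" for z
  have W: "integrable (gauss h) W"
    unfolding W_def using w integrable_gauss_inner[OF h, of v] by simp
  have IW: "(\<integral>z. W z \<partial>gauss h) = (\<integral>z. w z \<partial>gauss h) + (norm v)\<^sup>2 / (2 * h)"
    unfolding W_def using w integrable_gauss_inner[OF h, of v] prob_space
    by (simp add: integral_gauss_inner[OF h])
  have "(\<integral>\<^sup>+ z. en (\<phi> (x + z)) \<partial>gauss h) = (\<integral>\<^sup>+ z. en (\<phi> (x + (z + v)))
      * ennreal (exp (- (z \<bullet> v / h) - (norm v)\<^sup>2 / (2 * h))) \<partial>gauss h)"
    by (rule nn_integral_gauss_shift[OF h]) simp
  also have "\<dots> = (\<integral>\<^sup>+ z. ennreal (exp (- W z)) \<partial>gauss h)"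
  proof (rule nn_integral_cong_AE)
    show "AE z in gauss h. en (\<phi> (x + (z + v))) * ennreal (exp (- (z \<bullet> v / h) - (norm v)\<^sup>2 / (2 * h)))
        = ennreal (exp (- W z))"
      using fin
    proof eventually_elim
      case (elim z)
      then have "\<phi> (x + (z + v)) = ennreal (w z)"
        by (simp add: add_ac)
      then have "en (\<phi> (x + (z + v))) = ennreal (exp (- w z))"
        by (simp only:) (simp add: w_def)
      then show ?case
        by (simp add: W_def mult_exp_exp algebra_simps flip: ennreal_mult)
    qed
  qed
  finally have "en (ennreal (\<integral>z. W z \<partial>gauss h)) \<le> (\<integral>\<^sup>+ z. en (\<phi> (x + z)) \<partial>gauss h)"
    using exp_integral_le_nn_integral[OF prob_space_axioms W] h
    by (subst en_ennreal) (auto simp: IW w_def)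
  then have "soft_avg h \<phi> x \<le> ennreal (\<integral>z. W z \<partial>gauss h)"
    by (simp add: soft_avg_def nlog_le_iff)
  also have "\<dots> = ennreal (\<integral>z. w z \<partial>gauss h) + ennreal ((norm v)\<^sup>2 / (2 * h))"
    unfolding IW using h by (intro ennreal_plus) (auto simp: w_def)
  also have "ennreal (\<integral>z. w z \<partial>gauss h) = (\<integral>\<^sup>+ z. \<phi> (x + v + z) \<partial>gauss h)"
    unfolding I[symmetric] by (rule nn_integral_eq_integral[symmetric, OF w]) (simp add: w_def)
  finally show ?thesis .
qed simp

lemma soft_avg_mono: "(\<And>x. \<phi> x \<le> \<psi> x) \<Longrightarrow> soft_avg h \<phi> x \<le> soft_avg h \<psi> x"
  unfolding soft_avg_def by (intro nlog_antimono nn_integral_mono) (simp add: en_le_iff)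

lemma ctrl_avg_mono: "(\<And>x. \<phi> x \<le> \<psi> x) \<Longrightarrow> ctrl_avg d h \<phi> x \<le> ctrl_avg d h \<psi> x"
  unfolding ctrl_avg_def by (intro INF_mono' add_mono nn_integral_mono) auto

section \<open>Joint measurability and the semigroup property\<close>

lemma soft_avg_joint_measurable:
  fixes G :: "'b \<Rightarrow> 'v::euclidean_space \<Rightarrow> ennreal"
  assumes h: "h > 0" and G: "(\<lambda>(t, x). G t x) \<in> borel_measurable (M \<Otimes>\<^sub>M borel)"
  shows "(\<lambda>(t, x). soft_avg h (G t) x) \<in> borel_measurable (M \<Otimes>\<^sub>M borel)"
proof -
  interpret sigma_finite_measure "gauss h :: 'v measure" by (rule sigma_finite_gauss[OF h])
  have Gm: "(\<lambda>p. G (fst (fst p)) (snd (fst p) + snd p)) \<in> borel_measurable ((M \<Otimes>\<^sub>M borel) \<Otimes>\<^sub>M gauss h)"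
    by (rule measurable_joint[OF G]) auto
  show ?thesis unfolding soft_avg_def case_prod_beta'
    by (intro measurable_compose[OF _ nlog_measurable] borel_measurable_nn_integral)
      (auto simp: case_prod_beta' intro!: measurable_compose[OF Gm en_measurable])
qed

lemma ctrl_avg_joint_measurable:
  fixes F :: "'b \<Rightarrow> 'v::euclidean_space \<Rightarrow> ennreal"
  assumes h: "h > 0" and F: "(\<lambda>(s, x). F s x) \<in> borel_measurable (M \<Otimes>\<^sub>M borel)"
  shows "(\<lambda>(s, x). ctrl_avg d h (F s) x) \<in> borel_measurable (M \<Otimes>\<^sub>M borel)"
proof -
  interpret sigma_finite_measure "gauss h :: 'v measure" by (rule sigma_finite_gauss[OF h])
  have "(\<lambda>p. F (fst (fst p)) (snd (fst p) + d i + snd p)) \<in> borel_measurable ((M \<Otimes>\<^sub>M borel) \<Otimes>\<^sub>M gauss h)" for i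
    by (rule measurable_joint[OF F]) auto
  then show ?thesis unfolding ctrl_avg_def case_prod_beta'
    by (intro borel_measurable_INF borel_measurable_add borel_measurable_nn_integral)
      (auto simp: case_prod_beta')
qed

lemma measurable_section:
  "(\<lambda>(s, x). F s x) \<in> borel_measurable (M \<Otimes>\<^sub>M N) \<Longrightarrow> s \<in> space M \<Longrightarrow> F s \<in> borel_measurable N"
  using measurable_Pair2[of "\<lambda>(s, x). F s x" M N borel s] by simp

lemma soft_avg_semigroup:
  assumes h: "h > 0" "k > 0" and [measurable]: "\<phi> \<in> borel_measurable borel"
  shows "soft_avg h (soft_avg k \<phi>) x = soft_avg (h + k) \<phi> x"
proof -
  have "(\<integral>\<^sup>+ z. en (soft_avg k \<phi> (x + z)) \<partial>gauss h) = (\<integral>\<^sup>+ z. (\<integral>\<^sup>+ w. en (\<phi> (x + (z + w))) \<partial>gauss k) \<partial>gauss h)"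
    by (simp add: en_soft_avg h add.assoc)
  also have "\<dots> = (\<integral>\<^sup>+ z. en (\<phi> (x + z)) \<partial>gauss (h + k))"
    by (rule nn_integral_gauss_convolution[OF h]) simp
  finally show ?thesis by (simp add: soft_avg_def)
qed

text \<open>At least one step is taken because \<open>gauss 0\<close> is not the point mass at 0:
  division by zero makes its density vanish.\<close>

lemma soft_avg_iterate:
  assumes h: "h > 0" and [measurable]: "\<phi> \<in> borel_measurable borel"
  shows "(soft_avg h ^^ Suc N) \<phi> = soft_avg (real (Suc N) * h) \<phi>"
proof (induction N)
  case (Suc N)
  have "(soft_avg h ^^ Suc (Suc N)) \<phi> = soft_avg h (soft_avg (real (Suc N) * h) \<phi>)"
    using Suc by simp
  also have "\<dots> = soft_avg (h + real (Suc N) * h) \<phi>"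
    by (intro ext soft_avg_semigroup) (use h in auto)
  finally show ?case by (simp add: algebra_simps)
qed simp

section \<open>Inequalities transported by a contraction\<close>

text \<open>The operator acts on representatives, hence the identities almost everywhere. The
  contraction property is put in terms of squared norms because these are the costs to be
  compared.\<close>

locale L2_contraction = M1: finite_measure M1 + M2: finite_measure M2
  for M1 :: "'a measure" and M2 :: "'b measure" +
  fixes A :: "('a \<Rightarrow> 'v::euclidean_space) \<Rightarrow> 'b \<Rightarrow> 'v"
  assumes A_L2: "\<alpha> \<in> L2_space M1 \<Longrightarrow> A \<alpha> \<in> L2_space M2"
    and A_add: "\<alpha> \<in> L2_space M1 \<Longrightarrow> \<beta> \<in> L2_space M1 \<Longrightarrow> AE t in M2. A (\<lambda>s. \<alpha> s + \<beta> s) t = A \<alpha> t + A \<beta> t"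
    and A_scale: "\<alpha> \<in> L2_space M1 \<Longrightarrow> AE t in M2. A (\<lambda>s. c *\<^sub>R \<alpha> s) t = c *\<^sub>R A \<alpha> t"
    and A_const: "AE t in M2. A (\<lambda>s. v) t = v"
    and A_contraction: "\<alpha> \<in> L2_space M1 \<Longrightarrow>
      (\<integral>\<^sup>+ t. ennreal ((norm (A \<alpha> t))\<^sup>2) \<partial>M2) \<le> (\<integral>\<^sup>+ s. ennreal ((norm (\<alpha> s))\<^sup>2) \<partial>M1)"
begin

definition dominated :: "('b \<Rightarrow> 'v \<Rightarrow> ennreal) \<Rightarrow> ('a \<Rightarrow> 'v \<Rightarrow> ennreal) \<Rightarrow> bool" where
  "dominated G F \<longleftrightarrow>
    (\<forall>\<alpha>\<in>L2_space M1. (\<integral>\<^sup>+ t. G t (A \<alpha> t) \<partial>M2) \<le> (\<integral>\<^sup>+ s. F s (\<alpha> s) \<partial>M1))"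

lemma A_measurable: "\<alpha> \<in> L2_space M1 \<Longrightarrow> A \<alpha> \<in> borel_measurable M2"
  using A_L2 L2_space_measurable by blast

lemma A_diff:
  assumes "\<alpha> \<in> L2_space M1" "\<beta> \<in> L2_space M1"
  shows "AE t in M2. A (\<lambda>s. \<alpha> s - \<beta> s) t = A \<alpha> t - A \<beta> t"
  using A_add[OF assms(1) L2_space_scale[OF assms(2), of "-1"]] A_scale[OF assms(2), of "-1"]
  by eventually_elim simp

lemma A_contraction_scaled:
  assumes "\<alpha> \<in> L2_space M1" "c \<ge> 0"
  shows "(\<integral>\<^sup>+ t. ennreal (c * (norm (A \<alpha> t))\<^sup>2) \<partial>M2) \<le> (\<integral>\<^sup>+ s. ennreal (c * (norm (\<alpha> s))\<^sup>2) \<partial>M1)"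
proof -
  have [measurable]: "\<alpha> \<in> borel_measurable M1" "A \<alpha> \<in> borel_measurable M2"
    using assms A_measurable L2_space_measurable by auto
  show ?thesis
    using mult_left_mono[OF A_contraction[OF assms(1)], of "ennreal c"] assms(2)
    by (simp add: ennreal_mult nn_integral_cmult)
qed

text \<open>A drift of finite total cost is automatically square integrable, so \<open>A\<close> may
  be applied to it.\<close>

lemma L2_space_of_cost:
  assumes [measurable]: "v \<in> borel_measurable M1" and c: "c > 0"
    and fin: "(\<integral>\<^sup>+ s. \<phi> s + ennreal (c * (norm (v s))\<^sup>2) \<partial>M1) < \<infinity>"
  shows "v \<in> L2_space M1"
proof -
  have "ennreal c * (\<integral>\<^sup>+ s. ennreal ((norm (v s))\<^sup>2) \<partial>M1) = (\<integral>\<^sup>+ s. ennreal (c * (norm (v s))\<^sup>2) \<partial>M1)"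
    using c by (simp add: nn_integral_cmult ennreal_mult)
  also have "\<dots> \<le> (\<integral>\<^sup>+ s. \<phi> s + ennreal (c * (norm (v s))\<^sup>2) \<partial>M1)"
    by (intro nn_integral_mono) (simp add: add_increasing)
  finally have "ennreal c * (\<integral>\<^sup>+ s. ennreal ((norm (v s))\<^sup>2) \<partial>M1) < \<infinity>"
    using fin by (rule le_less_trans)
  then show ?thesis
    using c by (auto simp: L2_space_iff ennreal_mult_less_top)
qed

lemma le_of_approximations:
  assumes "\<And>\<delta>. \<delta> > 0 \<Longrightarrow> a \<le> b + ennreal \<delta> * emeasure M1 (space M1)"
  shows "a \<le> b"
proof (rule ennreal_le_epsilon)
  fix e :: real assume e: "0 < e"
  define \<delta> where "\<delta> = e / (measure M1 (space M1) + 1)"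
  have \<delta>: "\<delta> > 0" using e by (simp add: \<delta>_def add_nonneg_pos)
  have "\<delta> * measure M1 (space M1) \<le> e"
    using e by (simp add: \<delta>_def divide_simps add_nonneg_pos mult_left_mono)
  then have "ennreal \<delta> * emeasure M1 (space M1) \<le> ennreal e"
    using \<delta> by (simp add: M1.emeasure_eq_measure ennreal_leI flip: ennreal_mult)
  then show "a \<le> b + ennreal e"
    using assms[OF \<delta>] by (meson add_left_mono order_trans)
qed

text \<open>The near-optimal drift for \<open>F\<close> takes values in the range of
  \<open>d\<close>, but \<open>A v\<close> in general does not; this is harmless because
  \<open>soft_avg_le_shifted_average\<close> admits every shift on the left. If the right-hand side
  is infinite there is nothing to prove, and otherwise the drift has finite cost.\<close>

lemma dominated_step:
  assumes h: "h > 0"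
    and G: "(\<lambda>(t, x). G t x) \<in> borel_measurable (M2 \<Otimes>\<^sub>M borel)"
    and F: "(\<lambda>(s, x). F s x) \<in> borel_measurable (M1 \<Otimes>\<^sub>M borel)"
    and dom: "dominated G F"
  shows "dominated (\<lambda>t. soft_avg h (G t)) (\<lambda>s. ctrl_avg d h (F s))"
  unfolding dominated_def
proof
  fix \<alpha> :: "'a \<Rightarrow> 'v" assume \<alpha>: "\<alpha> \<in> L2_space M1"
  then have [measurable]: "\<alpha> \<in> borel_measurable M1" by (rule L2_space_measurable)
  have [measurable]: "A \<alpha> \<in> borel_measurable M2" by (rule A_measurable[OF \<alpha>])
  interpret g: sigma_finite_measure "gauss h :: 'v measure" by (rule sigma_finite_gauss[OF h])
  interpret p1: pair_sigma_finite M1 "gauss h :: 'v measure" ..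
  interpret p2: pair_sigma_finite M2 "gauss h :: 'v measure" ..
  define c where "c i s = (\<integral>\<^sup>+ z. F s (\<alpha> s + d i + z) \<partial>gauss h) + ennreal ((norm (d i))\<^sup>2 / (2 * h))" for i s
  have Fm: "(\<lambda>p. F (fst p) (\<alpha> (fst p) + v (fst p) + snd p)) \<in> borel_measurable (M1 \<Otimes>\<^sub>M gauss h)"
    if [measurable]: "v \<in> borel_measurable M1" for v
    by (rule measurable_joint[OF F]) auto
  have Gm: "(\<lambda>p. G (fst p) (A \<alpha> (fst p) + v (fst p) + snd p)) \<in> borel_measurable (M2 \<Otimes>\<^sub>M gauss h)"
    if [measurable]: "v \<in> borel_measurable M2" for v
    by (rule measurable_joint[OF G]) auto
  have cm: "c i \<in> borel_measurable M1" for i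
    unfolding c_def
    by (intro borel_measurable_add g.borel_measurable_nn_integral)
      (use Fm[of "\<lambda>_. d i"] in \<open>auto simp: case_prod_beta'\<close>)
  have INF: "(INF i. c i s) = ctrl_avg d h (F s) (\<alpha> s)" for s
    by (simp add: ctrl_avg_def c_def)
  show "(\<integral>\<^sup>+ t. soft_avg h (G t) (A \<alpha> t) \<partial>M2) \<le> (\<integral>\<^sup>+ s. ctrl_avg d h (F s) (\<alpha> s) \<partial>M1)"
  proof (cases "(\<integral>\<^sup>+ s. ctrl_avg d h (F s) (\<alpha> s) \<partial>M1) = \<infinity>")
    case False
    show ?thesis
    proof (rule le_of_approximations)
      fix \<delta> :: real assume \<delta>: "\<delta> > 0"
      obtain N where N [measurable]: "N \<in> measurable M1 (count_space UNIV)"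
        and cN: "\<And>s. c (N s) s \<le> ctrl_avg d h (F s) (\<alpha> s) + ennreal \<delta>"
        using measurable_approx_INF[of c M1 \<delta>] cm \<delta> unfolding INF by metis
      define v where "v s = d (N s)" for s
      have v [measurable]: "v \<in> borel_measurable M1" unfolding v_def by measurable
      have Sm [measurable]: "(\<lambda>s. ctrl_avg d h (F s) (\<alpha> s)) \<in> borel_measurable M1"
        by (rule measurable_joint[OF ctrl_avg_joint_measurable[OF h F]]) auto
      define I where "I s = (\<integral>\<^sup>+ z. F s (\<alpha> s + v s + z) \<partial>gauss h)" for s
      have [measurable]: "I \<in> borel_measurable M1"
        unfolding I_def using Fm[OF v] by (intro g.borel_measurable_nn_integral) (simp add: case_prod_beta')
      have "(\<integral>\<^sup>+ s. I s + ennreal (1 / (2 * h) * (norm (v s))\<^sup>2) \<partial>M1) = (\<integral>\<^sup>+ s. c (N s) s \<partial>M1)"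
        by (simp add: c_def I_def v_def)
      also have "\<dots> \<le> (\<integral>\<^sup>+ s. ctrl_avg d h (F s) (\<alpha> s) + ennreal \<delta> \<partial>M1)"
        by (intro nn_integral_mono cN)
      also have "\<dots> = (\<integral>\<^sup>+ s. ctrl_avg d h (F s) (\<alpha> s) \<partial>M1) + ennreal \<delta> * emeasure M1 (space M1)"
        by (simp add: nn_integral_add)
      finally have le: "(\<integral>\<^sup>+ s. I s + ennreal (1 / (2 * h) * (norm (v s))\<^sup>2) \<partial>M1)
          \<le> (\<integral>\<^sup>+ s. ctrl_avg d h (F s) (\<alpha> s) \<partial>M1) + ennreal \<delta> * emeasure M1 (space M1)" .
      also have "\<dots> < \<infinity>"
        using False by (simp add: less_top[symmetric] M1.emeasure_eq_measure ennreal_mult_eq_top_iff)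
      finally have vL2: "v \<in> L2_space M1"
        by (intro L2_space_of_cost[OF v, of "1 / (2 * h)" I]) (use h in auto)
      have [measurable]: "A v \<in> borel_measurable M2" by (rule A_measurable[OF vL2])
      have "(\<integral>\<^sup>+ t. soft_avg h (G t) (A \<alpha> t) \<partial>M2)
          \<le> (\<integral>\<^sup>+ t. (\<integral>\<^sup>+ z. G t (A \<alpha> t + A v t + z) \<partial>gauss h) + ennreal ((norm (A v t))\<^sup>2 / (2 * h)) \<partial>M2)"
        by (intro nn_integral_mono soft_avg_le_shifted_average h measurable_section[OF G])
      also have "\<dots> = (\<integral>\<^sup>+ t. (\<integral>\<^sup>+ z. G t (A \<alpha> t + A v t + z) \<partial>gauss h) \<partial>M2)
          + (\<integral>\<^sup>+ t. ennreal (1 / (2 * h) * (norm (A v t))\<^sup>2) \<partial>M2)"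
        by (subst nn_integral_add)
          (use Gm[of "A v"] in \<open>auto simp: case_prod_beta' intro!: g.borel_measurable_nn_integral\<close>)
      also have "\<dots> \<le> (\<integral>\<^sup>+ s. I s \<partial>M1) + (\<integral>\<^sup>+ s. ennreal (1 / (2 * h) * (norm (v s))\<^sup>2) \<partial>M1)"
      proof (intro add_mono)
        show "(\<integral>\<^sup>+ t. ennreal (1 / (2 * h) * (norm (A v t))\<^sup>2) \<partial>M2)
            \<le> (\<integral>\<^sup>+ s. ennreal (1 / (2 * h) * (norm (v s))\<^sup>2) \<partial>M1)"
          using h by (intro A_contraction_scaled vL2) simp
        \<comment> \<open>Exchanging the integrals freezes the noise \<open>z\<close>. Then
          \<open>z\<close> is a constant function of \<open>s\<close>, which \<open>A\<close> fixes,
          and the assumption applies to the single function \<open>\<alpha> + v + z\<close>.\<close>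
        have "(\<integral>\<^sup>+ t. (\<integral>\<^sup>+ z. G t (A \<alpha> t + A v t + z) \<partial>gauss h) \<partial>M2)
            = (\<integral>\<^sup>+ z. (\<integral>\<^sup>+ t. G t (A \<alpha> t + A v t + z) \<partial>M2) \<partial>gauss h)"
          by (rule p2.Fubini'[symmetric]) (use Gm[of "A v"] in \<open>simp add: case_prod_beta'\<close>)
        also have "\<dots> \<le> (\<integral>\<^sup>+ z. (\<integral>\<^sup>+ s. F s (\<alpha> s + v s + z) \<partial>M1) \<partial>gauss h)"
        proof (rule nn_integral_mono)
          fix z :: 'v
          have L: "(\<lambda>s. \<alpha> s + v s) \<in> L2_space M1" by (rule L2_space_add[OF \<alpha> vL2])
          have C: "(\<lambda>s. z) \<in> L2_space M1" by (rule L2_space_const) (rule M1.finite_measure_axioms)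
          have "AE t in M2. A (\<lambda>s. \<alpha> s + v s + z) t = A \<alpha> t + A v t + z"
            using A_add[OF \<alpha> vL2] A_add[OF L C] A_const[of z] by eventually_elim simp
          then have "(\<integral>\<^sup>+ t. G t (A \<alpha> t + A v t + z) \<partial>M2) = (\<integral>\<^sup>+ t. G t (A (\<lambda>s. \<alpha> s + v s + z) t) \<partial>M2)"
            by (intro nn_integral_cong_AE) (auto elim!: eventually_mono)
          also have "\<dots> \<le> (\<integral>\<^sup>+ s. F s (\<alpha> s + v s + z) \<partial>M1)"
            using dom L2_space_add[OF L C] by (simp add: dominated_def)
          finally show "(\<integral>\<^sup>+ t. G t (A \<alpha> t + A v t + z) \<partial>M2) \<le> (\<integral>\<^sup>+ s. F s (\<alpha> s + v s + z) \<partial>M1)" .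
        qed
        also have "\<dots> = (\<integral>\<^sup>+ s. I s \<partial>M1)"
          unfolding I_def by (rule p1.Fubini') (use Fm[of v] in \<open>simp add: case_prod_beta'\<close>)
        finally show "(\<integral>\<^sup>+ t. (\<integral>\<^sup>+ z. G t (A \<alpha> t + A v t + z) \<partial>gauss h) \<partial>M2) \<le> (\<integral>\<^sup>+ s. I s \<partial>M1)" .
      qed
      also have "\<dots> = (\<integral>\<^sup>+ s. I s + ennreal (1 / (2 * h) * (norm (v s))\<^sup>2) \<partial>M1)"
        by (rule nn_integral_add[symmetric]) auto
      also note le
      finally show "(\<integral>\<^sup>+ t. soft_avg h (G t) (A \<alpha> t) \<partial>M2)
          \<le> (\<integral>\<^sup>+ s. ctrl_avg d h (F s) (\<alpha> s) \<partial>M1) + ennreal \<delta> * emeasure M1 (space M1)" .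
    qed
  qed simp
qed

lemma dominated_iterate:
  assumes h: "h > 0"
    and G: "(\<lambda>(t, x). G t x) \<in> borel_measurable (M2 \<Otimes>\<^sub>M borel)"
    and F: "(\<lambda>(s, x). F s x) \<in> borel_measurable (M1 \<Otimes>\<^sub>M borel)"
    and dom: "dominated G F"
  shows "dominated (\<lambda>t. (soft_avg h ^^ N) (G t)) (\<lambda>s. (ctrl_avg d h ^^ N) (F s))"
    and "(\<lambda>(t, x). (soft_avg h ^^ N) (G t) x) \<in> borel_measurable (M2 \<Otimes>\<^sub>M borel)"
    and "(\<lambda>(s, x). (ctrl_avg d h ^^ N) (F s) x) \<in> borel_measurable (M1 \<Otimes>\<^sub>M borel)"
proof (induction N)
  case (Suc N)
  {
    case 1 show ?case using dominated_step[OF h Suc(2,3,1), of d] by simp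
  next
    case 2 show ?case using soft_avg_joint_measurable[OF h Suc(2)] by simp
  next
    case 3 show ?case using ctrl_avg_joint_measurable[OF h Suc(3), of d] by simp
  }
qed (use G F dom in auto)

text \<open>For \<open>f\<close> a countable family of constants suffices. A near-minimiser
  \<open>\<beta>\<close> switches between these constants with \<open>s\<close>, and
  \<open>A \<beta>\<close> need not take values among them; so the envelope of \<open>g\<close> is
  an essential infimum over all functions \<open>A \<beta>\<close>.\<close>

lemma dominated_envelope:
  fixes f :: "'a \<Rightarrow> 'v \<Rightarrow> ennreal" and g :: "'b \<Rightarrow> 'v \<Rightarrow> ennreal"
  assumes k: "k > 0"
    and g: "(\<lambda>(t, x). g t x) \<in> borel_measurable (M2 \<Otimes>\<^sub>M borel)"
    and f: "(\<lambda>(s, x). f s x) \<in> borel_measurable (M1 \<Otimes>\<^sub>M borel)"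
    and dom: "dominated g f"
  obtains y :: "nat \<Rightarrow> 'v" and b :: "nat \<Rightarrow> 'a \<Rightarrow> 'v"
  where "\<And>x. AE s in M1. \<forall>x'. env k (\<lambda>i. f s (y i)) y x' \<le> f s x + ennreal (k / 2 * (norm (x' - x))\<^sup>2)"
    and "range b \<subseteq> L2_space M1"
    and "dominated (\<lambda>t. env k (\<lambda>i. g t (A (b i) t)) (\<lambda>i. A (b i) t)) (\<lambda>s. env k (\<lambda>i. f s (y i)) y)"
proof -
  have fm: "(\<lambda>s. f s (a s)) \<in> borel_measurable M1" if "a \<in> borel_measurable M1" for a
    by (rule measurable_joint[OF f]) (use that in auto)
  have gm: "(\<lambda>t. g t (a t)) \<in> borel_measurable M2" if "a \<in> borel_measurable M2" for a
    by (rule measurable_joint[OF g]) (use that in auto)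
  have z: "(\<lambda>s. 0) \<in> L2_space M1" by (rule L2_space_const) (rule M1.finite_measure_axioms)
  obtain y :: "nat \<Rightarrow> 'v" where
    y: "\<And>x. AE s in M1. \<forall>x'. env k (\<lambda>i. f s (y i)) y x' \<le> f s x + ennreal (k / 2 * (norm (x' - x))\<^sup>2)"
    using essential_envelope[OF M1.finite_measure_axioms, of "UNIV :: 'v set" k "\<lambda>x s. f s x" "\<lambda>x s. x"] k fm
    by auto
  obtain b :: "nat \<Rightarrow> 'a \<Rightarrow> 'v" where b: "range b \<subseteq> L2_space M1" and
    env_b: "\<And>\<beta>. \<beta> \<in> L2_space M1 \<Longrightarrow> AE t in M2. \<forall>x. env k (\<lambda>i. g t (A (b i) t)) (\<lambda>i. A (b i) t) x
      \<le> g t (A \<beta> t) + ennreal (k / 2 * (norm (x - A \<beta> t))\<^sup>2)"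
    using essential_envelope[OF M2.finite_measure_axioms, of "L2_space M1" k "\<lambda>\<beta> t. g t (A \<beta> t)" "\<lambda>\<beta>. A \<beta>"] k z gm A_measurable
    by auto
  have "dominated (\<lambda>t. env k (\<lambda>i. g t (A (b i) t)) (\<lambda>i. A (b i) t)) (\<lambda>s. env k (\<lambda>i. f s (y i)) y)"
    unfolding dominated_def
  proof
    fix \<alpha> :: "'a \<Rightarrow> 'v" assume \<alpha>: "\<alpha> \<in> L2_space M1"
    then have [measurable]: "\<alpha> \<in> borel_measurable M1" by (rule L2_space_measurable)
    define c where "c i s = f s (y i) + ennreal (k / 2 * (norm (\<alpha> s - y i))\<^sup>2)" for i s
    have [measurable]: "c i \<in> borel_measurable M1" for i
      unfolding c_def using fm[of "\<lambda>_. y i"] by measurable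
    have INF: "(INF i. c i s) = env k (\<lambda>i. f s (y i)) y (\<alpha> s)" for s
      by (simp add: env_def c_def)
    have [measurable]: "(\<lambda>s. env k (\<lambda>i. f s (y i)) y (\<alpha> s)) \<in> borel_measurable M1"
      unfolding INF[symmetric] by measurable
    show "(\<integral>\<^sup>+ t. env k (\<lambda>i. g t (A (b i) t)) (\<lambda>i. A (b i) t) (A \<alpha> t) \<partial>M2)
      \<le> (\<integral>\<^sup>+ s. env k (\<lambda>i. f s (y i)) y (\<alpha> s) \<partial>M1)"
    proof (cases "(\<integral>\<^sup>+ s. env k (\<lambda>i. f s (y i)) y (\<alpha> s) \<partial>M1) = \<infinity>")
      case False
      show ?thesis
      proof (rule le_of_approximations)
        fix \<delta> :: real assume \<delta>: "\<delta> > 0"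
        obtain N where N [measurable]: "N \<in> measurable M1 (count_space UNIV)"
          and cN: "\<And>s. c (N s) s \<le> env k (\<lambda>i. f s (y i)) y (\<alpha> s) + ennreal \<delta>"
          using measurable_approx_INF[of c M1 \<delta>] \<delta> unfolding INF by auto
        define \<beta> where "\<beta> s = y (N s)" for s
        have [measurable]: "\<beta> \<in> borel_measurable M1" unfolding \<beta>_def by measurable
        have "(\<integral>\<^sup>+ s. f s (\<beta> s) + ennreal (k / 2 * (norm (\<alpha> s - \<beta> s))\<^sup>2) \<partial>M1)
            \<le> (\<integral>\<^sup>+ s. env k (\<lambda>i. f s (y i)) y (\<alpha> s) + ennreal \<delta> \<partial>M1)"
          using cN by (intro nn_integral_mono) (simp add: c_def \<beta>_def)
        also have "\<dots> = (\<integral>\<^sup>+ s. env k (\<lambda>i. f s (y i)) y (\<alpha> s) \<partial>M1) + ennreal \<delta> * emeasure M1 (space M1)"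
          by (simp add: nn_integral_add)
        finally have le: "(\<integral>\<^sup>+ s. f s (\<beta> s) + ennreal (k / 2 * (norm (\<alpha> s - \<beta> s))\<^sup>2) \<partial>M1)
            \<le> (\<integral>\<^sup>+ s. env k (\<lambda>i. f s (y i)) y (\<alpha> s) \<partial>M1) + ennreal \<delta> * emeasure M1 (space M1)" .
        also have "\<dots> < \<infinity>"
          using False by (simp add: less_top[symmetric] M1.emeasure_eq_measure ennreal_mult_eq_top_iff)
        \<comment> \<open>Only the displacement from \<open>\<alpha>\<close> has a finite cost; that
          \<open>\<beta>\<close> is square integrable follows from it.\<close>
        finally have D: "(\<lambda>s. \<alpha> s - \<beta> s) \<in> L2_space M1"
          by (intro L2_space_of_cost[of _ "k / 2" "\<lambda>s. f s (\<beta> s)"]) (use k in auto)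
        from L2_space_diff[OF \<alpha> D] have \<beta>: "\<beta> \<in> L2_space M1" by simp
        have [measurable]: "A \<alpha> \<in> borel_measurable M2" "A \<beta> \<in> borel_measurable M2"
          "A (\<lambda>s. \<alpha> s - \<beta> s) \<in> borel_measurable M2"
          by (auto intro!: A_measurable \<alpha> \<beta> D)
        have "(\<integral>\<^sup>+ t. env k (\<lambda>i. g t (A (b i) t)) (\<lambda>i. A (b i) t) (A \<alpha> t) \<partial>M2)
            \<le> (\<integral>\<^sup>+ t. g t (A \<beta> t) + ennreal (k / 2 * (norm (A (\<lambda>s. \<alpha> s - \<beta> s) t))\<^sup>2) \<partial>M2)"
        proof (rule nn_integral_mono_AE)
          show "AE t in M2. env k (\<lambda>i. g t (A (b i) t)) (\<lambda>i. A (b i) t) (A \<alpha> t)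
              \<le> g t (A \<beta> t) + ennreal (k / 2 * (norm (A (\<lambda>s. \<alpha> s - \<beta> s) t))\<^sup>2)"
            using env_b[OF \<beta>] A_diff[OF \<alpha> \<beta>] by eventually_elim simp
        qed
        also have "\<dots> = (\<integral>\<^sup>+ t. g t (A \<beta> t) \<partial>M2) + (\<integral>\<^sup>+ t. ennreal (k / 2 * (norm (A (\<lambda>s. \<alpha> s - \<beta> s) t))\<^sup>2) \<partial>M2)"
          by (intro nn_integral_add gm) auto
        also have "\<dots> \<le> (\<integral>\<^sup>+ s. f s (\<beta> s) \<partial>M1) + (\<integral>\<^sup>+ s. ennreal (k / 2 * (norm (\<alpha> s - \<beta> s))\<^sup>2) \<partial>M1)"
          using dom \<beta> k by (intro add_mono A_contraction_scaled D) (auto simp: dominated_def)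
        also have "\<dots> = (\<integral>\<^sup>+ s. f s (\<beta> s) + ennreal (k / 2 * (norm (\<alpha> s - \<beta> s))\<^sup>2) \<partial>M1)"
          by (intro nn_integral_add[symmetric] fm) auto
        also note le
        finally show "(\<integral>\<^sup>+ t. env k (\<lambda>i. g t (A (b i) t)) (\<lambda>i. A (b i) t) (A \<alpha> t) \<partial>M2)
          \<le> (\<integral>\<^sup>+ s. env k (\<lambda>i. f s (y i)) y (\<alpha> s) \<partial>M1) + ennreal \<delta> * emeasure M1 (space M1)" .
      qed
    qed simp
  qed
  then show ?thesis using that y b by blast
qed

end

section \<open>One step of the controlled average\<close>

text \<open>A second-order Taylor bound with constant \<open>K\<close> on both sides, with an
  unspecified gradient \<open>p\<close> at each point. It expresses a Lipschitz gradient without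
  mentioning derivatives.\<close>

definition C11 :: "real \<Rightarrow> ('v::euclidean_space \<Rightarrow> real) \<Rightarrow> bool" where
  "C11 K \<phi> \<longleftrightarrow> (\<forall>z. \<exists>p. \<forall>w. \<bar>\<phi> (z + w) - \<phi> z - p \<bullet> w\<bar> \<le> K / 2 * (norm w)\<^sup>2)"

lemma C11_continuous:
  assumes "C11 K \<phi>" shows "continuous_on UNIV \<phi>"
  unfolding continuous_on_def
proof safe
  fix z
  obtain p where p: "\<And>w. \<bar>\<phi> (z + w) - \<phi> z - p \<bullet> w\<bar> \<le> K / 2 * (norm w)\<^sup>2"
    using assms unfolding C11_def by metis
  have "((\<lambda>y. \<phi> y - \<phi> z) \<longlongrightarrow> 0) (at z)"
  proof (rule Lim_null_comparison)
    show "\<forall>\<^sub>F y in at z. norm (\<phi> y - \<phi> z) \<le> K / 2 * (norm (y - z))\<^sup>2 + \<bar>p \<bullet> (y - z)\<bar>"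
    proof (rule always_eventually, rule allI)
      fix y show "norm (\<phi> y - \<phi> z) \<le> K / 2 * (norm (y - z))\<^sup>2 + \<bar>p \<bullet> (y - z)\<bar>"
        using p[of "y - z"] unfolding real_norm_def add_diff_cancel_left' add_diff_eq
        by linarith
    qed
    have "((\<lambda>y. K / 2 * (norm (y - z))\<^sup>2 + \<bar>p \<bullet> (y - z)\<bar>) \<longlongrightarrow> K / 2 * (norm (z - z))\<^sup>2 + \<bar>p \<bullet> (z - z)\<bar>) (at z)"
      by (intro tendsto_intros)
    then show "((\<lambda>y. K / 2 * (norm (y - z))\<^sup>2 + \<bar>p \<bullet> (y - z)\<bar>) \<longlongrightarrow> 0) (at z)"
      by simp
  qed
  then show "(\<phi> \<longlongrightarrow> \<phi> z) (at z within UNIV)"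
    by (simp add: LIM_zero_iff)
qed

lemma C11_proximal_point:
  fixes \<phi> :: "'v::euclidean_space \<Rightarrow> real"
  assumes \<phi>: "C11 K \<phi>" and pos: "\<And>x. \<phi> x \<ge> 0" and h: "h > 0" and K: "K \<ge> 0"
  obtains z where "\<And>w. \<bar>\<phi> (z + w) - \<phi> z - ((x - z) /\<^sub>R h) \<bullet> w\<bar> \<le> K / 2 * (norm w)\<^sup>2"
proof -
  define J where "J y = \<phi> y + (norm (y - x))\<^sup>2 / (2 * h)" for y
  \<comment> \<open>Outside the ball of this radius the quadratic penalty alone is at least
    \<open>\<phi> x\<close>, which is \<open>J x\<close>; so a minimum over the compact ball is
    global.\<close>
  define r where "r = sqrt (2 * h * \<phi> x)"
  have cont: "continuous_on (cball x r) J"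
    unfolding J_def using C11_continuous[OF \<phi>] by (intro continuous_intros) (auto intro: continuous_on_subset simp: h less_imp_neq[OF h, symmetric])
  obtain z where z: "z \<in> cball x r" "\<And>y. y \<in> cball x r \<Longrightarrow> J z \<le> J y"
  proof -
    have "cball x r \<noteq> {}" using pos[of x] h by (simp add: r_def not_less)
    then show ?thesis using continuous_attains_inf[OF compact_cball _ cont] that by blast
  qed
  have min: "J z \<le> J y" for y
  proof (cases "y \<in> cball x r")
    case False
    then have "r \<le> norm (y - x)" by (simp add: dist_norm norm_minus_commute)
    then have "r\<^sup>2 \<le> (norm (y - x))\<^sup>2" using pos[of x] h by (intro power_mono) (auto simp: r_def)
    then have "\<phi> x \<le> (norm (y - x))\<^sup>2 / (2 * h)"
      using pos[of x] h by (simp add: r_def field_simps)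
    then have "\<phi> x \<le> J y" using pos[of y] by (simp add: J_def)
    moreover have "J z \<le> J x" using z(2)[of x] pos[of x] h by (auto simp: r_def)
    ultimately show ?thesis by (simp add: J_def)
  qed (rule z(2))
  obtain p where p: "\<And>w. \<bar>\<phi> (z + w) - \<phi> z - p \<bullet> w\<bar> \<le> K / 2 * (norm w)\<^sup>2"
    using \<phi> unfolding C11_def by metis
  define q c where "q = p + (z - x) /\<^sub>R h" and "c = K / 2 + 1 / (2 * h)"
  have c: "c > 0" using K h by (simp add: c_def add_nonneg_pos)
  have "0 \<le> q \<bullet> w + c * (norm w)\<^sup>2" for w
  proof -
    have "(norm (z + w - x))\<^sup>2 = (norm (z - x))\<^sup>2 + 2 * ((z - x) \<bullet> w) + (norm w)\<^sup>2"
      unfolding power2_norm_eq_inner by (simp add: inner_simps inner_commute)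
    then have "(norm (z + w - x))\<^sup>2 / (2 * h) = (norm (z - x))\<^sup>2 / (2 * h) + ((z - x) /\<^sub>R h) \<bullet> w + 1 / (2 * h) * (norm w)\<^sup>2"
      using h unfolding inner_scaleR_left by (simp add: field_simps)
    moreover have "\<phi> (z + w) \<le> \<phi> z + p \<bullet> w + K / 2 * (norm w)\<^sup>2"
      using p[of w] by linarith
    ultimately show ?thesis
      using min[of "z + w"] unfolding J_def q_def c_def inner_add_left distrib_right by linarith
  qed
  \<comment> \<open>The displacement that minimises
    \<open>q \<bullet> w + c * (norm w)\<^sup>2\<close>. The minimum is a negative multiple of
    \<open>(norm q)\<^sup>2\<close>, hence \<open>q = 0\<close>, which is the first-order
    condition.\<close>
  from this[of "- (1 / (2 * c)) *\<^sub>R q"] have "0 \<le> - (1 / (2 * c)) * (norm q)\<^sup>2 + c * ((1 / (2 * c))\<^sup>2 * (norm q)\<^sup>2)"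
    by (simp add: power_mult_distrib power_divide power2_norm_eq_inner)
  also have "\<dots> = - (1 / (4 * c)) * (norm q)\<^sup>2"
    using c by (simp add: field_simps power2_eq_square)
  finally have "q = 0"
    using c by (simp add: zero_le_mult_iff divide_le_0_iff)
  then have "p = (x - z) /\<^sub>R h"
    by (simp add: q_def scaleR_diff_right algebra_simps)
  then show ?thesis using that p by metis
qed

lemma exp_minus_le_quadratic: "exp (- r) \<le> 1 - r + r\<^sup>2 / 2 * exp \<bar>r\<bar>" for r :: real
proof -
  obtain t where t: "\<bar>t\<bar> \<le> \<bar>- r\<bar>" "exp (- r) = (\<Sum>m<2. (- r) ^ m / fact m) + exp t / fact 2 * (- r) ^ 2"
    using Maclaurin_exp_le[of "- r" 2] by blast
  have "exp t \<le> exp \<bar>r\<bar>" using t(1) by simp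
  then have "exp t / 2 * r\<^sup>2 \<le> exp \<bar>r\<bar> / 2 * r\<^sup>2" by (intro mult_right_mono) auto
  then show ?thesis using t(2) by (simp add: numeral_2_eq_2 algebra_simps)
qed

text \<open>Gaussian noise around the proximal point \<open>z\<close> of \<open>x\<close> corresponds to a drift that is exactly minus
  the gradient at \<open>z\<close>. The gap to the soft average is then \<open>E R + log E exp (- R)\<close> for the Taylor
  remainder \<open>R\<close> at \<open>z\<close>, which is of order \<open>h\<^sup>2\<close> uniformly in \<open>x\<close>.\<close>

lemma ctrl_avg_le_soft_avg_C11:
  fixes \<phi> :: "'v::euclidean_space \<Rightarrow> real"
  assumes \<phi>: "C11 K \<phi>" and pos: "\<And>x. \<phi> x \<ge> 0" and h: "h > 0" and K: "K \<ge> 0" "K * h \<le> 1 / 4"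
    and d: "closure (range d) = UNIV"
  shows "ctrl_avg d h (\<lambda>x. ennreal (\<phi> x)) x \<le> soft_avg h (\<lambda>x. ennreal (\<phi> x)) x
    + ennreal (16 * (K * h)\<^sup>2 * sqrt 2 ^ DIM('v))"
proof -
  interpret prob_space "gauss h :: 'v measure" by (rule prob_space_gauss[OF h])
  have [measurable]: "\<phi> \<in> borel_measurable borel"
    by (rule borel_measurable_continuous_onI[OF C11_continuous[OF \<phi>]])
  obtain z where z: "\<And>w. \<bar>\<phi> (z + w) - \<phi> z - ((x - z) /\<^sub>R h) \<bullet> w\<bar> \<le> K / 2 * (norm w)\<^sup>2"
    using C11_proximal_point[OF \<phi> pos h K(1)] by metis
  define p where "p = (x - z) /\<^sub>R h"
  define R where "R w = \<phi> (z + w) - \<phi> z - p \<bullet> w" for w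
  have R: "\<bar>R w\<bar> \<le> K / 2 * (norm w)\<^sup>2" for w using z by (simp add: R_def p_def)
  have [measurable]: "R \<in> borel_measurable borel" unfolding R_def by measurable
  note int [simp] = integrable_gauss_norm_square[OF h] integrable_gauss_norm[OF h] integrable_gauss_inner[OF h]
  have intR [simp]: "integrable (gauss h) R"
    by (rule Bochner_Integration.integrable_bound[of _ "\<lambda>w. K / 2 * (norm w)\<^sup>2"])
      (use R K(1) in \<open>auto intro!: AE_I2 order_trans[OF R] simp: abs_mult\<close>)
  define v where "v = z - x"
  define E where "E = \<phi> z + (norm v)\<^sup>2 / (2 * h)"
  define m where "m = (\<integral>w. R w \<partial>gauss h)"
  define \<epsilon> where "\<epsilon> = 16 * (K * h)\<^sup>2 * sqrt 2 ^ DIM('v)"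
  have \<epsilon>: "\<epsilon> \<ge> 0" by (simp add: \<epsilon>_def)
  have \<phi>zw: "\<phi> (x + v + w) = \<phi> z + w \<bullet> p + R w" for w
    by (simp add: v_def R_def inner_commute)
  have cost: "(\<integral>\<^sup>+ w. ennreal (\<phi> (x + v + w)) \<partial>gauss h) + ennreal ((norm v)\<^sup>2 / (2 * h)) = ennreal (E + m)"
    and Em: "E + m \<ge> 0"
  proof -
    have i: "integrable (gauss h) (\<lambda>w. \<phi> (x + v + w))" unfolding \<phi>zw by simp
    have "(\<integral>w. \<phi> (x + v + w) \<partial>gauss h) = \<phi> z + m"
      unfolding \<phi>zw m_def using prob_space by (simp add: integral_gauss_inner[OF h])
    moreover have "(\<integral>w. \<phi> (x + v + w) \<partial>gauss h) \<ge> 0" by (simp add: pos)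
    moreover have "E + m = (\<phi> z + m) + (norm v)\<^sup>2 / (2 * h)" "(norm v)\<^sup>2 / (2 * h) \<ge> 0"
      using h by (simp_all add: E_def)
    ultimately show "(\<integral>\<^sup>+ w. ennreal (\<phi> (x + v + w)) \<partial>gauss h) + ennreal ((norm v)\<^sup>2 / (2 * h)) = ennreal (E + m)"
      "E + m \<ge> 0"
      using pos by (simp_all only: nn_integral_eq_integral[OF i] AE_I2 ennreal_plus add_nonneg_nonneg)
  qed
  have "ctrl_avg d h (\<lambda>x. ennreal (\<phi> x)) x \<le> ennreal (E + m)"
  proof -
    \<comment> \<open>The optimal drift \<open>v\<close> need not be one of the \<open>d i\<close>,
      so it is approximated by some of them. Keeping these within distance 1 of \<open>v\<close>
      gives the common integrable bound \<open>B\<close> for dominated convergence.\<close>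
    have "v \<in> closure (range d)" using d by simp
    then obtain u where u: "\<And>n. u n \<in> range d" "u \<longlonglongrightarrow> v" unfolding closure_sequential by blast
    then have "\<forall>\<^sub>F n in sequentially. dist (u n) v < 1" by (intro tendstoD) auto
    then obtain n0 where n0: "\<And>n. n \<ge> n0 \<Longrightarrow> dist (u n) v < 1" by (auto simp: eventually_sequentially)
    define u' where "u' n = u (n + n0)" for n
    have u': "u' \<longlonglongrightarrow> v" "\<And>n. norm (u' n - v) \<le> 1"
      unfolding u'_def using LIMSEQ_ignore_initial_segment[OF u(2)] n0 by (auto simp: dist_norm less_imp_le)
    define B where "B w = \<phi> z + norm p * (1 + norm w) + K / 2 * (2 + 2 * (norm w)\<^sup>2)" for w :: 'v
    have B0: "B w \<ge> 0" for w using pos[of z] K by (simp add: B_def)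
    have le: "\<phi> (x + u' n + w) \<le> B w" for n w
    proof -
      define e where "e = u' n - v + w"
      have "x + u' n + w = z + e" by (simp add: e_def v_def)
      moreover have "\<phi> (z + e) \<le> \<phi> z + p \<bullet> e + K / 2 * (norm e)\<^sup>2" using R[of e] unfolding R_def by linarith
      moreover have "p \<bullet> e \<le> norm p * (1 + norm w)"
      proof -
        have "p \<bullet> e \<le> norm p * norm e" by (rule norm_cauchy_schwarz)
        also have "norm e \<le> 1 + norm w"
          using norm_triangle_ineq[of "u' n - v" w] u'(2)[of n] by (simp add: e_def)
        finally show ?thesis by (simp add: mult_left_mono)
      qed
      moreover have "(norm e)\<^sup>2 \<le> 2 + 2 * (norm w)\<^sup>2"
      proof -
        have "(norm (u' n - v))\<^sup>2 \<le> 1" using u'(2)[of n] by (simp add: power_le_one)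
        then show ?thesis using norm_add_square_le[of "u' n - v" w] by (simp add: e_def)
      qed
      then have "K / 2 * (norm e)\<^sup>2 \<le> K / 2 * (2 + 2 * (norm w)\<^sup>2)"
        using K(1) by (intro mult_left_mono) auto
      ultimately show ?thesis unfolding B_def by simp
    qed
    have "integrable (gauss h) B" unfolding B_def by simp
    then have Bfin: "(\<integral>\<^sup>+ w. ennreal (B w) \<partial>gauss h) < \<infinity>"
      using B0 by (simp add: nn_integral_eq_integral)
    have "(\<lambda>n. \<integral>\<^sup>+ w. ennreal (\<phi> (x + u' n + w)) \<partial>gauss h) \<longlonglongrightarrow> (\<integral>\<^sup>+ w. ennreal (\<phi> (x + v + w)) \<partial>gauss h)"
    proof (rule nn_integral_dominated_convergence[where w = "\<lambda>w. ennreal (B w)"])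
      show "AE w in gauss h. (\<lambda>n. ennreal (\<phi> (x + u' n + w))) \<longlonglongrightarrow> ennreal (\<phi> (x + v + w))"
      proof (rule AE_I2)
        fix w
        have "(\<lambda>n. x + u' n + w) \<longlonglongrightarrow> x + v + w" by (intro tendsto_intros u')
        then have "(\<lambda>n. \<phi> (x + u' n + w)) \<longlonglongrightarrow> \<phi> (x + v + w)"
          by (rule continuous_on_tendsto_compose[OF C11_continuous[OF \<phi>]]) auto
        then show "(\<lambda>n. ennreal (\<phi> (x + u' n + w))) \<longlonglongrightarrow> ennreal (\<phi> (x + v + w))"
          by (rule tendsto_ennrealI)
      qed
    qed (use Bfin le in \<open>auto intro!: AE_I2 ennreal_leI simp: B_def\<close>)
    moreover have "(\<lambda>n. ennreal ((norm (u' n))\<^sup>2 / (2 * h))) \<longlonglongrightarrow> ennreal ((norm v)\<^sup>2 / (2 * h))"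
      using h by (intro tendsto_ennrealI tendsto_intros u') auto
    ultimately have "(\<lambda>n. (\<integral>\<^sup>+ w. ennreal (\<phi> (x + u' n + w)) \<partial>gauss h) + ennreal ((norm (u' n))\<^sup>2 / (2 * h)))
        \<longlonglongrightarrow> ennreal (E + m)"
      unfolding cost[symmetric] by (intro tendsto_add)
    moreover have "ctrl_avg d h (\<lambda>x. ennreal (\<phi> x)) x
        \<le> (\<integral>\<^sup>+ w. ennreal (\<phi> (x + u' n + w)) \<partial>gauss h) + ennreal ((norm (u' n))\<^sup>2 / (2 * h))" for n
    proof -
      obtain i where "u' n = d i" using u(1)[of "n + n0"] by (auto simp: u'_def)
      then show ?thesis unfolding ctrl_avg_def by (auto intro!: INF_lower)
    qed
    ultimately show ?thesis by (intro LIMSEQ_le_const) auto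
  qed
  moreover have "ennreal (E + m) \<le> soft_avg h (\<lambda>x. ennreal (\<phi> x)) x + ennreal \<epsilon>"
  proof -
    have quad: "exp (- R w) \<le> 1 - R w + 16 * (K * h)\<^sup>2 * exp ((norm w)\<^sup>2 / (4 * h))" for w
    proof -
      \<comment> \<open>With this scale \<open>(exp r)\<^sup>2\<close> is the integrable weight of
        \<open>integrable_gauss_exp_square\<close>. The condition \<open>K * h \<le> 1 / 4\<close>
        gives \<open>\<bar>R w\<bar> \<le> r\<close>, so one factor \<open>exp r\<close> bounds
        \<open>exp \<bar>R w\<bar>\<close> and the other bounds
        \<open>r\<^sup>2 / 2\<close>.\<close>
      define r where "r = (norm w)\<^sup>2 / (8 * h)"
      have r: "r \<ge> 0" using h by (simp add: r_def)
      have Rr: "\<bar>R w\<bar> \<le> 4 * (K * h) * r" using R[of w] h by (simp add: r_def field_simps)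
      have "(R w)\<^sup>2 \<le> (4 * (K * h) * r)\<^sup>2" using power_mono[OF Rr, of 2] by simp
      moreover have "exp \<bar>R w\<bar> \<le> exp r"
      proof -
        have "4 * (K * h) * r \<le> 1 * r" using K(2) r by (intro mult_right_mono) auto
        then show ?thesis using Rr by simp
      qed
      ultimately have "(R w)\<^sup>2 / 2 * exp \<bar>R w\<bar> \<le> (4 * (K * h) * r)\<^sup>2 / 2 * exp r"
        by (intro mult_mono) auto
      also have "\<dots> = 16 * (K * h)\<^sup>2 * (r\<^sup>2 / 2) * exp r"
        by (simp add: power_mult_distrib)
      also have "r\<^sup>2 / 2 \<le> exp r" using exp_lower_Taylor_quadratic[OF r] r by linarith
      then have "16 * (K * h)\<^sup>2 * (r\<^sup>2 / 2) * exp r \<le> 16 * (K * h)\<^sup>2 * exp r * exp r"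
        by (intro mult_right_mono mult_left_mono) auto
      also have "\<dots> = 16 * (K * h)\<^sup>2 * exp ((norm w)\<^sup>2 / (4 * h))"
        by (simp add: r_def mult.assoc mult_exp_exp)
      finally show ?thesis using exp_minus_le_quadratic[of "R w"] by linarith
    qed
    have iexp: "(\<integral>w. exp ((norm w)\<^sup>2 / (4 * h)) \<partial>(gauss h :: 'v measure)) = sqrt 2 ^ DIM('v)"
      using nn_integral_gauss_exp_square[OF h, where 'v = 'v]
      by (subst integral_eq_nn_integral) (auto intro!: AE_I2)
    define U where "U w = 1 - R w + 16 * (K * h)\<^sup>2 * exp ((norm w)\<^sup>2 / (4 * h))" for w
    have U: "integrable (gauss h) U" unfolding U_def using integrable_gauss_exp_square[OF h, where 'v = 'v] by simp
    have "(\<integral>w. U w \<partial>gauss h) = 1 - m + \<epsilon>"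
      unfolding U_def m_def \<epsilon>_def using prob_space integrable_gauss_exp_square[OF h, where 'v = 'v]
      by (simp add: iexp)
    have "(\<integral>\<^sup>+ w. en (ennreal (\<phi> (x + w))) \<partial>gauss h)
        = (\<integral>\<^sup>+ w. en (ennreal (\<phi> (x + (w + v)))) * ennreal (exp (- (w \<bullet> v / h) - (norm v)\<^sup>2 / (2 * h))) \<partial>gauss h)"
      by (rule nn_integral_gauss_shift[OF h]) simp
    \<comment> \<open>Since \<open>v = - h *\<^sub>R p\<close>, the linear exponent produced by the
      shift cancels the linear Taylor term of \<phi>, and only the remainder \<open>R\<close> is
      left.\<close>
    also have "\<dots> = (\<integral>\<^sup>+ w. ennreal (exp (- E)) * ennreal (exp (- R w)) \<partial>gauss h)"
    proof (rule nn_integral_cong)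
      fix w
      have "w \<bullet> v / h = - (w \<bullet> p)"
        using h by (simp add: v_def p_def inner_diff_right divide_inverse algebra_simps)
      moreover have "\<phi> (x + (w + v)) = \<phi> z + w \<bullet> p + R w" using \<phi>zw[of w] by (simp add: add_ac)
      ultimately show "en (ennreal (\<phi> (x + (w + v)))) * ennreal (exp (- (w \<bullet> v / h) - (norm v)\<^sup>2 / (2 * h)))
          = ennreal (exp (- E)) * ennreal (exp (- R w))"
        using pos[of "x + (w + v)"] by (simp add: E_def mult_exp_exp flip: ennreal_mult)
    qed
    also have "\<dots> \<le> (\<integral>\<^sup>+ w. ennreal (exp (- E)) * ennreal (U w) \<partial>gauss h)"
      using quad by (intro nn_integral_mono mult_left_mono ennreal_leI) (auto simp: U_def)
    also have "\<dots> = ennreal (exp (- E)) * ennreal (\<integral>w. U w \<partial>gauss h)"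
    proof -
      have "U w \<ge> 0" for w using quad[of w] exp_ge_zero[of "- R w"] unfolding U_def by linarith
      then have "(\<integral>\<^sup>+ w. ennreal (U w) \<partial>gauss h) = ennreal (\<integral>w. U w \<partial>gauss h)"
        by (intro nn_integral_eq_integral U) simp
      moreover have "U \<in> borel_measurable (gauss h)" using U by auto
      ultimately show ?thesis by (subst nn_integral_cmult) simp_all
    qed
    also have "\<dots> \<le> ennreal (exp (- E)) * ennreal (exp (- m + \<epsilon>))"
    proof -
      have "(\<integral>w. U w \<partial>gauss h) \<le> exp (- m + \<epsilon>)"
        using exp_ge_add_one_self[of "- m + \<epsilon>"] \<open>(\<integral>w. U w \<partial>gauss h) = 1 - m + \<epsilon>\<close> by linarith
      then show ?thesis by (intro mult_left_mono ennreal_leI) simp_all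
    qed
    also have "\<dots> = ennreal (exp (- (E + m - \<epsilon>)))"
      by (simp add: mult_exp_exp algebra_simps flip: ennreal_mult)
    finally have le: "(\<integral>\<^sup>+ w. en (ennreal (\<phi> (x + w))) \<partial>gauss h) \<le> ennreal (exp (- (E + m - \<epsilon>)))" .
    have "ennreal (E + m - \<epsilon>) \<le> soft_avg h (\<lambda>x. ennreal (\<phi> x)) x"
      unfolding soft_avg_def using nlog_antimono[OF le] by (simp add: nlog_exp del: minus_diff_eq)
    then have "ennreal (E + m - \<epsilon>) + ennreal \<epsilon> \<le> soft_avg h (\<lambda>x. ennreal (\<phi> x)) x + ennreal \<epsilon>"
      by (rule add_right_mono)
    \<comment> \<open>\<open>E + m - \<epsilon>\<close> may be negative and is then truncated to 0
      by \<open>ennreal\<close>; in that case \<open>E + m\<close> is below \<epsilon>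
      anyway.\<close>
    moreover have "ennreal (E + m) \<le> ennreal (E + m - \<epsilon>) + ennreal \<epsilon>"
    proof (cases "E + m - \<epsilon> \<ge> 0")
      case True
      then show ?thesis using \<epsilon> by (simp flip: ennreal_plus)
    next
      case False
      then show ?thesis by (intro add_increasing ennreal_leI) auto
    qed
    ultimately show ?thesis by (blast intro: order_trans)
  qed
  ultimately show ?thesis unfolding \<epsilon>_def by (rule order_trans)
qed

section \<open>Regularity of soft Gaussian averages\<close>

lemma integrable_bounded_prob:
  fixes a :: "'c \<Rightarrow> 'w::{banach, second_countable_topology}"
  assumes "prob_space M" "a \<in> borel_measurable M" "\<And>\<omega>. \<omega> \<in> space M \<Longrightarrow> norm (a \<omega>) \<le> c"
  shows "integrable M a"
proof -
  interpret prob_space M by fact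
  show ?thesis by (rule integrable_const_bound[of _ c]) (use assms in auto)
qed

text \<open>The upper bound is Jensen's inequality. The lower bound is Hoeffding's lemma for the
  centred variable, which lies in an interval of length \<open>2 * c\<close>: the exponent
  \<open>(2 * c)\<^sup>2 / 8\<close> is \<open>c\<^sup>2 / 2\<close>.\<close>

lemma log_laplace_bounds:
  fixes a :: "'c \<Rightarrow> real"
  assumes P: "prob_space M" and a [measurable]: "a \<in> borel_measurable M"
    and le: "\<And>\<omega>. \<omega> \<in> space M \<Longrightarrow> \<bar>a \<omega>\<bar> \<le> c"
  shows "- ln (\<integral>\<omega>. exp (- a \<omega>) \<partial>M) \<le> (\<integral>\<omega>. a \<omega> \<partial>M)"
    and "(\<integral>\<omega>. a \<omega> \<partial>M) - c\<^sup>2 / 2 \<le> - ln (\<integral>\<omega>. exp (- a \<omega>) \<partial>M)"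
    and "(\<integral>\<omega>. exp (- a \<omega>) \<partial>M) > 0"
proof -
  interpret prob_space M by fact
  define m Z where "m = (\<integral>\<omega>. a \<omega> \<partial>M)" and "Z = (\<integral>\<omega>. exp (- a \<omega>) \<partial>M)"
  have ia: "integrable M a" by (rule integrable_bounded_prob[OF P a, where c = c]) (use le in auto)
  have "exp (- a \<omega>) \<le> exp c" if "\<omega> \<in> space M" for \<omega> using le[OF that] by simp
  then have ie: "integrable M (\<lambda>\<omega>. exp (- a \<omega>))"
    by (intro integrable_bounded_prob[OF P, where c = "exp c"]) auto
  have nnZ: "(\<integral>\<^sup>+ \<omega>. ennreal (exp (- a \<omega>)) \<partial>M) = ennreal Z"
    unfolding Z_def by (intro nn_integral_eq_integral ie) auto
  have lo: "exp (- m) \<le> Z"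
    using exp_integral_le_nn_integral[OF P ia] nnZ by (simp add: m_def ennreal_le_iff2)
  then show Z: "Z > 0" by (meson exp_gt_zero less_le_trans)
  show "- ln Z \<le> m"
  proof -
    have "ln (exp (- m)) \<le> ln Z" by (rule ln_mono[OF lo]) simp
    then show ?thesis by simp
  qed
  define f where "f \<omega> = m - a \<omega>" for \<omega>
  interpret f: interval_bounded_random_variable M f "m - c" "m + c"
  proof unfold_locales
    show "f \<in> borel_measurable M" unfolding f_def by measurable
    show "AE \<omega> in M. f \<omega> \<in> {m - c..m + c}"
    proof (rule AE_I2)
      fix \<omega> assume "\<omega> \<in> space M"
      from le[OF this] have "- c \<le> a \<omega>" "a \<omega> \<le> c" by linarith+
      then show "f \<omega> \<in> {m - c..m + c}" by (simp add: f_def)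
    qed
  qed
  have "expectation f = 0" using ia by (simp add: f_def[abs_def] m_def prob_space)
  from f.Hoeffdings_lemma_nn_integral_0[OF _ this, of 1]
  have "(\<integral>\<^sup>+ \<omega>. ennreal (exp (f \<omega>)) \<partial>M) \<le> ennreal (exp (c\<^sup>2 / 2))"
    by (simp add: power2_eq_square)
  moreover have "(\<integral>\<^sup>+ \<omega>. ennreal (exp (f \<omega>)) \<partial>M) = ennreal (exp m) * ennreal Z"
    by (simp add: f_def exp_diff exp_minus divide_inverse ennreal_mult nn_integral_cmult nnZ[symmetric])
  ultimately have "exp m * Z \<le> exp (c\<^sup>2 / 2)"
    using Z by (simp flip: ennreal_mult)
  then have "ln (exp m * Z) \<le> ln (exp (c\<^sup>2 / 2))" using Z by (intro ln_mono) auto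
  then show "m - c\<^sup>2 / 2 \<le> - ln Z" using Z by (simp add: ln_mult)
qed

text \<open>The mean of \<open>b\<close> serves as the gradient in \<open>y\<close> of the
  log-Laplace transform. \<open>K\<close> is the Taylor error of \<open>a\<close> averaged, and
  \<open>L\<^sup>2\<close> is the Hoeffding gap for the bound \<open>L * norm y\<close>.\<close>

lemma log_laplace_gradient:
  fixes b :: "'c \<Rightarrow> 'v::euclidean_space"
  assumes P: "prob_space M" and a [measurable]: "a \<in> borel_measurable M" and b [measurable]: "b \<in> borel_measurable M"
    and aL: "\<And>\<omega>. \<omega> \<in> space M \<Longrightarrow> \<bar>a \<omega>\<bar> \<le> L * norm y"
    and bL: "\<And>\<omega>. \<omega> \<in> space M \<Longrightarrow> norm (b \<omega>) \<le> L"
    and ab: "\<And>\<omega>. \<omega> \<in> space M \<Longrightarrow> \<bar>a \<omega> - b \<omega> \<bullet> y\<bar> \<le> K / 2 * (norm y)\<^sup>2"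
  shows "\<bar>- ln (\<integral>\<omega>. exp (- a \<omega>) \<partial>M) - (\<integral>\<omega>. b \<omega> \<partial>M) \<bullet> y\<bar> \<le> (K + L\<^sup>2) / 2 * (norm y)\<^sup>2"
proof -
  interpret prob_space M by fact
  have ia: "integrable M a" by (rule integrable_bounded_prob[OF P a, where c = "L * norm y"]) (use aL in auto)
  have ib: "integrable M b" by (rule integrable_bounded_prob[OF P b bL])
  have "\<bar>(\<integral>\<omega>. a \<omega> \<partial>M) - (\<integral>\<omega>. b \<omega> \<partial>M) \<bullet> y\<bar> = \<bar>\<integral>\<omega>. a \<omega> - b \<omega> \<bullet> y \<partial>M\<bar>"
    using ia ib by simp
  also have "\<dots> \<le> (\<integral>\<omega>. \<bar>a \<omega> - b \<omega> \<bullet> y\<bar> \<partial>M)"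
    by (rule integral_abs_bound)
  also have "\<dots> \<le> (\<integral>\<omega>. K / 2 * (norm y)\<^sup>2 \<partial>M)"
    using ia ib ab by (intro integral_mono) auto
  also have "\<dots> = K / 2 * (norm y)\<^sup>2" by (simp add: prob_space)
  finally have *: "\<bar>(\<integral>\<omega>. a \<omega> \<partial>M) - (\<integral>\<omega>. b \<omega> \<partial>M) \<bullet> y\<bar> \<le> K / 2 * (norm y)\<^sup>2" .
  have "(K + L\<^sup>2) / 2 * (norm y)\<^sup>2 = K / 2 * (norm y)\<^sup>2 + (L * norm y)\<^sup>2 / 2"
    by (simp add: power_mult_distrib field_simps)
  moreover have "0 \<le> (L * norm y)\<^sup>2 / 2" by simp
  ultimately show ?thesis
    using * log_laplace_bounds(1,2)[OF P a aL] by linarith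
qed

text \<open>\<open>p\<close> stands for the gradient of \<psi>. It is kept as a bounded measurable
  function so that averaging it yields a gradient for averages of \<psi>.\<close>

definition tame :: "real \<Rightarrow> real \<Rightarrow> ('v::euclidean_space \<Rightarrow> real) \<Rightarrow> ('v \<Rightarrow> 'v) \<Rightarrow> bool" where
  "tame L K \<psi> p \<longleftrightarrow> \<psi> \<in> borel_measurable borel \<and> p \<in> borel_measurable borel \<and> (\<forall>x. norm (p x) \<le> L) \<and>
    (\<forall>x y. \<bar>\<psi> (x + y) - \<psi> x\<bar> \<le> L * norm y) \<and>
    (\<forall>x y. \<bar>\<psi> (x + y) - \<psi> x - p x \<bullet> y\<bar> \<le> K / 2 * (norm y)\<^sup>2)"

lemma tame_gauss:
  fixes \<psi> :: "'v::euclidean_space \<Rightarrow> real"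
  assumes \<psi>: "tame L K \<psi> p" and \<tau>: "\<tau> > 0"
  defines "I \<equiv> \<lambda>u. (\<integral>z. exp (- \<psi> (u + z)) \<partial>gauss \<tau>)"
  shows "\<And>u. integrable (gauss \<tau>) (\<lambda>z. exp (- \<psi> (u + z)))" and "\<And>u. I u > 0"
    and "\<And>u. \<exists>q. \<forall>y. \<bar>- ln (I (u + y) / I u) - q \<bullet> y\<bar> \<le> (K + L\<^sup>2) / 2 * (norm y)\<^sup>2"
proof -
  interpret prob_space "gauss \<tau> :: 'v measure" by (rule prob_space_gauss[OF \<tau>])
  have [measurable]: "\<psi> \<in> borel_measurable borel" "p \<in> borel_measurable borel"
    using \<psi> by (auto simp: tame_def)
  have lip: "\<bar>\<psi> (x + y) - \<psi> x\<bar> \<le> L * norm y" for x y using \<psi> by (auto simp: tame_def)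
  show int: "integrable (gauss \<tau>) (\<lambda>z. exp (- \<psi> (u + z)))" for u
  proof (rule Bochner_Integration.integrable_bound)
    show "integrable (gauss \<tau>) (\<lambda>z::'v. exp (- \<psi> u + L\<^sup>2 * \<tau>) * exp ((norm z)\<^sup>2 / (4 * \<tau>)))"
      by (intro integrable_mult_right integrable_gauss_exp_square \<tau>)
    show "AE z in gauss \<tau>. norm (exp (- \<psi> (u + z))) \<le> norm (exp (- \<psi> u + L\<^sup>2 * \<tau>) * exp ((norm z)\<^sup>2 / (4 * \<tau>)))"
    proof (rule AE_I2)
      fix z :: 'v
      \<comment> \<open>This square trades the linear growth of \<psi> for the largest quadratic
        exponent whose Gaussian integral is at hand.\<close>
      have "0 \<le> (2 * L * \<tau> - norm z)\<^sup>2 / (4 * \<tau>)" using \<tau> by simp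
      also have "\<dots> = L\<^sup>2 * \<tau> - L * norm z + (norm z)\<^sup>2 / (4 * \<tau>)"
        using \<tau> by (simp add: power2_eq_square field_simps)
      finally have "- \<psi> (u + z) \<le> - \<psi> u + L\<^sup>2 * \<tau> + (norm z)\<^sup>2 / (4 * \<tau>)"
        using lip[of u z] by linarith
      then show "norm (exp (- \<psi> (u + z))) \<le> norm (exp (- \<psi> u + L\<^sup>2 * \<tau>) * exp ((norm z)\<^sup>2 / (4 * \<tau>)))"
        by (simp add: mult_exp_exp)
    qed
  qed simp
  show pos: "I u > 0" for u
  proof -
    have "I u \<noteq> 0"
    proof
      assume "I u = 0"
      then have "AE z in gauss \<tau>. exp (- \<psi> (u + z)) = 0"
        unfolding I_def by (subst (asm) integral_nonneg_eq_0_iff_AE[OF int]) auto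
      then show False by simp
    qed
    moreover have "I u \<ge> 0" by (simp add: I_def)
    ultimately show ?thesis by simp
  qed
  show "\<exists>q. \<forall>y. \<bar>- ln (I (u + y) / I u) - q \<bullet> y\<bar> \<le> (K + L\<^sup>2) / 2 * (norm y)\<^sup>2" for u
  proof -
  \<comment> \<open>The Gibbs measure of \<psi> at \<open>u\<close>. Under it the ratio
    \<open>I (u + y) / I u\<close> is the Laplace transform of the increments of \<psi>, so the
    gradient sought is the \<nu>-mean of \<open>p\<close>.\<close>
  define \<nu> where "\<nu> = density (gauss \<tau>) (\<lambda>z. ennreal (exp (- \<psi> (u + z)) / I u))"
  have P: "prob_space \<nu>"
  proof
    have "emeasure \<nu> (space \<nu>) = (\<integral>\<^sup>+ z. ennreal (exp (- \<psi> (u + z)) / I u) \<partial>gauss \<tau>)"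
      by (simp add: \<nu>_def emeasure_density)
    also have "\<dots> = ennreal (\<integral>z. exp (- \<psi> (u + z)) / I u \<partial>gauss \<tau>)"
      using int pos[of u] by (intro nn_integral_eq_integral) auto
    also have "(\<integral>z. exp (- \<psi> (u + z)) / I u \<partial>gauss \<tau>) = 1"
      using pos[of u] by (simp add: I_def)
    finally show "emeasure \<nu> (space \<nu>) = 1" by simp
  qed
    show ?thesis
  proof (rule exI[of _ "\<integral>z. p (u + z) \<partial>\<nu>"], rule allI)
    fix y
    have "(\<integral>z. exp (- (\<psi> (u + z + y) - \<psi> (u + z))) \<partial>\<nu>)
        = (\<integral>z. (exp (- \<psi> (u + z)) / I u) *\<^sub>R exp (- (\<psi> (u + z + y) - \<psi> (u + z))) \<partial>gauss \<tau>)"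
      unfolding \<nu>_def using pos[of u] by (intro integral_density) (auto intro: less_imp_le)
    also have "\<dots> = (\<integral>z. exp (- \<psi> (u + y + z)) / I u \<partial>gauss \<tau>)"
      by (simp add: mult_exp_exp add_ac)
    also have "\<dots> = I (u + y) / I u" by (simp add: I_def)
    finally have e: "(\<integral>z. exp (- (\<psi> (u + z + y) - \<psi> (u + z))) \<partial>\<nu>) = I (u + y) / I u" .
    have [simp, measurable_cong]: "sets \<nu> = sets borel" by (simp add: \<nu>_def)
    show "\<bar>- ln (I (u + y) / I u) - (\<integral>z. p (u + z) \<partial>\<nu>) \<bullet> y\<bar> \<le> (K + L\<^sup>2) / 2 * (norm y)\<^sup>2"
      unfolding e[symmetric] using \<psi>
      by (intro log_laplace_gradient[OF P]) (auto simp: tame_def)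
  qed
  qed
qed

text \<open>Multiplying two Gaussians adds precisions: \<open>1 / \<tau> + a\<close> corresponds to
  the variance \<open>\<tau> * b\<close>, with centre \<open>b *\<^sub>R x\<close>. The power of
  \<open>sqrt b\<close> corrects the normalisation.\<close>

lemma gdens_times_gaussian:
  fixes x y :: "'v::euclidean_space"
  assumes \<tau>: "\<tau> > 0" and a: "a \<ge> 0"
  defines "b \<equiv> 1 / (1 + a * \<tau>)"
  shows "gdens \<tau> (y - x) * exp (- (a / 2 * (norm y)\<^sup>2))
    = sqrt b ^ DIM('v) * exp (- (a * b / 2 * (norm x)\<^sup>2)) * gdens (\<tau> * b) (y - b *\<^sub>R x)"
proof -
  have at: "1 + a * \<tau> > 0" using \<tau> a by (simp add: add_pos_nonneg)
  then have b: "b > 0" by (simp add: b_def)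
  have ab: "a * \<tau> = 1 / b - 1" using at by (simp add: b_def)
  define P R T where "P = y \<bullet> y" and "R = y \<bullet> x" and "T = x \<bullet> x"
  have a': "a = (1 / b - 1) / \<tau>" using ab \<tau> by (simp add: field_simps)
  have "(P - 2 * R + T) / (2 * \<tau>) + a / 2 * P
      = a * b / 2 * T + (P - 2 * b * R + b\<^sup>2 * T) / (2 * (\<tau> * b))"
    unfolding a' using \<tau> b by (simp add: field_simps power2_eq_square)
  moreover have "(norm (y - x))\<^sup>2 = P - 2 * R + T" "(norm (y - b *\<^sub>R x))\<^sup>2 = P - 2 * b * R + b\<^sup>2 * T"
    unfolding power2_norm_eq_inner P_def R_def T_def
    by (simp_all add: inner_simps inner_commute power2_eq_square algebra_simps)
  ultimately have e: "(norm (y - x))\<^sup>2 / (2 * \<tau>) + a / 2 * (norm y)\<^sup>2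
      = a * b / 2 * (norm x)\<^sup>2 + (norm (y - b *\<^sub>R x))\<^sup>2 / (2 * (\<tau> * b))"
    by (simp add: P_def T_def power2_norm_eq_inner)
  have "exp (- ((norm (y - x))\<^sup>2 / (2 * \<tau>))) * exp (- (a / 2 * (norm y)\<^sup>2))
      = exp (- (a * b / 2 * (norm x)\<^sup>2)) * exp (- ((norm (y - b *\<^sub>R x))\<^sup>2 / (2 * (\<tau> * b))))"
    unfolding mult_exp_exp using e by (metis minus_add_distrib uminus_add_conv_diff diff_conv_add_uminus)
  moreover have "sqrt (2 * pi * (\<tau> * b)) = sqrt (2 * pi * \<tau>) * sqrt b"
    by (simp flip: real_sqrt_mult)
  moreover have "sqrt b ^ DIM('v) > 0" using b by simp
  ultimately show ?thesis
    using b by (simp add: gdens_def power_mult_distrib)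
qed

text \<open>The quadratic part is absorbed into the Gaussian, so that only the Lipschitz part is averaged and
  the constant in \<open>C11\<close> does not depend on \<open>\<tau>\<close>.\<close>

lemma soft_avg_tame_plus_quadratic:
  fixes \<psi> :: "'v::euclidean_space \<Rightarrow> real"
  assumes \<psi>: "tame L K \<psi> p" and a: "a \<ge> 0" and K: "K \<ge> 0" and \<tau>: "\<tau> > 0"
    and pos: "\<And>x. a / 2 * (norm x)\<^sup>2 + \<psi> x \<ge> 0"
  obtains G where "\<And>x. G x \<ge> 0" "\<And>x. soft_avg \<tau> (\<lambda>x. ennreal (a / 2 * (norm x)\<^sup>2 + \<psi> x)) x = ennreal (G x)"
    "C11 (a + K + L\<^sup>2) G"
proof -
  have [measurable]: "\<psi> \<in> borel_measurable borel" using \<psi> by (auto simp: tame_def)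
  define b where "b = 1 / (1 + a * \<tau>)"
  have at: "1 + a * \<tau> \<ge> 1" using \<tau> a by simp
  then have b: "b > 0" "b \<le> 1" by (auto simp: b_def)
  define I where "I u = (\<integral>z. exp (- \<psi> (u + z)) \<partial>gauss (\<tau> * b))" for u
  have \<tau>b: "\<tau> * b > 0" using \<tau> b by simp
  note tg = tame_gauss[OF \<psi> \<tau>b, folded I_def]
  define \<kappa> where "\<kappa> = sqrt b ^ DIM('v)"
  have \<kappa>: "\<kappa> > 0" using b by (simp add: \<kappa>_def)
  define G where "G x = a * b / 2 * (norm x)\<^sup>2 - ln \<kappa> - ln (I (b *\<^sub>R x))" for x
  have eq: "(\<integral>\<^sup>+ z. en (ennreal (a / 2 * (norm (x + z))\<^sup>2 + \<psi> (x + z))) \<partial>gauss \<tau>) = ennreal (exp (- G x))" for x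
  proof -
    define C where "C = \<kappa> * exp (- (a * b / 2 * (norm x)\<^sup>2))"
    have C: "C > 0" using \<kappa> by (simp add: C_def)
    have "(\<integral>\<^sup>+ z. en (ennreal (a / 2 * (norm (x + z))\<^sup>2 + \<psi> (x + z))) \<partial>gauss \<tau>)
        = (\<integral>\<^sup>+ z. ennreal (gdens \<tau> z) * ennreal (exp (- (a / 2 * (norm (x + z))\<^sup>2 + \<psi> (x + z)))) \<partial>lborel)"
      using pos by (simp add: nn_integral_gauss)
    also have "\<dots> = (\<integral>\<^sup>+ y. ennreal (gdens \<tau> (y - x)) * ennreal (exp (- (a / 2 * (norm y)\<^sup>2 + \<psi> y))) \<partial>lborel)"
      using nn_integral_lborel_plus[of "\<lambda>y. ennreal (gdens \<tau> (y - x)) * ennreal (exp (- (a / 2 * (norm y)\<^sup>2 + \<psi> y)))" x]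
      by (simp add: add.commute)
    also have "\<dots> = (\<integral>\<^sup>+ y. ennreal C * (ennreal (gdens (\<tau> * b) (y - b *\<^sub>R x)) * ennreal (exp (- \<psi> y))) \<partial>lborel)"
    proof (rule nn_integral_cong)
      fix y
      have "gdens \<tau> (y - x) * exp (- (a / 2 * (norm y)\<^sup>2 + \<psi> y))
          = (gdens \<tau> (y - x) * exp (- (a / 2 * (norm y)\<^sup>2))) * exp (- \<psi> y)"
        by (simp add: mult_exp_exp)
      also have "\<dots> = C * (gdens (\<tau> * b) (y - b *\<^sub>R x) * exp (- \<psi> y))"
        unfolding gdens_times_gaussian[OF \<tau> a] C_def \<kappa>_def b_def by (simp add: mult_ac)
      finally show "ennreal (gdens \<tau> (y - x)) * ennreal (exp (- (a / 2 * (norm y)\<^sup>2 + \<psi> y)))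
          = ennreal C * (ennreal (gdens (\<tau> * b) (y - b *\<^sub>R x)) * ennreal (exp (- \<psi> y)))"
        using \<tau> \<tau>b C by (simp flip: ennreal_mult)
    qed
    also have "\<dots> = ennreal C * (\<integral>\<^sup>+ y. ennreal (gdens (\<tau> * b) (y - b *\<^sub>R x)) * ennreal (exp (- \<psi> y)) \<partial>lborel)"
      by (rule nn_integral_cmult) simp
    also have "(\<integral>\<^sup>+ y. ennreal (gdens (\<tau> * b) (y - b *\<^sub>R x)) * ennreal (exp (- \<psi> y)) \<partial>lborel)
        = (\<integral>\<^sup>+ z. ennreal (exp (- \<psi> (b *\<^sub>R x + z))) \<partial>gauss (\<tau> * b))"
      using nn_integral_lborel_plus[of "\<lambda>y. ennreal (gdens (\<tau> * b) (y - b *\<^sub>R x)) * ennreal (exp (- \<psi> y))" "b *\<^sub>R x"]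
      by (simp add: nn_integral_gauss add.commute)
    also have "\<dots> = ennreal (I (b *\<^sub>R x))"
      unfolding I_def by (intro nn_integral_eq_integral tg) auto
    also have "ennreal C * ennreal (I (b *\<^sub>R x)) = ennreal (exp (- G x))"
    proof -
      have "exp (- G x) = exp (ln \<kappa>) * exp (- (a * b / 2 * (norm x)\<^sup>2)) * exp (ln (I (b *\<^sub>R x)))"
        by (simp add: G_def mult_exp_exp algebra_simps)
      then have "exp (- G x) = C * I (b *\<^sub>R x)" using \<kappa> tg(2) by (simp add: C_def)
      then show ?thesis using C tg(2)[of "b *\<^sub>R x"] by (simp add: ennreal_mult)
    qed
    finally show ?thesis .
  qed
  show ?thesis
  proof
    show "soft_avg \<tau> (\<lambda>x. ennreal (a / 2 * (norm x)\<^sup>2 + \<psi> x)) x = ennreal (G x)" for x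
      unfolding soft_avg_def eq by (rule nlog_exp)
    show "G x \<ge> 0" for x
      using nn_integral_en_le_1[OF \<tau>, of "\<lambda>x. ennreal (a / 2 * (norm x)\<^sup>2 + \<psi> x)" x] unfolding eq
      by (simp add: ennreal_le_1)
    show "C11 (a + K + L\<^sup>2) G"
      unfolding C11_def
    proof
      fix x
      obtain q where q: "\<And>y. \<bar>- ln (I (b *\<^sub>R x + y) / I (b *\<^sub>R x)) - q \<bullet> y\<bar> \<le> (K + L\<^sup>2) / 2 * (norm y)\<^sup>2"
        using tg(3) by metis
      show "\<exists>p. \<forall>w. \<bar>G (x + w) - G x - p \<bullet> w\<bar> \<le> (a + K + L\<^sup>2) / 2 * (norm w)\<^sup>2"
      \<comment> \<open>The gradient combines the quadratic term with the chain rule for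
        \<open>b *\<^sub>R x\<close>. As \<open>b \<le> 1\<close>, both the coefficient
        \<open>a * b\<close> and the rescaling of the argument only improve the second-order bounds,
        whatever \<tau> is.\<close>
      proof (rule exI[of _ "(a * b) *\<^sub>R x + b *\<^sub>R q"], rule allI)
        fix w
        have n: "(norm (x + w))\<^sup>2 = (norm x)\<^sup>2 + 2 * (x \<bullet> w) + (norm w)\<^sup>2"
          unfolding power2_norm_eq_inner by (simp add: inner_simps inner_commute)
        have "G (x + w) - G x - ((a * b) *\<^sub>R x + b *\<^sub>R q) \<bullet> w
            = a * b / 2 * (norm w)\<^sup>2 + (- ln (I (b *\<^sub>R x + b *\<^sub>R w) / I (b *\<^sub>R x)) - q \<bullet> (b *\<^sub>R w))"
          unfolding G_def n using tg(2)[of "b *\<^sub>R x + b *\<^sub>R w"] tg(2)[of "b *\<^sub>R x"]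
          by (simp add: ln_div scaleR_add_right inner_add_left algebra_simps add_divide_distrib)
        moreover have "\<bar>- ln (I (b *\<^sub>R x + b *\<^sub>R w) / I (b *\<^sub>R x)) - q \<bullet> (b *\<^sub>R w)\<bar> \<le> (K + L\<^sup>2) / 2 * (norm w)\<^sup>2"
        proof -
          have "(norm (b *\<^sub>R w))\<^sup>2 \<le> (norm w)\<^sup>2"
            using b by (intro power_mono) (auto simp: mult_left_le_one_le)
          then have "(K + L\<^sup>2) / 2 * (norm (b *\<^sub>R w))\<^sup>2 \<le> (K + L\<^sup>2) / 2 * (norm w)\<^sup>2"
            using K by (intro mult_left_mono) auto
          then show ?thesis using q[of "b *\<^sub>R w"] by linarith
        qed
        moreover have "0 \<le> a * b / 2 * (norm w)\<^sup>2" "a * b / 2 * (norm w)\<^sup>2 \<le> a / 2 * (norm w)\<^sup>2"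
          using a b by (auto intro!: mult_right_mono simp: mult_left_le)
        moreover have "(a + K + L\<^sup>2) / 2 * (norm w)\<^sup>2 = a / 2 * (norm w)\<^sup>2 + (K + L\<^sup>2) / 2 * (norm w)\<^sup>2"
          by (simp add: field_simps)
        ultimately show "\<bar>G (x + w) - G x - ((a * b) *\<^sub>R x + b *\<^sub>R q) \<bullet> w\<bar> \<le> (a + K + L\<^sup>2) / 2 * (norm w)\<^sup>2"
          by linarith
      qed
    qed
  qed
qed

text \<open>The term \<open>L\<^sup>2\<close> is slack here. It makes the constant the same as after
  averaging, so that one \<open>K\<close> serves for all steps of the iteration.\<close>

lemma C11_tame_plus_quadratic:
  assumes \<psi>: "tame L K \<psi> p" and a: "a \<ge> 0"
  shows "C11 (a + K + L\<^sup>2) (\<lambda>x. a / 2 * (norm x)\<^sup>2 + \<psi> x)"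
  unfolding C11_def
proof
  fix z
  show "\<exists>q. \<forall>w. \<bar>a / 2 * (norm (z + w))\<^sup>2 + \<psi> (z + w) - (a / 2 * (norm z)\<^sup>2 + \<psi> z) - q \<bullet> w\<bar>
      \<le> (a + K + L\<^sup>2) / 2 * (norm w)\<^sup>2"
  proof (rule exI[of _ "a *\<^sub>R z + p z"], rule allI)
    fix w
    have n: "(norm (z + w))\<^sup>2 = (norm z)\<^sup>2 + 2 * (z \<bullet> w) + (norm w)\<^sup>2"
      unfolding power2_norm_eq_inner by (simp add: inner_simps inner_commute)
    have "a / 2 * (norm (z + w))\<^sup>2 + \<psi> (z + w) - (a / 2 * (norm z)\<^sup>2 + \<psi> z) - (a *\<^sub>R z + p z) \<bullet> w
        = a / 2 * (norm w)\<^sup>2 + (\<psi> (z + w) - \<psi> z - p z \<bullet> w)"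
      unfolding n by (simp add: inner_add_left algebra_simps add_divide_distrib)
    moreover have "\<bar>\<psi> (z + w) - \<psi> z - p z \<bullet> w\<bar> \<le> K / 2 * (norm w)\<^sup>2"
      using \<psi> by (auto simp: tame_def)
    moreover have "0 \<le> a / 2 * (norm w)\<^sup>2" "0 \<le> L\<^sup>2 / 2 * (norm w)\<^sup>2" using a by auto
    moreover have "(a + K + L\<^sup>2) / 2 * (norm w)\<^sup>2 = a / 2 * (norm w)\<^sup>2 + K / 2 * (norm w)\<^sup>2 + L\<^sup>2 / 2 * (norm w)\<^sup>2"
      by (simp add: field_simps)
    ultimately show "\<bar>a / 2 * (norm (z + w))\<^sup>2 + \<psi> (z + w) - (a / 2 * (norm z)\<^sup>2 + \<psi> z) - (a *\<^sub>R z + p z) \<bullet> w\<bar>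
      \<le> (a + K + L\<^sup>2) / 2 * (norm w)\<^sup>2" by linarith
  qed
qed

section \<open>Convergence of the iterated controlled averages\<close>

text \<open>Log-sum-exp smoothing, at scale \<eta>, of the minimum of the affine functions
  \<open>r i - l i \<bullet> x\<close>.\<close>

definition softmin :: "'i set \<Rightarrow> ('i \<Rightarrow> real) \<Rightarrow> ('i \<Rightarrow> 'v::euclidean_space) \<Rightarrow> real \<Rightarrow> 'v \<Rightarrow> real" where
  "softmin I r l \<eta> x = - \<eta> * ln (\<Sum>i\<in>I. exp ((l i \<bullet> x - r i) / \<eta>))"

text \<open>An increment of \<open>softmin\<close> is \<eta> times a log-Laplace transform under the
  Gibbs weights \<open>w x\<close>. The exponent is linear in \<open>y\<close>, so its own Taylor
  error is 0 and only the Hoeffding gap \<open>(L / \<eta>)\<^sup>2\<close> remains; the factor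
  \<eta> turns it into \<open>L\<^sup>2 / \<eta>\<close>.\<close>

lemma softmin_tame:
  fixes l :: "'i \<Rightarrow> 'v::euclidean_space"
  assumes I: "finite I" "I \<noteq> {}" and \<eta>: "\<eta> > 0" and L: "\<And>i. i \<in> I \<Longrightarrow> norm (l i) \<le> L"
  obtains p where "tame L (L\<^sup>2 / \<eta>) (softmin I r l \<eta>) p"
proof -
  have L0: "L \<ge> 0" using I(2) L norm_ge_zero order_trans by blast
  define Z where "Z x = (\<Sum>i\<in>I. exp ((l i \<bullet> x - r i) / \<eta>))" for x
  have Z: "Z x > 0" for x unfolding Z_def using I by (intro sum_pos) auto
  define w where "w x i = exp ((l i \<bullet> x - r i) / \<eta>) / Z x" for x i
  have w: "w x i \<ge> 0" "(\<Sum>i\<in>I. w x i) = 1" for x i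
    using Z[of x] by (auto simp: w_def Z_def simp flip: sum_divide_distrib)
  define p where "p x = - (\<Sum>i\<in>I. w x i *\<^sub>R l i)" for x
  have diff: "softmin I r l \<eta> (x + y) - softmin I r l \<eta> x = \<eta> * - ln (\<Sum>i\<in>I. w x i * exp (l i \<bullet> y / \<eta>))"
    and grad: "\<bar>- ln (\<Sum>i\<in>I. w x i * exp (l i \<bullet> y / \<eta>)) - p x \<bullet> y / \<eta>\<bar> \<le> (0 + (L / \<eta>)\<^sup>2) / 2 * (norm y)\<^sup>2"
    and lip: "\<bar>- ln (\<Sum>i\<in>I. w x i * exp (l i \<bullet> y / \<eta>))\<bar> \<le> L / \<eta> * norm y" for x y
  proof -
    have s: "(\<Sum>i\<in>I. w x i * exp (l i \<bullet> y / \<eta>)) = Z (x + y) / Z x"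
      by (simp add: w_def Z_def sum_divide_distrib inner_add_right mult_exp_exp algebra_simps add_divide_distrib diff_divide_distrib)
    show "softmin I r l \<eta> (x + y) - softmin I r l \<eta> x = \<eta> * - ln (\<Sum>i\<in>I. w x i * exp (l i \<bullet> y / \<eta>))"
      unfolding s softmin_def Z_def[symmetric] ln_divide_pos[OF Z Z] by (simp add: algebra_simps)
    define M where "M = point_measure I (\<lambda>i. ennreal (w x i))"
    have P: "prob_space M"
      unfolding M_def using I w by (intro prob_space_point_measure) (auto simp: sum_ennreal)
    have sp: "space M = I" by (simp add: M_def space_point_measure)
    have int: "(\<integral>i. u i \<partial>M) = (\<Sum>i\<in>I. w x i *\<^sub>R u i)" for u :: "'i \<Rightarrow> 'w::{banach, second_countable_topology}"
      unfolding M_def using I w by (subst lebesgue_integral_point_measure_finite) auto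
    have meas: "u \<in> borel_measurable M" for u :: "'i \<Rightarrow> 'w::topological_space"
      by (simp add: M_def measurable_point_measure_eq1)
    have le: "\<bar>- (l i \<bullet> y) / \<eta>\<bar> \<le> L / \<eta> * norm y" if "i \<in> I" for i
    proof -
      have "\<bar>l i \<bullet> y\<bar> \<le> norm (l i) * norm y" by (rule Cauchy_Schwarz_ineq2)
      also have "\<dots> \<le> L * norm y" using L[OF that] by (rule mult_right_mono) simp
      finally show ?thesis using \<eta> by (simp add: divide_right_mono)
    qed
    have "\<bar>- ln (\<integral>i. exp (- (- (l i \<bullet> y) / \<eta>)) \<partial>M) - (\<integral>i. - (1 / \<eta>) *\<^sub>R l i \<partial>M) \<bullet> y\<bar>
        \<le> (0 + (L / \<eta>)\<^sup>2) / 2 * (norm y)\<^sup>2"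
      by (rule log_laplace_gradient[OF P meas meas])
        (use le L \<eta> in \<open>auto simp: sp divide_right_mono\<close>)
    moreover have "(\<integral>i. - (1 / \<eta>) *\<^sub>R l i \<partial>M) \<bullet> y = p x \<bullet> y / \<eta>"
      by (simp add: int p_def inner_sum_left sum_divide_distrib sum_negf)
    moreover have "(\<integral>i. exp (- (- (l i \<bullet> y) / \<eta>)) \<partial>M) = (\<Sum>i\<in>I. w x i * exp (l i \<bullet> y / \<eta>))"
      by (simp add: int)
    ultimately show "\<bar>- ln (\<Sum>i\<in>I. w x i * exp (l i \<bullet> y / \<eta>)) - p x \<bullet> y / \<eta>\<bar> \<le> (0 + (L / \<eta>)\<^sup>2) / 2 * (norm y)\<^sup>2"
      by (simp only:)
    have bnd: "exp (- (L / \<eta> * norm y)) \<le> exp (l i \<bullet> y / \<eta>)" "exp (l i \<bullet> y / \<eta>) \<le> exp (L / \<eta> * norm y)" if "i \<in> I" for i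
      using le[OF that] unfolding abs_le_iff by auto
    let ?s = "\<Sum>i\<in>I. w x i * exp (l i \<bullet> y / \<eta>)"
    have "?s \<le> (\<Sum>i\<in>I. w x i * exp (L / \<eta> * norm y))"
      using w bnd by (intro sum_mono mult_left_mono) auto
    then have 1: "?s \<le> exp (L / \<eta> * norm y)" using w(2) by (simp flip: sum_distrib_right)
    have "(\<Sum>i\<in>I. w x i * exp (- (L / \<eta> * norm y))) \<le> ?s"
      using w bnd by (intro sum_mono mult_left_mono) auto
    then have 2: "exp (- (L / \<eta> * norm y)) \<le> ?s" using w(2) by (simp flip: sum_distrib_right)
    have 3: "?s > 0" using 2 exp_gt_zero less_le_trans by blast
    have "ln ?s \<le> L / \<eta> * norm y" using ln_mono[OF 1 3] by simp
    moreover have "- (L / \<eta> * norm y) \<le> ln ?s" using ln_mono[OF 2] by simp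
    ultimately show "\<bar>- ln ?s\<bar> \<le> L / \<eta> * norm y" by linarith
  qed
  have "tame L (L\<^sup>2 / \<eta>) (softmin I r l \<eta>) p"
    unfolding tame_def
  proof (intro conjI allI)
    show "softmin I r l \<eta> \<in> borel_measurable borel"
      unfolding softmin_def by measurable
    show "p \<in> borel_measurable borel"
      unfolding p_def w_def Z_def by measurable
    show "norm (p x) \<le> L" for x
    proof -
      have "norm (p x) \<le> (\<Sum>i\<in>I. norm (w x i *\<^sub>R l i))" unfolding p_def norm_minus_cancel by (rule norm_sum)
      also have "\<dots> \<le> (\<Sum>i\<in>I. w x i * L)" using w L by (intro sum_mono) (simp add: mult_left_mono)
      also have "\<dots> = L" using w by (simp flip: sum_distrib_right)
      finally show ?thesis .
    qed
    show "\<bar>softmin I r l \<eta> (x + y) - softmin I r l \<eta> x\<bar> \<le> L * norm y" for x y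
      unfolding diff abs_mult using mult_left_mono[OF lip[of x y], of \<eta>] \<eta> by simp
    show "\<bar>softmin I r l \<eta> (x + y) - softmin I r l \<eta> x - p x \<bullet> y\<bar> \<le> L\<^sup>2 / \<eta> / 2 * (norm y)\<^sup>2" for x y
    proof -
      have "\<eta> * - ln (\<Sum>i\<in>I. w x i * exp (l i \<bullet> y / \<eta>)) - p x \<bullet> y
          = \<eta> * (- ln (\<Sum>i\<in>I. w x i * exp (l i \<bullet> y / \<eta>)) - p x \<bullet> y / \<eta>)"
        using \<eta> by (simp add: right_diff_distrib)
      then show ?thesis
        unfolding diff using mult_left_mono[OF grad[of x y], of \<eta>] \<eta>
        by (simp only: abs_mult) (simp add: power_divide power2_eq_square)
    qed
  qed
  then show ?thesis by (rule that)
qed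

text \<open>The sum of exponentials lies between its largest term and \<open>card I\<close> times
  that term, hence the smoothing error \<open>\<eta> * ln (card I)\<close>.\<close>

lemma softmin_bounds:
  assumes I: "finite I" "I \<noteq> {}" and \<eta>: "\<eta> > 0"
  shows "i \<in> I \<Longrightarrow> softmin I r l \<eta> x \<le> r i - l i \<bullet> x"
    and "(\<And>i. i \<in> I \<Longrightarrow> m \<le> r i - l i \<bullet> x) \<Longrightarrow> m \<le> softmin I r l \<eta> x + \<eta> * ln (real (card I))"
proof -
  let ?Z = "\<Sum>i\<in>I. exp ((l i \<bullet> x - r i) / \<eta>)"
  have Z: "?Z > 0" using I by (intro sum_pos) auto
  {
    assume i: "i \<in> I"
    have "exp ((l i \<bullet> x - r i) / \<eta>) \<le> ?Z" using I i by (intro member_le_sum) auto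
    then have "(l i \<bullet> x - r i) / \<eta> \<le> ln ?Z" using Z by (simp add: ln_ge_iff)
    then show "softmin I r l \<eta> x \<le> r i - l i \<bullet> x"
      using \<eta> by (simp add: softmin_def field_simps)
  next
    assume m: "\<And>i. i \<in> I \<Longrightarrow> m \<le> r i - l i \<bullet> x"
    have "?Z \<le> (\<Sum>i\<in>I. exp (- m / \<eta>))"
    proof (rule sum_mono)
      fix i assume "i \<in> I"
      then have "l i \<bullet> x - r i \<le> - m" using m[of i] by simp
      then show "exp ((l i \<bullet> x - r i) / \<eta>) \<le> exp (- m / \<eta>)"
        using \<eta> by (intro iffD2[OF exp_le_cancel_iff] divide_right_mono) auto
    qed
    also have "\<dots> = real (card I) * exp (- m / \<eta>)" by simp
    finally have "ln ?Z \<le> ln (real (card I) * exp (- m / \<eta>))" using Z by (intro ln_mono)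
    also have "\<dots> = ln (real (card I)) - m / \<eta>" using I by (subst ln_mult) (auto simp: card_gt_0_iff)
    finally have "\<eta> * ln ?Z \<le> \<eta> * (ln (real (card I)) - m / \<eta>)" using \<eta> by simp
    then show "m \<le> softmin I r l \<eta> x + \<eta> * ln (real (card I))"
      using \<eta> by (simp add: softmin_def right_diff_distrib)
  }
qed

section \<open>Accumulating the one-step errors and removing the smoothing\<close>

lemma ctrl_avg_add_const:
  fixes \<phi> :: "'v::euclidean_space \<Rightarrow> ennreal"
  assumes h: "h > 0" and [measurable]: "\<phi> \<in> borel_measurable borel"
  shows "ctrl_avg d h (\<lambda>x. \<phi> x + c) x = ctrl_avg d h \<phi> x + c"
proof -
  interpret prob_space "gauss h :: 'v measure" by (rule prob_space_gauss[OF h])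
  have "(\<integral>\<^sup>+ z. \<phi> (x + d i + z) + c \<partial>gauss h) = (\<integral>\<^sup>+ z. \<phi> (x + d i + z) \<partial>gauss h) + c" for i
    using emeasure_space_1 by (subst nn_integral_add) simp_all
  then show ?thesis
    unfolding ctrl_avg_def by (simp only: INF_ennreal_add_const[symmetric] add.assoc add.commute[of c])
qed

lemma soft_avg_add_const_le:
  fixes \<phi> :: "'v::euclidean_space \<Rightarrow> ennreal"
  assumes h: "h > 0" and [measurable]: "\<phi> \<in> borel_measurable borel"
  shows "soft_avg h (\<lambda>x. \<phi> x + c) x \<le> soft_avg h \<phi> x + c"
proof -
  have "(\<integral>\<^sup>+ z. en (\<phi> (x + z) + c) \<partial>gauss h) = en (soft_avg h \<phi> x) * en c"
    unfolding en_soft_avg[OF h] en_add by (rule nn_integral_multc) simp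
  then show ?thesis
    by (simp add: soft_avg_def[of h "\<lambda>x. \<phi> x + c"] nlog_le_iff en_add)
qed

lemma ctrl_avg_iterate_mono: "(\<And>x. \<phi> x \<le> \<psi> x) \<Longrightarrow> (ctrl_avg d h ^^ N) \<phi> x \<le> (ctrl_avg d h ^^ N) \<psi> x"
  by (induction N arbitrary: x) (auto intro: ctrl_avg_mono)

text \<open>Constants pass through \<open>ctrl_avg\<close>, so the errors of the steps simply add.
  Each step starts from a soft average of the original function, by the semigroup property, and all
  of these share the constant \<open>K\<close>.\<close>

lemma ctrl_avg_iterate_le:
  fixes \<psi> :: "'v::euclidean_space \<Rightarrow> real"
  assumes \<psi>: "tame L K0 \<psi> p" and a: "a \<ge> 0" and K0: "K0 \<ge> 0"
    and pos: "\<And>x. a / 2 * (norm x)\<^sup>2 + \<psi> x \<ge> 0"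
    and h: "h > 0" and Kh: "K * h \<le> 1 / 4" and K: "K = a + K0 + L\<^sup>2"
    and d: "closure (range d) = UNIV"
  defines "\<phi> \<equiv> \<lambda>x. ennreal (a / 2 * (norm x)\<^sup>2 + \<psi> x)"
  shows "(ctrl_avg d h ^^ N) \<phi> x \<le> (soft_avg h ^^ N) \<phi> x + ennreal (real N * (16 * (K * h)\<^sup>2 * sqrt 2 ^ DIM('v)))"
proof (induction N arbitrary: x)
  case (Suc N)
  define \<epsilon> where "\<epsilon> = 16 * (K * h)\<^sup>2 * sqrt 2 ^ DIM('v)"
  have \<epsilon>: "\<epsilon> \<ge> 0" by (simp add: \<epsilon>_def)
  have [measurable]: "\<psi> \<in> borel_measurable borel" using \<psi> by (simp add: tame_def)
  have [measurable]: "\<phi> \<in> borel_measurable borel" unfolding \<phi>_def by measurable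
  obtain G where G: "\<And>x. G x \<ge> 0" "(soft_avg h ^^ N) \<phi> = (\<lambda>x. ennreal (G x))" "C11 K G"
  proof (cases N)
    case 0
    then show ?thesis
      using that[of "\<lambda>x. a / 2 * (norm x)\<^sup>2 + \<psi> x"] pos C11_tame_plus_quadratic[OF \<psi> a] by (simp add: \<phi>_def K)
  next
    case (Suc n)
    have "real (Suc n) * h > 0" using h by simp
    from soft_avg_tame_plus_quadratic[OF \<psi> a K0 this pos]
    obtain G where G: "\<And>x. G x \<ge> 0" "\<And>x. soft_avg (real (Suc n) * h) \<phi> x = ennreal (G x)" "C11 K G"
      unfolding \<phi>_def K by blast
    have "(soft_avg h ^^ N) \<phi> = (\<lambda>x. ennreal (G x))"
      unfolding Suc soft_avg_iterate[OF h \<open>\<phi> \<in> borel_measurable borel\<close>] by (rule ext) (rule G(2))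
    then show ?thesis using that[of G] G by blast
  qed
  have [measurable]: "G \<in> borel_measurable borel"
    by (rule borel_measurable_continuous_onI[OF C11_continuous[OF G(3)]])
  have K_nonneg: "K \<ge> 0" using a K0 by (simp add: K)
  have "(ctrl_avg d h ^^ Suc N) \<phi> x \<le> ctrl_avg d h (\<lambda>x. ennreal (G x) + ennreal (real N * \<epsilon>)) x"
    using Suc[folded \<epsilon>_def] unfolding G(2) by (simp add: ctrl_avg_mono)
  also have "\<dots> = ctrl_avg d h (\<lambda>x. ennreal (G x)) x + ennreal (real N * \<epsilon>)"
    by (rule ctrl_avg_add_const[OF h]) simp
  also have "\<dots> \<le> (soft_avg h (\<lambda>x. ennreal (G x)) x + ennreal \<epsilon>) + ennreal (real N * \<epsilon>)"
    unfolding \<epsilon>_def by (intro add_right_mono ctrl_avg_le_soft_avg_C11 G K_nonneg Kh h d)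
  also have "\<dots> = (soft_avg h ^^ Suc N) \<phi> x + ennreal (real (Suc N) * \<epsilon>)"
    using \<epsilon> by (simp add: G(2) add.assoc algebra_simps flip: ennreal_plus)
  finally show ?case by (simp only: \<epsilon>_def)
qed simp

text \<open>Subtracting the common quadratic turns the finite minimum of paraboloids into a minimum
  of affine functions. Replacing it by \<open>softmin\<close> at a small fixed \<eta> costs at most
  \<open>e\<close>, and the regularity constant \<open>K\<close> then depends on \<eta> but not on
  \<open>N\<close>.\<close>

lemma limsup_ctrl_avg_iterate_finite:
  fixes y :: "nat \<Rightarrow> 'v::euclidean_space"
  assumes k: "k > 0" and T: "T > 0" and d: "closure (range d) = UNIV"
    and I: "finite I" "I \<noteq> {}" and r: "\<And>i. i \<in> I \<Longrightarrow> r i \<ge> 0"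
  defines "F \<equiv> \<lambda>x. INF i\<in>I. ennreal (r i + k / 2 * (norm (x - y i))\<^sup>2)"
  shows "limsup (\<lambda>N. (ctrl_avg d (T / real (Suc N)) ^^ Suc N) F x) \<le> soft_avg T F x"
proof (rule ennreal_le_epsilon)
  fix e :: real assume e: "e > 0"
  \<comment> \<open>The summand 1 keeps the denominator positive when \<open>I\<close> has one
    element and the logarithm vanishes.\<close>
  define \<eta> where "\<eta> = e / (ln (real (card I)) + 1)"
  have card: "card I > 0" using I by (simp add: card_gt_0_iff)
  have lnc: "ln (real (card I)) \<ge> 0" using card by (simp add: Suc_leI)
  define q where "q = ln (real (card I))"
  have q: "q + 1 > 0" using lnc by (simp add: q_def)
  have \<eta>: "\<eta> > 0" "\<eta> * ln (real (card I)) \<le> e"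
    unfolding \<eta>_def q_def[symmetric] using e q by (simp_all add: field_simps)
  define C where "C = \<eta> * ln (real (card I))"
  have C: "0 \<le> C" using \<eta> lnc by (simp add: C_def)
  define l where "l i = k *\<^sub>R y i" for i
  define r' where "r' i = r i + k / 2 * (norm (y i))\<^sup>2" for i
  define L where "L = Max ((\<lambda>i. norm (l i)) ` I)"
  have L: "norm (l i) \<le> L" if "i \<in> I" for i unfolding L_def using I that by (intro Max_ge) auto
  obtain p0 where p0: "tame L (L\<^sup>2 / \<eta>) (softmin I r' l \<eta>) p0"
    using softmin_tame[OF I \<eta>(1), of l L r'] L by blast
  \<comment> \<open>Adding the smoothing error \<open>C\<close> makes the approximation lie above
    \<open>F\<close>; in particular it is nonnegative.\<close>
  define \<psi> where "\<psi> x = softmin I r' l \<eta> x + C" for x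
  have \<psi>: "tame L (L\<^sup>2 / \<eta>) \<psi> p0"
    using p0 by (auto simp: tame_def \<psi>_def[abs_def])
  have par: "r i + k / 2 * (norm (x - y i))\<^sup>2 = k / 2 * (norm x)\<^sup>2 + (r' i - l i \<bullet> x)" for x i
    unfolding r'_def l_def power2_norm_eq_inner
    by (simp add: inner_simps inner_commute algebra_simps)
  define \<Phi> where "\<Phi> x = k / 2 * (norm x)\<^sup>2 + \<psi> x" for x
  have F_attained: "\<exists>i\<in>I. F x = ennreal (r i + k / 2 * (norm (x - y i))\<^sup>2) \<and>
      (\<forall>j\<in>I. r i + k / 2 * (norm (x - y i))\<^sup>2 \<le> r j + k / 2 * (norm (x - y j))\<^sup>2)" for x
  proof -
    obtain i where i: "i \<in> I" "\<And>j. j \<in> I \<Longrightarrow> r i + k / 2 * (norm (x - y i))\<^sup>2 \<le> r j + k / 2 * (norm (x - y j))\<^sup>2"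
    proof -
      define \<rho> where "\<rho> i = r i + k / 2 * (norm (x - y i))\<^sup>2" for i
      have "Min (\<rho> ` I) \<in> \<rho> ` I" using I by (intro Min_in) auto
      then obtain i where "i \<in> I" "Min (\<rho> ` I) = \<rho> i" by auto
      moreover from this have "\<rho> i \<le> \<rho> j" if "j \<in> I" for j
        using I Min_le[of "\<rho> ` I" "\<rho> j"] that by simp
      ultimately show ?thesis using that unfolding \<rho>_def by blast
    qed
    have "F x = ennreal (r i + k / 2 * (norm (x - y i))\<^sup>2)"
      unfolding F_def by (rule antisym) (use i in \<open>auto intro!: INF_lower INF_greatest ennreal_leI\<close>)
    then show ?thesis using i by auto
  qed
  have F_\<Phi>: "F x \<le> ennreal (\<Phi> x)" and \<Phi>_F: "ennreal (\<Phi> x) \<le> F x + ennreal C" and \<Phi>0: "\<Phi> x \<ge> 0" for x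
  proof -
    obtain i where i: "i \<in> I" "F x = ennreal (r i + k / 2 * (norm (x - y i))\<^sup>2)"
        "\<And>j. j \<in> I \<Longrightarrow> r i + k / 2 * (norm (x - y i))\<^sup>2 \<le> r j + k / 2 * (norm (x - y j))\<^sup>2"
      using F_attained[of x] by blast
    have Fi: "r i + k / 2 * (norm (x - y i))\<^sup>2 \<ge> 0" using r[OF i(1)] k by simp
    have "r' i - l i \<bullet> x \<le> \<psi> x"
      unfolding \<psi>_def C_def using i(3)[unfolded par] by (intro softmin_bounds(2)[OF I \<eta>(1)]) simp
    then have ge: "r i + k / 2 * (norm (x - y i))\<^sup>2 \<le> \<Phi> x" unfolding \<Phi>_def par by simp
    then show "F x \<le> ennreal (\<Phi> x)" by (simp add: i(2) ennreal_leI)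
    show "\<Phi> x \<ge> 0" using ge Fi by linarith
    have "\<Phi> x \<le> r i + k / 2 * (norm (x - y i))\<^sup>2 + C"
      unfolding par \<Phi>_def \<psi>_def using softmin_bounds(1)[OF I \<eta>(1) i(1)] by simp
    then show "ennreal (\<Phi> x) \<le> F x + ennreal C"
      unfolding i(2) using Fi C by (simp add: ennreal_leI flip: ennreal_plus)
  qed
  have [measurable]: "F \<in> borel_measurable borel"
    unfolding F_def using I by measurable
  have [measurable]: "\<Phi> \<in> borel_measurable borel"
  proof -
    have [measurable]: "\<psi> \<in> borel_measurable borel" using \<psi> by (simp add: tame_def)
    show ?thesis unfolding \<Phi>_def by measurable
  qed
  define K where "K = k + L\<^sup>2 / \<eta> + L\<^sup>2"
  \<comment> \<open>The total error of \<open>Suc N\<close> steps of length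
    \<open>T / real (Suc N)\<close> is \<open>B / real (Suc N)\<close>.\<close>
  define B where "B = 16 * K\<^sup>2 * T\<^sup>2 * sqrt 2 ^ DIM('v)"
  have step: "(ctrl_avg d (T / real (Suc N)) ^^ Suc N) F x \<le> soft_avg T (\<lambda>x. ennreal (\<Phi> x)) x + ennreal (B / real (Suc N))"
    if N: "4 * K * T \<le> real (Suc N)" for N
  proof -
    define h where "h = T / real (Suc N)"
    have h: "h > 0" "real (Suc N) * h = T" using T by (auto simp: h_def)
    have Kh: "K * h \<le> 1 / 4" using N by (simp add: h_def field_simps)
    have "(ctrl_avg d h ^^ Suc N) F x \<le> (ctrl_avg d h ^^ Suc N) (\<lambda>x. ennreal (\<Phi> x)) x"
      by (rule ctrl_avg_iterate_mono) (rule F_\<Phi>)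
    also have "\<dots> \<le> (soft_avg h ^^ Suc N) (\<lambda>x. ennreal (\<Phi> x)) x + ennreal (real (Suc N) * (16 * (K * h)\<^sup>2 * sqrt 2 ^ DIM('v)))"
      unfolding \<Phi>_def
      by (rule ctrl_avg_iterate_le[OF \<psi> _ _ \<Phi>0[unfolded \<Phi>_def] h(1) Kh K_def d]) (use k \<eta> in auto)
    also have "(soft_avg h ^^ Suc N) (\<lambda>x. ennreal (\<Phi> x)) = soft_avg T (\<lambda>x. ennreal (\<Phi> x))"
      using soft_avg_iterate[OF h(1), of "\<lambda>x. ennreal (\<Phi> x)" N] h(2) by simp
    also have "real (Suc N) * (16 * (K * h)\<^sup>2 * sqrt 2 ^ DIM('v)) = B / real (Suc N)"
      by (simp add: B_def h_def power2_eq_square field_simps del: of_nat_Suc)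
    finally show ?thesis by (simp add: h_def)
  qed
  have "limsup (\<lambda>N. (ctrl_avg d (T / real (Suc N)) ^^ Suc N) F x)
      \<le> limsup (\<lambda>N. soft_avg T (\<lambda>x. ennreal (\<Phi> x)) x + ennreal (B / real (Suc N)))"
  proof (rule Limsup_mono)
    obtain N0 :: nat where "4 * K * T \<le> real N0" using real_arch_simple by blast
    then have "4 * K * T \<le> real (Suc N)" if "N \<ge> N0" for N using that by linarith
    then show "\<forall>\<^sub>F N in sequentially. (ctrl_avg d (T / real (Suc N)) ^^ Suc N) F x
        \<le> soft_avg T (\<lambda>x. ennreal (\<Phi> x)) x + ennreal (B / real (Suc N))"
      unfolding eventually_sequentially using step by blast
  qed
  also have "\<dots> = soft_avg T (\<lambda>x. ennreal (\<Phi> x)) x + ennreal 0"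
  proof (rule lim_imp_Limsup)
    have "(\<lambda>N. B / real (Suc N)) \<longlonglongrightarrow> 0"
      using tendsto_mult[OF tendsto_const LIMSEQ_inverse_real_of_nat, of B] by (simp add: divide_inverse)
    then show "(\<lambda>N. soft_avg T (\<lambda>x. ennreal (\<Phi> x)) x + ennreal (B / real (Suc N)))
        \<longlonglongrightarrow> soft_avg T (\<lambda>x. ennreal (\<Phi> x)) x + ennreal 0"
      by (intro tendsto_add tendsto_const tendsto_ennrealI)
  qed simp
  also have "\<dots> \<le> soft_avg T (\<lambda>x. F x + ennreal C) x"
    using \<Phi>_F by (simp add: soft_avg_mono)
  also have "\<dots> \<le> soft_avg T F x + ennreal C"
    by (rule soft_avg_add_const_le[OF T]) simp
  also have "\<dots> \<le> soft_avg T F x + ennreal e"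
    using \<eta>(2) by (intro add_left_mono ennreal_leI) (simp add: C_def)
  finally show "limsup (\<lambda>N. (ctrl_avg d (T / real (Suc N)) ^^ Suc N) F x) \<le> soft_avg T F x + ennreal e" .
qed

text \<open>Dropping all but finitely many paraboloids only increases the controlled averages, so
  the limsup lies below the soft average of each partial minimum. Monotone convergence is then
  applied to the soft averages alone.\<close>

lemma limsup_ctrl_avg_iterate_env:
  fixes y :: "nat \<Rightarrow> 'v::euclidean_space"
  assumes k: "k > 0" and T: "T > 0" and d: "closure (range d) = UNIV"
  shows "limsup (\<lambda>N. (ctrl_avg d (T / real (Suc N)) ^^ Suc N) (env k c y) x) \<le> soft_avg T (env k c y) x"
    (is "?L \<le> _")
proof -
  define F where "F m x = (INF i\<in>{..m}. c i + ennreal (k / 2 * (norm (x - y i))\<^sup>2))" for m :: nat and x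
  have [measurable]: "F m \<in> borel_measurable borel" for m unfolding F_def by measurable
  have le: "?L \<le> soft_avg T (F m) x" for m
  proof -
    \<comment> \<open>Infinite values contribute nothing to the minimum, and the finite case works
      with real heights. If none is finite, the soft average is \<open>\<top>\<close>.\<close>
    define I where "I = {i\<in>{..m}. c i < \<top>}"
    define r where "r i = enn2real (c i)" for i
    have r: "c i = ennreal (r i)" if "i \<in> I" for i using that by (simp add: I_def r_def)
    have r0: "r i \<ge> 0" for i by (simp add: r_def)
    have F_I: "F m x = (INF i\<in>I. ennreal (r i + k / 2 * (norm (x - y i))\<^sup>2))" for x
    proof -
      have "(INF i\<in>I. ennreal (r i + k / 2 * (norm (x - y i))\<^sup>2)) = (INF i\<in>I. c i + ennreal (k / 2 * (norm (x - y i))\<^sup>2))"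
        using k r0 by (intro INF_cong) (simp_all add: r)
      also have "\<dots> = F m x"
        unfolding F_def
      proof (rule antisym)
        show "(INF i\<in>I. c i + ennreal (k / 2 * (norm (x - y i))\<^sup>2)) \<le> (INF i\<in>{..m}. c i + ennreal (k / 2 * (norm (x - y i))\<^sup>2))"
        proof (rule INF_greatest)
          fix i assume "i \<in> {..m}"
          then show "(INF i\<in>I. c i + ennreal (k / 2 * (norm (x - y i))\<^sup>2)) \<le> c i + ennreal (k / 2 * (norm (x - y i))\<^sup>2)"
            by (cases "c i < \<top>") (auto simp: I_def intro!: INF_lower simp: less_top[symmetric])
        qed
      qed (auto simp: I_def intro!: INF_superset_mono)
      finally show ?thesis by simp
    qed
    show ?thesis
    proof (cases "I = {}")
      case True
      then have "F m = (\<lambda>x. \<top>)" using F_I by auto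
      then have "soft_avg T (F m) x = \<top>" by (simp add: soft_avg_def nlog_def)
      then show ?thesis by simp
    next
      case False
      have "?L \<le> limsup (\<lambda>N. (ctrl_avg d (T / real (Suc N)) ^^ Suc N) (F m) x)"
        by (intro Limsup_mono always_eventually allI ctrl_avg_iterate_mono)
          (auto simp: env_def F_def intro!: INF_superset_mono)
      also have "\<dots> \<le> soft_avg T (F m) x"
        unfolding F_I[abs_def]
        by (rule limsup_ctrl_avg_iterate_finite[OF k T d]) (use False in \<open>auto simp: I_def r_def\<close>)
      finally show ?thesis .
    qed
  qed
  have "(\<integral>\<^sup>+ z. en (env k c y (x + z)) \<partial>gauss T) = (\<integral>\<^sup>+ z. (SUP m. en (F m (x + z))) \<partial>gauss T)"
  proof (rule nn_integral_cong)
    fix z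
    have "env k c y (x + z) = (INF m. F m (x + z))"
      unfolding env_def F_def
    proof (rule antisym; rule INF_greatest)
      fix m show "(INF i. c i + ennreal (k / 2 * (norm (x + z - y i))\<^sup>2))
          \<le> (INF i\<in>{..m}. c i + ennreal (k / 2 * (norm (x + z - y i))\<^sup>2))"
        by (intro INF_superset_mono) auto
    next
      fix j show "(INF m. INF i\<in>{..m}. c i + ennreal (k / 2 * (norm (x + z - y i))\<^sup>2))
          \<le> c j + ennreal (k / 2 * (norm (x + z - y j))\<^sup>2)"
        by (rule INF_lower2[of j]) (auto intro: INF_lower)
    qed
    then show "en (env k c y (x + z)) = (SUP m. en (F m (x + z)))" by (simp add: en_INF)
  qed
  also have "\<dots> = (SUP m. \<integral>\<^sup>+ z. en (F m (x + z)) \<partial>gauss T)"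
    by (rule nn_integral_monotone_convergence_SUP)
      (auto simp: incseq_def le_fun_def en_le_iff F_def intro!: INF_superset_mono)
  also have "\<dots> \<le> en ?L"
  proof (rule SUP_least)
    fix m
    show "(\<integral>\<^sup>+ z. en (F m (x + z)) \<partial>gauss T) \<le> en ?L"
      using le[of m] unfolding en_soft_avg[OF T, symmetric] by (simp add: en_le_iff)
  qed
  finally have "nlog (en ?L) \<le> soft_avg T (env k c y) x"
    unfolding soft_avg_def by (rule nlog_antimono)
  then show ?thesis by (simp add: nlog_en)
qed

section \<open>The inequality for Gaussian averages\<close>

text \<open>Choose zero drift in every step and compose the noises. This bound is uniform in the
  number of steps for a fixed total time and feeds the dominating function of the limit.\<close>

lemma ctrl_avg_iterate_le_average:
  fixes \<phi> :: "'v::euclidean_space \<Rightarrow> ennreal"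
  assumes h: "h > 0" and d0: "d 0 = 0" and [measurable]: "\<phi> \<in> borel_measurable borel"
  shows "(ctrl_avg d h ^^ Suc N) \<phi> x \<le> (\<integral>\<^sup>+ z. \<phi> (x + z) \<partial>gauss (real (Suc N) * h))"
proof (induction N arbitrary: x)
  case 0
  show ?case
    using d0 by (auto simp: ctrl_avg_def intro!: INF_lower2[of 0])
next
  case (Suc N)
  have pos: "real (Suc N) * h > 0" using h by simp
  have "(ctrl_avg d h ^^ Suc (Suc N)) \<phi> x \<le> (\<integral>\<^sup>+ z. (ctrl_avg d h ^^ Suc N) \<phi> (x + d 0 + z) \<partial>gauss h) + ennreal ((norm (d 0))\<^sup>2 / (2 * h))"
    unfolding funpow.simps(2)[of "Suc N"] comp_def ctrl_avg_def[of d h "(ctrl_avg d h ^^ Suc N) \<phi>"] by (rule INF_lower) simp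
  also have "\<dots> = (\<integral>\<^sup>+ z. (ctrl_avg d h ^^ Suc N) \<phi> (x + z) \<partial>gauss h)" by (simp add: d0 del: funpow.simps)
  also have "\<dots> \<le> (\<integral>\<^sup>+ z. (\<integral>\<^sup>+ w. \<phi> (x + (z + w)) \<partial>gauss (real (Suc N) * h)) \<partial>gauss h)"
  proof (rule nn_integral_mono)
    fix z show "(ctrl_avg d h ^^ Suc N) \<phi> (x + z) \<le> (\<integral>\<^sup>+ w. \<phi> (x + (z + w)) \<partial>gauss (real (Suc N) * h))"
      using Suc[of "x + z"] by (simp only: add.assoc)
  qed
  also have "\<dots> = (\<integral>\<^sup>+ z. \<phi> (x + z) \<partial>gauss (h + real (Suc N) * h))"
    by (rule nn_integral_gauss_convolution[OF h pos]) simp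
  also have "h + real (Suc N) * h = real (Suc (Suc N)) * h" by (simp add: algebra_simps)
  finally show ?case .
qed

lemma AE_gauss: "AE z in lborel. P z \<Longrightarrow> AE z in gauss h. P z"
  unfolding gauss_def by (subst AE_density) (auto elim: eventually_mono)

text \<open>Paraboloids centred near \<open>x\<close> start above \<open>b\<close> by lower
  semicontinuity, and those centred at distance at least \<delta> exceed \<open>b\<close> through
  their penalty once \<open>k n\<close> is large. The centres may change with
  \<open>n\<close>.\<close>

lemma liminf_env_ge:
  fixes g :: "'v::euclidean_space \<Rightarrow> ennreal"
  assumes lsc: "\<And>a. a < g x \<Longrightarrow> \<forall>\<^sub>F y in nhds x. a < g y"
    and k: "\<And>n. k n \<ge> real n"
  shows "g x \<le> liminf (\<lambda>n. env (k n) (\<lambda>i. g (y n i)) (y n) x)"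
  unfolding le_Liminf_iff
proof (intro allI impI)
  fix a assume "a < g x"
  then obtain b where b: "a < b" "b < g x" using dense by blast
  obtain r where r: "b = ennreal r" "r \<ge> 0" using b(2) by (cases b) auto
  obtain \<delta> where \<delta>: "\<delta> > 0" "\<And>y. dist y x < \<delta> \<Longrightarrow> b < g y"
    using lsc[OF b(2)] unfolding eventually_nhds_metric by auto
  obtain N where N: "2 * r / \<delta>\<^sup>2 \<le> real N" using real_arch_simple by blast
  have "b \<le> env (k n) (\<lambda>i. g (y n i)) (y n) x" if n: "n \<ge> N" for n
    unfolding env_def
  proof (rule INF_greatest)
    fix i
    show "b \<le> g (y n i) + ennreal (k n / 2 * (norm (x - y n i))\<^sup>2)"
    proof (cases "dist (y n i) x < \<delta>")
      case True
      then show ?thesis using \<delta>(2) by (simp add: add_increasing2 less_imp_le)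
    next
      case False
      then have "\<delta>\<^sup>2 \<le> (norm (x - y n i))\<^sup>2"
        using \<delta>(1) by (intro power_mono) (auto simp: dist_norm norm_minus_commute)
      moreover have "2 * r / \<delta>\<^sup>2 \<le> k n" using N n k[of n] by linarith
      then have "r \<le> k n / 2 * \<delta>\<^sup>2" using \<delta>(1) by (simp add: field_simps)
      moreover have "k n \<ge> 0" using k[of n] by linarith
      ultimately have "r \<le> k n / 2 * (norm (x - y n i))\<^sup>2"
        using mult_left_mono[of "\<delta>\<^sup>2" "(norm (x - y n i))\<^sup>2" "k n / 2"] by linarith
      then show ?thesis unfolding r(1) by (simp add: add_increasing ennreal_leI)
    qed
  qed
  then show "\<forall>\<^sub>F n in sequentially. a < env (k n) (\<lambda>i. g (y n i)) (y n) x"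
    unfolding eventually_sequentially using b(1) less_le_trans by blast
qed

text \<open>Under \<open>en\<close> the assertion becomes the reverse Fatou lemma, with the constant
  1 as dominating function.\<close>

lemma liminf_soft_avg_ge:
  fixes g :: "'v::euclidean_space \<Rightarrow> ennreal"
  assumes T: "T > 0" and [measurable]: "\<And>n. G n \<in> borel_measurable borel"
    and le: "\<And>x. g x \<le> liminf (\<lambda>n. G n x)"
  shows "soft_avg T g x \<le> liminf (\<lambda>n. soft_avg T (G n) x)"
  unfolding le_Liminf_iff
proof (intro allI impI)
  interpret prob_space "gauss T :: 'v measure" by (rule prob_space_gauss[OF T])
  fix a assume "a < soft_avg T g x"
  then have a: "(\<integral>\<^sup>+ z. en (g (x + z)) \<partial>gauss T) < en a"
    by (simp add: soft_avg_def less_nlog_iff)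
  have "limsup (\<lambda>n. en (G n u)) \<le> en (g u)" for u
    unfolding Limsup_le_iff
  proof (intro allI impI)
    fix c assume c: "en (g u) < c"
    show "\<forall>\<^sub>F n in sequentially. en (G n u) < c"
    proof (cases "c \<le> 1")
      case True
      then have c': "c = en (nlog c)" by (simp add: en_nlog)
      then have "nlog c < g u" using c by (metis en_le_iff not_le)
      then have "\<forall>\<^sub>F n in sequentially. nlog c < G n u"
        using le[of u] unfolding le_Liminf_iff by blast
      then show ?thesis
        by eventually_elim (subst c', simp add: en_le_iff not_le[symmetric])
    next
      case False
      then have "en (G n u) < c" for n using en_le_1[of "G n u"] by (meson le_less_trans not_le)
      then show ?thesis by simp
    qed
  qed
  then have "(\<integral>\<^sup>+ z. limsup (\<lambda>n. en (G n (x + z))) \<partial>gauss T) \<le> (\<integral>\<^sup>+ z. en (g (x + z)) \<partial>gauss T)"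
    by (intro nn_integral_mono)
  moreover have "limsup (\<lambda>n. \<integral>\<^sup>+ z. en (G n (x + z)) \<partial>gauss T) \<le> (\<integral>\<^sup>+ z. limsup (\<lambda>n. en (G n (x + z))) \<partial>gauss T)"
    by (rule nn_integral_limsup[where w = "\<lambda>_. 1"]) (use emeasure_space_1 in \<open>auto simp: en_le_1\<close>)
  ultimately have "limsup (\<lambda>n. \<integral>\<^sup>+ z. en (G n (x + z)) \<partial>gauss T) < en a"
    using a by (meson le_less_trans)
  then have "\<forall>\<^sub>F n in sequentially. (\<integral>\<^sup>+ z. en (G n (x + z)) \<partial>gauss T) < en a"
    by (rule Limsup_lessD)
  then show "\<forall>\<^sub>F n in sequentially. a < soft_avg T (G n) x"
    by eventually_elim (simp add: soft_avg_def less_nlog_iff)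
qed

section \<open>Limits in the number of steps and in the curvature of the envelopes\<close>

context L2_contraction
begin

text \<open>The left-hand side is the same for every number of steps, so it is bounded by the limsup
  of the integrals on the right. The reverse Fatou lemma moves the limsup inside, which is where
  integrability of the envelope at 0 is used.\<close>

lemma nn_integral_soft_avg_le_env:
  assumes k: "k > 0" and T: "T > 0"
    and G: "(\<lambda>(t, x). G t x) \<in> borel_measurable (M2 \<Otimes>\<^sub>M borel)"
    and c: "\<And>i. c i \<in> borel_measurable M1"
    and dom: "dominated G (\<lambda>s. env k (\<lambda>i. c i s) y)"
    and fin: "(\<integral>\<^sup>+ s. env k (\<lambda>i. c i s) y 0 \<partial>M1) < \<infinity>"
  shows "(\<integral>\<^sup>+ t. soft_avg T (G t) 0 \<partial>M2) \<le> (\<integral>\<^sup>+ s. soft_avg T (env k (\<lambda>i. c i s) y) 0 \<partial>M1)"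
proof -
  interpret g: prob_space "gauss T :: 'v measure" by (rule prob_space_gauss[OF T])
  define F where "F s = env k (\<lambda>i. c i s) y" for s
  have F: "(\<lambda>(s, x). F s x) \<in> borel_measurable (M1 \<Otimes>\<^sub>M borel)"
    unfolding F_def using env_joint_measurable[of c M1 "\<lambda>i s. y i" k] c by simp
  have F0 [measurable]: "(\<lambda>s. F s 0) \<in> borel_measurable M1"
    by (rule measurable_joint[OF F]) auto
  obtain d :: "nat \<Rightarrow> 'v" where d: "closure (range d) = UNIV" "d 0 = 0"
    using dense_sequence by blast
  define h where "h N = T / real (Suc N)" for N
  have h: "h N > 0" "real (Suc N) * h N = T" for N using T by (auto simp: h_def)
  define u where "u N s = (ctrl_avg d (h N) ^^ Suc N) (F s) 0" for N s
  have um: "u N \<in> borel_measurable M1" for N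
    unfolding u_def
    by (rule measurable_joint[OF dominated_iterate(3)[OF h(1) G F]]) (use dom in \<open>auto simp: F_def\<close>)
  have le_u: "(\<integral>\<^sup>+ t. soft_avg T (G t) 0 \<partial>M2) \<le> (\<integral>\<^sup>+ s. u N s \<partial>M1)" for N
  proof -
    have "(\<lambda>s. 0) \<in> L2_space M1" by (rule L2_space_const) (rule M1.finite_measure_axioms)
    then have "(\<integral>\<^sup>+ t. (soft_avg (h N) ^^ Suc N) (G t) (A (\<lambda>s. 0) t) \<partial>M2) \<le> (\<integral>\<^sup>+ s. u N s \<partial>M1)"
      using dominated_iterate(1)[OF h(1) G F dom[folded F_def], of "Suc N" N d]
      unfolding dominated_def u_def by blast
    moreover have "(\<integral>\<^sup>+ t. (soft_avg (h N) ^^ Suc N) (G t) (A (\<lambda>s. 0) t) \<partial>M2) = (\<integral>\<^sup>+ t. soft_avg T (G t) 0 \<partial>M2)"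
    proof (rule nn_integral_cong_AE)
      show "AE t in M2. (soft_avg (h N) ^^ Suc N) (G t) (A (\<lambda>s. 0) t) = soft_avg T (G t) 0"
        using A_const[of 0] AE_space
      proof eventually_elim
        case (elim t)
        then show ?case
          using soft_avg_iterate[OF h(1) measurable_section[OF G], of t N N] h(2) by (simp del: funpow.simps of_nat_Suc)
      qed
    qed
    ultimately show ?thesis by simp
  qed
  \<comment> \<open>\<open>env_perturb\<close> with weight 1 bounds \<open>F s z\<close> by
    \<open>2 * F s 0\<close> plus \<open>k * (norm z)\<^sup>2\<close>; \<open>m\<close> is the
    Gaussian mean of the last term.\<close>
  define m where "m = (\<integral>\<^sup>+ z. ennreal (k * (norm z)\<^sup>2) \<partial>(gauss T :: 'v measure))"
  have m: "m < \<infinity>"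
  proof -
    have "integrable (gauss T) (\<lambda>z::'v. k * (norm z)\<^sup>2)"
      by (intro integrable_mult_right integrable_gauss_norm_square T)
    then show ?thesis unfolding m_def using k by (subst nn_integral_eq_integral) auto
  qed
  have u_le: "u N s \<le> 2 * F s 0 + m" if s: "s \<in> space M1" for N s
  proof -
    have [measurable]: "F s \<in> borel_measurable borel" by (rule measurable_section[OF F s])
    have "u N s \<le> (\<integral>\<^sup>+ z. F s (0 + z) \<partial>gauss T)"
      unfolding u_def using ctrl_avg_iterate_le_average[where d = d and h = "h N" and \<phi> = "F s" and x = 0 and N = N] h d(2)
      by (simp del: funpow.simps of_nat_Suc)
    also have "\<dots> \<le> (\<integral>\<^sup>+ (z::'v). 2 * F s 0 + ennreal (k * (norm z)\<^sup>2) \<partial>gauss T)"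
    proof (rule nn_integral_mono)
      fix z :: 'v
      show "F s (0 + z) \<le> 2 * F s 0 + ennreal (k * (norm z)\<^sup>2)"
        using env_perturb[OF k, of 1 "\<lambda>i. c i s" y z 0] by (simp add: F_def)
    qed
    also have "\<dots> = 2 * F s 0 + m"
      unfolding m_def using g.emeasure_space_1 by (subst nn_integral_add) simp_all
    finally show ?thesis .
  qed
  have "(\<integral>\<^sup>+ t. soft_avg T (G t) 0 \<partial>M2) \<le> limsup (\<lambda>N. \<integral>\<^sup>+ s. u N s \<partial>M1)"
    using le_u by (intro le_Limsup always_eventually) auto
  also have "\<dots> \<le> (\<integral>\<^sup>+ s. limsup (\<lambda>N. u N s) \<partial>M1)"
  proof (rule nn_integral_limsup)
    show "(\<lambda>s. 2 * F s 0 + m) \<in> borel_measurable M1" by measurable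
    show "AE s in M1. u N s \<le> 2 * F s 0 + m" for N using u_le by (intro AE_I2)
    have "(\<integral>\<^sup>+ s. 2 * F s 0 + m \<partial>M1) = 2 * (\<integral>\<^sup>+ s. F s 0 \<partial>M1) + m * emeasure M1 (space M1)"
      by (subst nn_integral_add) (simp_all add: nn_integral_cmult)
    also have "\<dots> < \<infinity>"
      using fin m by (simp add: F_def ennreal_mult_less_top M1.emeasure_eq_measure)
    finally show "(\<integral>\<^sup>+ s. 2 * F s 0 + m \<partial>M1) < \<infinity>" .
  qed (rule um)
  also have "\<dots> \<le> (\<integral>\<^sup>+ s. soft_avg T (F s) 0 \<partial>M1)"
    unfolding u_def h_def F_def by (intro nn_integral_mono limsup_ctrl_avg_iterate_env k T d)
  finally show ?thesis by (simp add: F_def)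
qed

lemma nn_integral_soft_avg_le:
  fixes f :: "'a \<Rightarrow> 'v \<Rightarrow> ennreal" and g :: "'b \<Rightarrow> 'v \<Rightarrow> ennreal"
  assumes T: "T > 0" and \<epsilon>: "\<epsilon> > 0"
    and g: "(\<lambda>(t, x). g t x) \<in> borel_measurable (M2 \<Otimes>\<^sub>M borel)"
    and f: "(\<lambda>(s, x). f s x) \<in> borel_measurable (M1 \<Otimes>\<^sub>M borel)"
    and dom: "dominated g f"
    and lsc: "\<And>t x a. t \<in> space M2 \<Longrightarrow> a < g t x \<Longrightarrow> \<forall>\<^sub>F y in nhds x. a < g t y"
    and fin: "(\<integral>\<^sup>+ s. nlog (\<integral>\<^sup>+ y. en (f s y) * ennreal (exp (- (\<epsilon> * (norm y)\<^sup>2))) \<partial>lborel) \<partial>M1) < \<infinity>"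
  shows "(\<integral>\<^sup>+ t. soft_avg T (g t) 0 \<partial>M2) \<le> (\<integral>\<^sup>+ s. soft_avg T (f s) 0 \<partial>M1)"
proof -
  interpret p: pair_sigma_finite M1 "lborel :: 'v measure" ..
  \<comment> \<open>Large \<open>n\<close> is needed for lower semicontinuity, and the lower bound
    \<epsilon> for the comparison of the envelope at 0 with the Gaussian weight.\<close>
  define k where "k n = real n + \<epsilon>" for n :: nat
  have k: "k n > 0" "k n \<ge> real n" "k n \<ge> \<epsilon>" for n using \<epsilon> by (auto simp: k_def)
  define P where "P n y b \<longleftrightarrow>
      (\<forall>x. AE s in M1. \<forall>x'. env (k n) (\<lambda>i. f s (y i)) y x' \<le> f s x + ennreal (k n / 2 * (norm (x' - x))\<^sup>2)) \<and>
      range b \<subseteq> L2_space M1 \<and>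
      dominated (\<lambda>t. env (k n) (\<lambda>i. g t (A (b i) t)) (\<lambda>i. A (b i) t)) (\<lambda>s. env (k n) (\<lambda>i. f s (y i)) y)"
    for n :: nat and y :: "nat \<Rightarrow> 'v" and b :: "nat \<Rightarrow> 'a \<Rightarrow> 'v"
  have "\<exists>y b. P n y b" for n
    by (rule dominated_envelope[OF k(1)[of n] g f dom]) (auto simp: P_def)
  then obtain y :: "nat \<Rightarrow> nat \<Rightarrow> 'v" and b where P: "\<And>n. P n (y n) (b n)" by metis
  note y = P[unfolded P_def, THEN conjunct1, THEN spec]
    and b = P[unfolded P_def, THEN conjunct2, THEN conjunct1]
    and dom_n = P[unfolded P_def, THEN conjunct2, THEN conjunct2]
  define F G where "F n s = env (k n) (\<lambda>i. f s (y n i)) (y n)"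
    and "G n t = env (k n) (\<lambda>i. g t (A (b n i) t)) (\<lambda>i. A (b n i) t)" for n s t
  have fy: "(\<lambda>s. f s (y n i)) \<in> borel_measurable M1" for n i
    by (rule measurable_joint[OF f]) auto
  have Ab: "A (b n i) \<in> borel_measurable M2" for n i
    using b[of n] by (intro A_measurable) auto
  have gb: "(\<lambda>t. g t (A (b n i) t)) \<in> borel_measurable M2" for n i
    by (rule measurable_joint[OF g]) (use Ab in auto)
  have Fm: "(\<lambda>(s, x). F n s x) \<in> borel_measurable (M1 \<Otimes>\<^sub>M borel)" for n
    unfolding F_def using env_joint_measurable[of "\<lambda>i s. f s (y n i)" M1 "\<lambda>i s. y n i"] fy by simp
  have Gm: "(\<lambda>(t, x). G n t x) \<in> borel_measurable (M2 \<Otimes>\<^sub>M borel)" for n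
    unfolding G_def by (intro env_joint_measurable gb Ab)
  have F_le: "AE s in M1. AE x in lborel. F n s x \<le> f s x"
    and F0_le: "AE s in M1. AE x in lborel. F n s 0 \<le> f s x + ennreal (k n / 2 * (norm x)\<^sup>2)" for n
  proof -
    have [measurable]: "(\<lambda>p. F n (fst p) (snd p)) \<in> borel_measurable (M1 \<Otimes>\<^sub>M lborel)"
      "(\<lambda>p. f (fst p) (snd p)) \<in> borel_measurable (M1 \<Otimes>\<^sub>M lborel)"
      "(\<lambda>p. F n (fst p) 0) \<in> borel_measurable (M1 \<Otimes>\<^sub>M lborel)"
      by (auto intro!: measurable_joint[OF Fm] measurable_joint[OF f])
    \<comment> \<open>The null set in \<open>s\<close> depends on \<open>x\<close>; Fubini's theorem
      reverses the two quantifiers, and almost every \<open>x\<close> is enough inside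
      integrals.\<close>
    have "AE x in lborel. AE s in M1. F n s x \<le> f s x"
    proof (rule AE_I2)
      fix x show "AE s in M1. F n s x \<le> f s x"
        using y[of n x] by eventually_elim (auto simp: F_def dest!: spec[of _ x])
    qed
    moreover have "{p \<in> space (M1 \<Otimes>\<^sub>M lborel). F n (fst p) (snd p) \<le> f (fst p) (snd p)} \<in> sets (M1 \<Otimes>\<^sub>M lborel)"
      by measurable
    ultimately show "AE s in M1. AE x in lborel. F n s x \<le> f s x"
      by (subst p.AE_commute)
    have "AE x in lborel. AE s in M1. F n s 0 \<le> f s x + ennreal (k n / 2 * (norm x)\<^sup>2)"
    proof (rule AE_I2)
      fix x show "AE s in M1. F n s 0 \<le> f s x + ennreal (k n / 2 * (norm x)\<^sup>2)"
        using y[of n x] by eventually_elim (auto simp: F_def dest!: spec[of _ 0])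
    qed
    moreover have "{p \<in> space (M1 \<Otimes>\<^sub>M lborel). F n (fst p) 0 \<le> f (fst p) (snd p) + ennreal (k n / 2 * (norm (snd p))\<^sup>2)}
        \<in> sets (M1 \<Otimes>\<^sub>M lborel)"
      by measurable
    ultimately show "AE s in M1. AE x in lborel. F n s 0 \<le> f s x + ennreal (k n / 2 * (norm x)\<^sup>2)"
      by (subst p.AE_commute)
  qed
  have F0m [measurable]: "(\<lambda>s. F n s 0) \<in> borel_measurable M1" for n
    by (rule measurable_joint[OF Fm]) auto
  have F0_fin: "(\<integral>\<^sup>+ s. F n s 0 \<partial>M1) < \<infinity>" for n
  proof -
    \<comment> \<open>As \<open>f \<ge> 0\<close> and \<open>k n \<ge> \<epsilon>\<close>, \<open>\<epsilon> / k n * (f + k n / 2 |x|\<^sup>2) \<le> f + \<epsilon> / 2 |x|\<^sup>2\<close>.\<close>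
    define l where "l = \<epsilon> / k n"
    have l: "0 < l" "l \<le> 1" "l * k n = \<epsilon>" using \<epsilon> k(1)[of n] k(3)[of n] by (auto simp: l_def)
    \<comment> \<open>The maximum with 1 makes \<open>ln C\<close> nonnegative, so it can be added
      in \<open>ennreal\<close>.\<close>
    define C where "C = max 1 (sqrt (2 * pi * (1 / \<epsilon>)) ^ DIM('v))"
    have C: "C \<ge> 1" by (simp add: C_def)
    define J where "J s = (\<integral>\<^sup>+ y. en (f s y) * ennreal (exp (- (\<epsilon> * (norm y)\<^sup>2))) \<partial>lborel)" for s
    have "AE s in M1. ennreal l * F n s 0 \<le> nlog (J s) + ennreal (ln C)"
      using F0_le[of n] AE_space
    proof eventually_elim
      case (elim s)
      have [measurable]: "f s \<in> borel_measurable borel" by (rule measurable_section[OF f elim(2)])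
      \<comment> \<open>The Gaussian weight is split into two equal factors. One compensates the
        paraboloid in the bound for \<open>F n s 0\<close>, the other remains and is
        integrable.\<close>
      have "AE x in lborel. en (f s x) * ennreal (exp (- (\<epsilon> * (norm x)\<^sup>2)))
          \<le> en (ennreal l * F n s 0) * ennreal (exp (- ((norm x)\<^sup>2 / (2 * (1 / \<epsilon>)))))"
        using elim(1)
      proof eventually_elim
        case (elim x)
        have "ennreal l * F n s 0 \<le> ennreal l * f s x + ennreal l * ennreal (k n / 2 * (norm x)\<^sup>2)"
          using mult_left_mono[OF elim, of "ennreal l"] by (simp add: distrib_left)
        also have "\<dots> \<le> 1 * f s x + ennreal (\<epsilon> / 2 * (norm x)\<^sup>2)"
        proof (intro add_mono mult_right_mono)
          show "ennreal l \<le> 1" using l by (simp add: ennreal_le_1)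
          have "l * (k n / 2 * (norm x)\<^sup>2) = \<epsilon> / 2 * (norm x)\<^sup>2" using l(3) by (simp flip: mult.assoc)
          then show "ennreal l * ennreal (k n / 2 * (norm x)\<^sup>2) \<le> ennreal (\<epsilon> / 2 * (norm x)\<^sup>2)"
            using l by (simp only: order_refl flip: ennreal_mult')
        qed simp
        finally have "en (f s x + ennreal (\<epsilon> / 2 * (norm x)\<^sup>2)) \<le> en (ennreal l * F n s 0)"
          by (simp add: en_le_iff)
        then have "en (f s x) * ennreal (exp (- (\<epsilon> / 2 * (norm x)\<^sup>2))) \<le> en (ennreal l * F n s 0)"
          using \<epsilon> by (simp add: en_add)
        from mult_right_mono[OF this, of "ennreal (exp (- (\<epsilon> / 2 * (norm x)\<^sup>2)))"]
        moreover have "ennreal (exp (- (\<epsilon> * (norm x)\<^sup>2)))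
            = ennreal (exp (- (\<epsilon> / 2 * (norm x)\<^sup>2))) * ennreal (exp (- (\<epsilon> / 2 * (norm x)\<^sup>2)))"
          by (simp add: mult_exp_exp flip: ennreal_mult)
        ultimately show ?case by (simp add: mult.assoc mult.commute[of \<epsilon>])
      qed
      then have "J s \<le> (\<integral>\<^sup>+ (x::'v). en (ennreal l * F n s 0) * ennreal (exp (- ((norm x)\<^sup>2 / (2 * (1 / \<epsilon>))))) \<partial>lborel)"
        unfolding J_def by (rule nn_integral_mono_AE)
      also have "\<dots> = en (ennreal l * F n s 0) * ennreal (sqrt (2 * pi * (1 / \<epsilon>)) ^ DIM('v))"
        using nn_integral_exp_norm[of "1 / \<epsilon>", where 'v = 'v] \<epsilon> by (subst nn_integral_cmult) simp_all
      also have "\<dots> \<le> en (ennreal l * F n s 0) * ennreal C"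
        by (intro mult_left_mono ennreal_leI) (auto simp: C_def)
      finally have J: "J s \<le> en (ennreal l * F n s 0) * ennreal C" .
      have "en (nlog (J s) + ennreal (ln C)) \<le> J s * ennreal (1 / C)"
        using C by (auto simp: en_add exp_minus inverse_eq_divide nlog_le_iff[symmetric] intro!: mult_right_mono)
      also have "\<dots> \<le> en (ennreal l * F n s 0) * ennreal C * ennreal (1 / C)"
        by (rule mult_right_mono[OF J]) simp
      also have "\<dots> = en (ennreal l * F n s 0)"
        using C by (simp add: mult.assoc flip: ennreal_mult)
      finally show ?case by (simp add: en_le_iff)
    qed
    then have "(\<integral>\<^sup>+ s. ennreal l * F n s 0 \<partial>M1) \<le> (\<integral>\<^sup>+ s. nlog (J s) + ennreal (ln C) \<partial>M1)"
      by (rule nn_integral_mono_AE)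
    also have "\<dots> = (\<integral>\<^sup>+ s. nlog (J s) \<partial>M1) + ennreal (ln C) * emeasure M1 (space M1)"
    proof -
      have "(\<lambda>p. f (fst p) (snd p)) \<in> borel_measurable (M1 \<Otimes>\<^sub>M lborel)"
        by (rule measurable_joint[OF f]) auto
      then have "J \<in> borel_measurable M1"
        unfolding J_def by (intro lborel.borel_measurable_nn_integral) (simp add: case_prod_beta')
      then show ?thesis by (subst nn_integral_add) simp_all
    qed
    also have "\<dots> < \<infinity>"
      using fin by (simp add: J_def ennreal_mult_less_top M1.emeasure_eq_measure)
    finally show ?thesis using l by (auto simp: nn_integral_cmult ennreal_mult_less_top)
  qed
  have n: "(\<integral>\<^sup>+ t. soft_avg T (G n t) 0 \<partial>M2) \<le> (\<integral>\<^sup>+ s. soft_avg T (f s) 0 \<partial>M1)" for n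
  proof -
    have "(\<integral>\<^sup>+ t. soft_avg T (G n t) 0 \<partial>M2) \<le> (\<integral>\<^sup>+ s. soft_avg T (F n s) 0 \<partial>M1)"
      unfolding F_def
      by (rule nn_integral_soft_avg_le_env[OF k(1) T Gm fy])
        (use dom_n[of n] F0_fin[of n] in \<open>auto simp: F_def G_def[abs_def]\<close>)
    also have "\<dots> \<le> (\<integral>\<^sup>+ s. soft_avg T (f s) 0 \<partial>M1)"
    proof (rule nn_integral_mono_AE)
      show "AE s in M1. soft_avg T (F n s) 0 \<le> soft_avg T (f s) 0"
        using F_le[of n]
      proof eventually_elim
        case (elim s)
        then have "AE z in gauss T. F n s z \<le> f s z" by (rule AE_gauss)
        then show ?case
          unfolding soft_avg_def by (intro nlog_antimono nn_integral_mono_AE) (simp add: en_le_iff)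
      qed
    qed
    finally show ?thesis .
  qed
  \<comment> \<open>Fatou's lemma in \<open>t\<close> passes to the limit on the left; on the right
    the bound by \<open>f\<close> is already uniform in \<open>n\<close>.\<close>
  have Qm: "(\<lambda>t. soft_avg T (G n t) 0) \<in> borel_measurable M2" for n
    by (rule measurable_joint[OF soft_avg_joint_measurable[OF T Gm]]) auto
  have "(\<integral>\<^sup>+ t. soft_avg T (g t) 0 \<partial>M2) \<le> (\<integral>\<^sup>+ t. liminf (\<lambda>n. soft_avg T (G n t) 0) \<partial>M2)"
    by (intro nn_integral_mono liminf_soft_avg_ge T measurable_section[OF Gm])
      (auto simp: G_def intro!: liminf_env_ge k lsc)
  also have "\<dots> \<le> liminf (\<lambda>n. \<integral>\<^sup>+ t. soft_avg T (G n t) 0 \<partial>M2)"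
    by (rule nn_integral_liminf[OF Qm])
  also have "\<dots> \<le> (\<integral>\<^sup>+ s. soft_avg T (f s) 0 \<partial>M1)"
    using n by (intro Liminf_le always_eventually) auto
  finally show ?thesis .
qed

end

section \<open>Removing the Gaussian weight\<close>

text \<open>The positive part of the logarithm, so that \<open>plog\<close> and \<open>nlog\<close>
  are its two parts. The convention \<open>ln 0 = 0\<close> gives \<open>plog 0 = 0\<close>.\<close>

definition plog :: "ennreal \<Rightarrow> ennreal" where
  "plog y = (if y = \<top> then \<top> else ennreal (ln (enn2real y)))"

lemma plog_measurable [measurable]: "plog \<in> borel_measurable borel"
  unfolding plog_def by measurable

lemma less_plog_iff:
  assumes "r \<ge> 0" shows "ennreal r < plog y \<longleftrightarrow> ennreal (exp r) < y"
proof (cases y)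
  case (real q)
  show ?thesis
  proof (cases "q = 0")
    case False
    then have q: "q > 0" using real by simp
    then have "r < ln q \<longleftrightarrow> exp r < q" by (metis exp_less_cancel_iff exp_ln)
    then show ?thesis using real assms q by (simp add: plog_def ennreal_less_iff)
  qed (use real assms in \<open>simp add: plog_def\<close>)
qed (simp add: plog_def)

lemma plog_mono: "x \<le> y \<Longrightarrow> plog x \<le> plog y"
proof (rule dense_le)
  fix a assume "x \<le> y" "a < plog x"
  then show "a \<le> plog y"
    by (cases a) (auto simp: less_plog_iff intro!: less_imp_le)
qed

lemma plog_SUP: "plog (SUP j. I j) \<le> (SUP j. plog (I j))"
proof (rule dense_le)
  fix a assume a: "a < plog (SUP j. I j)"
  then obtain r where r: "a = ennreal r" "r \<ge> 0" by (cases a) auto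
  then have "ennreal (exp r) < (SUP j. I j)" using a by (simp add: less_plog_iff)
  then obtain j where "ennreal (exp r) < I j" by (auto simp: less_SUP_iff)
  then have "a < plog (I j)" using r by (simp add: less_plog_iff)
  then show "a \<le> (SUP j. plog (I j))" by (auto intro: SUP_upper2 less_imp_le)
qed

lemma nlog_SUP: "(INF j. nlog (I j)) \<le> nlog (SUP j. I j)"
proof (rule dense_le)
  fix b assume b: "b < (INF j. nlog (I j))"
  have "I j \<le> en b" for j
  proof -
    have "b < nlog (I j)" using b by (rule less_le_trans) (rule INF_lower, simp)
    then show ?thesis by (simp add: less_nlog_iff less_imp_le)
  qed
  then have "nlog (en b) \<le> nlog (SUP j. I j)" by (intro nlog_antimono SUP_least)
  then show "b \<le> nlog (SUP j. I j)" by (simp add: nlog_en)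
qed

text \<open>This is \<open>ln \<kappa> - ln y = - ln (y / \<kappa>)\<close> with \<open>ln y\<close>
  split into its two parts and moved so that only sums occur. The bound
  \<open>y \<le> \<kappa>\<close> ensures that the truncation of \<open>nlog (y / \<kappa>)\<close>
  at 0 has no effect.\<close>

lemma nlog_add_ln:
  assumes \<kappa>: "\<kappa> \<ge> 1" and y: "y \<le> ennreal \<kappa>"
  shows "nlog y + ennreal (ln \<kappa>) = nlog (ennreal (1 / \<kappa>) * y) + plog y"
proof (cases "y = 0")
  case False
  then obtain r where r: "y = ennreal r" "r > 0" "r \<le> \<kappa>"
    using y \<kappa> by (cases y) (auto simp: top_unique less_le)
  have *: "ennreal (1 / \<kappa>) * y = ennreal (r / \<kappa>)"
    using r \<kappa> by (simp flip: ennreal_mult)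
  have "ln r \<le> ln \<kappa>" "ln (r / \<kappa>) = ln r - ln \<kappa>" "ln \<kappa> \<ge> 0"
    using r \<kappa> by (auto simp: ln_divide_pos)
  moreover have "r / \<kappa> > 0" using r \<kappa> by simp
  ultimately show ?thesis
    unfolding * unfolding r(1) using r(2) \<kappa>
    by (cases "ln r \<ge> 0")
      (simp_all add: nlog_def plog_def ennreal_eq_0_iff not_le ennreal_neg flip: ennreal_plus)
qed (simp add: nlog_def)

section \<open>From extended-real integrals to nonnegative ones\<close>

lemma log_ext_pos_neg:
  "e2ennreal (max (log_ext y) 0) = plog y" "e2ennreal (max (- log_ext y) 0) = nlog y"
  by (auto simp: log_ext_def plog_def nlog_def max_def e2ennreal_infty ennreal.abs_eq[symmetric]
      ennreal_neg ennreal_eq_0_iff top_ennreal.abs_eq[symmetric] simp flip: zero_ereal_def)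

lemma semi_integral_neg_log:
  "semi_integral M (\<lambda>s. - log_ext (y s)) = enn2ereal (\<integral>\<^sup>+ s. nlog (y s) \<partial>M) - enn2ereal (\<integral>\<^sup>+ s. plog (y s) \<partial>M)"
  by (simp add: semi_integral_def log_ext_pos_neg)

lemma semi_integral_nonneg:
  assumes "\<And>x. x \<in> space M \<Longrightarrow> F x \<ge> 0"
  shows "semi_integral M F = enn2ereal (\<integral>\<^sup>+ x. e2ennreal (F x) \<partial>M)"
proof -
  have "(\<integral>\<^sup>+ x. e2ennreal (max (F x) 0) \<partial>M) = (\<integral>\<^sup>+ x. e2ennreal (F x) \<partial>M)"
    using assms by (intro nn_integral_cong) (simp add: max_absorb1)
  moreover have "(\<integral>\<^sup>+ x. e2ennreal (max (- F x) 0) \<partial>M) = (\<integral>\<^sup>+ x. 0 \<partial>M)"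
    using assms by (intro nn_integral_cong) (auto simp: max_def e2ennreal_neg)
  ultimately show ?thesis by (simp add: semi_integral_def zero_ennreal.rep_eq)
qed

lemma exp_ext_uminus: "f \<ge> 0 \<Longrightarrow> exp_ext (- f) = en (e2ennreal f)"
  by (cases f) (auto simp: exp_ext_def e2ennreal_infty simp flip: ennreal.abs_eq zero_ereal_def)

lemma exp_ext_uminus_diff:
  "f \<ge> 0 \<Longrightarrow> exp_ext (- f - ereal r) = en (e2ennreal f) * ennreal (exp (- r))"
  by (cases f) (auto simp: exp_ext_def e2ennreal_infty exp_diff exp_minus divide_inverse ennreal_mult
      simp flip: zero_ereal_def)

text \<open>Finiteness of the two minuends excludes \<open>\<infinity> - \<infinity>\<close>. The
  subtrahends may be infinite: then \<open>b\<close> is, since an infinite \<open>d\<close> with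
  finite \<open>b\<close> contradicts the first assumption.\<close>

lemma enn2ereal_diff_le:
  assumes "a + d \<le> c + b" "c < \<infinity>" "a < \<infinity>"
  shows "enn2ereal a - enn2ereal b \<le> enn2ereal c - enn2ereal d"
proof (cases b)
  case b: (real b')
  then have "a + d < \<infinity>" using assms(2) by (intro le_less_trans[OF assms(1)]) simp
  then obtain d' where d: "d = ennreal d'" "d' \<ge> 0" by (cases d) auto
  obtain a' where a: "a = ennreal a'" "a' \<ge> 0" using assms(3) by (cases a) auto
  obtain c' where c: "c = ennreal c'" "c' \<ge> 0" using assms(2) by (cases c) auto
  have "a' + d' \<le> c' + b'"
    using assms(1) a b c d by (simp flip: ennreal_plus)
  then show ?thesis using a b c d by (simp add: enn2ereal_ennreal)
next
  case top
  then show ?thesis using assms(3) by (cases a) (auto simp: enn2ereal_ennreal)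
qed

text \<open>The variance \<open>1 / (2 * \<epsilon>)\<close> is the one whose density is
  proportional to \<open>exp (- (\<epsilon> * (norm x)\<^sup>2))\<close>, so a long time is a weak
  Gaussian weight.\<close>

lemma soft_avg_gauss_eq:
  fixes \<phi> :: "'v::euclidean_space \<Rightarrow> ennreal"
  assumes \<epsilon>: "\<epsilon> > 0" and [measurable]: "\<phi> \<in> borel_measurable borel"
  shows "soft_avg (1 / (2 * \<epsilon>)) \<phi> 0 = nlog (ennreal (1 / sqrt (pi / \<epsilon>) ^ DIM('v))
    * (\<integral>\<^sup>+ x. en (\<phi> x) * ennreal (exp (- (\<epsilon> * (norm x)\<^sup>2))) \<partial>lborel))"
proof -
  have "gdens (1 / (2 * \<epsilon>)) x = 1 / sqrt (pi / \<epsilon>) ^ DIM('v) * exp (- (\<epsilon> * (norm x)\<^sup>2))" for x :: 'v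
    using \<epsilon> by (simp add: gdens_def mult.commute)
  then have "ennreal (gdens (1 / (2 * \<epsilon>)) x) = ennreal (1 / sqrt (pi / \<epsilon>) ^ DIM('v)) * ennreal (exp (- (\<epsilon> * (norm x)\<^sup>2)))" for x :: 'v
    using \<epsilon> by (simp only: ennreal_mult) (subst ennreal_mult; simp)
  then have "(\<integral>\<^sup>+ x. en (\<phi> (0 + x)) \<partial>gauss (1 / (2 * \<epsilon>)))
    = (\<integral>\<^sup>+ x. ennreal (1 / sqrt (pi / \<epsilon>) ^ DIM('v)) * (en (\<phi> x) * ennreal (exp (- (\<epsilon> * (norm x)\<^sup>2)))) \<partial>lborel)"
    by (subst nn_integral_gauss) (simp_all only: mult_ac add_0 assms measurable_compose[OF assms(2) en_measurable])
  also have "\<dots> = ennreal (1 / sqrt (pi / \<epsilon>) ^ DIM('v))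
    * (\<integral>\<^sup>+ x. en (\<phi> x) * ennreal (exp (- (\<epsilon> * (norm x)\<^sup>2))) \<partial>lborel)"
    by (rule nn_integral_cmult) simp
  finally show ?thesis by (simp add: soft_avg_def)
qed

definition weighted :: "real \<Rightarrow> ('v::euclidean_space \<Rightarrow> ennreal) \<Rightarrow> ennreal" where
  "weighted \<epsilon> \<phi> = (\<integral>\<^sup>+ x. en (\<phi> x) * ennreal (exp (- (\<epsilon> * (norm x)\<^sup>2))) \<partial>lborel)"

lemma weighted_le:
  fixes \<phi> :: "'v::euclidean_space \<Rightarrow> ennreal"
  assumes "\<epsilon> > 0" shows "weighted \<epsilon> \<phi> \<le> ennreal (sqrt (pi / \<epsilon>) ^ DIM('v))"
proof -
  have "weighted \<epsilon> \<phi> \<le> (\<integral>\<^sup>+ (x::'v). ennreal (exp (- ((norm x)\<^sup>2 / (2 * (1 / (2 * \<epsilon>)))))) \<partial>lborel)"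
    unfolding weighted_def
  proof (rule nn_integral_mono)
    fix x :: 'v
    have "en (\<phi> x) * ennreal (exp (- (\<epsilon> * (norm x)\<^sup>2))) \<le> 1 * ennreal (exp (- (\<epsilon> * (norm x)\<^sup>2)))"
      by (intro mult_right_mono en_le_1) simp
    then show "en (\<phi> x) * ennreal (exp (- (\<epsilon> * (norm x)\<^sup>2))) \<le> ennreal (exp (- ((norm x)\<^sup>2 / (2 * (1 / (2 * \<epsilon>))))))"
      by (simp add: mult.commute)
  qed
  also have "\<dots> = ennreal (sqrt (pi / \<epsilon>) ^ DIM('v))"
    using assms by (subst nn_integral_exp_norm) auto
  finally show ?thesis .
qed

lemma weighted_antimono: "\<delta> \<le> \<epsilon> \<Longrightarrow> weighted \<epsilon> \<phi> \<le> weighted \<delta> \<phi>"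
  unfolding weighted_def
  by (intro nn_integral_mono mult_left_mono ennreal_leI) (auto intro: mult_right_mono)

lemma weighted_SUP:
  fixes \<phi> :: "'v::euclidean_space \<Rightarrow> ennreal"
  assumes [measurable]: "\<phi> \<in> borel_measurable borel" and e: "decseq e" "e \<longlonglongrightarrow> 0"
  shows "(SUP j. weighted (e j) \<phi>) = (\<integral>\<^sup>+ x. en (\<phi> x) \<partial>lborel)"
proof (rule LIMSEQ_unique)
  show "(\<lambda>j. weighted (e j) \<phi>) \<longlonglongrightarrow> (SUP j. weighted (e j) \<phi>)"
    using e(1) by (intro LIMSEQ_SUP monoI weighted_antimono) (auto simp: decseq_def)
  show "(\<lambda>j. weighted (e j) \<phi>) \<longlonglongrightarrow> (\<integral>\<^sup>+ x. en (\<phi> x) \<partial>lborel)"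
    unfolding weighted_def
  proof (rule nn_integral_LIMSEQ)
    show "incseq (\<lambda>j x. en (\<phi> x) * ennreal (exp (- (e j * (norm x)\<^sup>2))))"
      using e(1) by (intro monoI le_funI mult_left_mono ennreal_leI) (auto simp: decseq_def intro!: mult_right_mono)
    fix x :: 'v
    have "(\<lambda>j. ennreal (exp (- (e j * (norm x)\<^sup>2)))) \<longlonglongrightarrow> ennreal (exp (- (0 * (norm x)\<^sup>2)))"
      by (intro tendsto_intros tendsto_ennrealI e)
    then have "(\<lambda>j. en (\<phi> x) * ennreal (exp (- (e j * (norm x)\<^sup>2)))) \<longlonglongrightarrow> en (\<phi> x) * 1"
      using en_le_1[of "\<phi> x"] by (intro ennreal_tendsto_cmult) (auto simp: le_less_trans less_top[symmetric] top_unique)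
    then show "(\<lambda>j. en (\<phi> x) * ennreal (exp (- (e j * (norm x)\<^sup>2)))) \<longlonglongrightarrow> en (\<phi> x)"
      by simp
  qed simp
qed

lemma weighted_measurable:
  assumes f: "(\<lambda>(s, x). f s x) \<in> borel_measurable (M \<Otimes>\<^sub>M borel)"
  shows "(\<lambda>s. weighted \<epsilon> (f s)) \<in> borel_measurable M"
proof -
  have "(\<lambda>p. f (fst p) (snd p)) \<in> borel_measurable (M \<Otimes>\<^sub>M lborel)"
    by (rule measurable_joint[OF f]) auto
  then show ?thesis
    unfolding weighted_def by (intro lborel.borel_measurable_nn_integral) (simp add: case_prod_beta')
qed

section \<open>Cancelling the normalisation and letting the weight tend to 1\<close>

context L2_contraction
begin

text \<open>The normalising constant contributes \<open>ln \<kappa>\<close> times the total mass on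
  each side; equal finite masses make these contributions cancel. The bound
  \<open>\<epsilon> \<le> pi\<close> gives \<open>\<kappa> \<ge> 1\<close>, so that
  \<open>ln \<kappa>\<close> is nonnegative.\<close>

lemma weighted_log_inequality:
  fixes f :: "'a \<Rightarrow> 'v \<Rightarrow> ennreal" and g :: "'b \<Rightarrow> 'v \<Rightarrow> ennreal"
  assumes \<epsilon>: "\<epsilon> > 0" "\<epsilon> \<le> pi" and mass: "emeasure M1 (space M1) = emeasure M2 (space M2)"
    and g: "(\<lambda>(t, x). g t x) \<in> borel_measurable (M2 \<Otimes>\<^sub>M borel)"
    and f: "(\<lambda>(s, x). f s x) \<in> borel_measurable (M1 \<Otimes>\<^sub>M borel)"
    and le: "(\<integral>\<^sup>+ t. soft_avg (1 / (2 * \<epsilon>)) (g t) 0 \<partial>M2) \<le> (\<integral>\<^sup>+ s. soft_avg (1 / (2 * \<epsilon>)) (f s) 0 \<partial>M1)"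
  shows "(\<integral>\<^sup>+ t. nlog (weighted \<epsilon> (g t)) \<partial>M2) + (\<integral>\<^sup>+ s. plog (weighted \<epsilon> (f s)) \<partial>M1)
    \<le> (\<integral>\<^sup>+ s. nlog (weighted \<epsilon> (f s)) \<partial>M1) + (\<integral>\<^sup>+ t. plog (weighted \<epsilon> (g t)) \<partial>M2)"
proof -
  define \<kappa> where "\<kappa> = sqrt (pi / \<epsilon>) ^ DIM('v)"
  have \<kappa>: "\<kappa> \<ge> 1" using \<epsilon> by (simp add: \<kappa>_def one_le_power)
  define c where "c = ennreal (ln \<kappa>) * emeasure M1 (space M1)"
  have c: "c < \<top>" by (simp add: c_def ennreal_mult_less_top M1.emeasure_eq_measure)
  have eq: "(\<integral>\<^sup>+ s. nlog (weighted \<epsilon> (F s)) \<partial>M) + ennreal (ln \<kappa>) * emeasure M (space M)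
      = (\<integral>\<^sup>+ s. soft_avg (1 / (2 * \<epsilon>)) (F s) 0 \<partial>M) + (\<integral>\<^sup>+ s. plog (weighted \<epsilon> (F s)) \<partial>M)"
    if F: "(\<lambda>(s, x). F s x) \<in> borel_measurable (M \<Otimes>\<^sub>M borel)"
    for M :: "'c measure" and F :: "'c \<Rightarrow> 'v \<Rightarrow> ennreal"
  proof -
    have [measurable]: "(\<lambda>s. weighted \<epsilon> (F s)) \<in> borel_measurable M" by (rule weighted_measurable[OF F])
    have [measurable]: "(\<lambda>s. soft_avg (1 / (2 * \<epsilon>)) (F s) 0) \<in> borel_measurable M"
      by (rule measurable_joint[OF soft_avg_joint_measurable[OF _ F]]) (use \<epsilon> in auto)
    have "(\<integral>\<^sup>+ s. nlog (weighted \<epsilon> (F s)) \<partial>M) + ennreal (ln \<kappa>) * emeasure M (space M)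
        = (\<integral>\<^sup>+ s. nlog (weighted \<epsilon> (F s)) + ennreal (ln \<kappa>) \<partial>M)"
      by (subst nn_integral_add) simp_all
    also have "\<dots> = (\<integral>\<^sup>+ s. soft_avg (1 / (2 * \<epsilon>)) (F s) 0 + plog (weighted \<epsilon> (F s)) \<partial>M)"
    proof (rule nn_integral_cong)
      fix s assume s: "s \<in> space M"
      show "nlog (weighted \<epsilon> (F s)) + ennreal (ln \<kappa>) = soft_avg (1 / (2 * \<epsilon>)) (F s) 0 + plog (weighted \<epsilon> (F s))"
        unfolding soft_avg_gauss_eq[OF \<epsilon>(1) measurable_section[OF F s]] weighted_def[symmetric] \<kappa>_def[symmetric]
        by (rule nlog_add_ln[OF \<kappa>]) (unfold \<kappa>_def, rule weighted_le[OF \<epsilon>(1)])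
    qed
    also have "\<dots> = (\<integral>\<^sup>+ s. soft_avg (1 / (2 * \<epsilon>)) (F s) 0 \<partial>M) + (\<integral>\<^sup>+ s. plog (weighted \<epsilon> (F s)) \<partial>M)"
      by (rule nn_integral_add) auto
    finally show ?thesis .
  qed
  define Ng Nf Pg Pf where "Ng = (\<integral>\<^sup>+ t. nlog (weighted \<epsilon> (g t)) \<partial>M2)" "Nf = (\<integral>\<^sup>+ s. nlog (weighted \<epsilon> (f s)) \<partial>M1)"
    "Pg = (\<integral>\<^sup>+ t. plog (weighted \<epsilon> (g t)) \<partial>M2)" "Pf = (\<integral>\<^sup>+ s. plog (weighted \<epsilon> (f s)) \<partial>M1)"
  have eg: "Ng + c = (\<integral>\<^sup>+ t. soft_avg (1 / (2 * \<epsilon>)) (g t) 0 \<partial>M2) + Pg"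
    using eq[OF g] mass by (simp add: Ng_Nf_Pg_Pf_def c_def)
  have ef: "Nf + c = (\<integral>\<^sup>+ s. soft_avg (1 / (2 * \<epsilon>)) (f s) 0 \<partial>M1) + Pf"
    using eq[OF f] by (simp add: Ng_Nf_Pg_Pf_def c_def)
  have "(Ng + Pf) + c = (Ng + c) + Pf" by (simp add: add_ac)
  also have "\<dots> = (\<integral>\<^sup>+ t. soft_avg (1 / (2 * \<epsilon>)) (g t) 0 \<partial>M2) + Pg + Pf"
    by (simp only: eg)
  also have "\<dots> \<le> (\<integral>\<^sup>+ s. soft_avg (1 / (2 * \<epsilon>)) (f s) 0 \<partial>M1) + Pg + Pf"
    by (intro add_right_mono le)
  also have "\<dots> = (\<integral>\<^sup>+ s. soft_avg (1 / (2 * \<epsilon>)) (f s) 0 \<partial>M1) + Pf + Pg" by (simp add: add_ac)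
  also have "\<dots> = (Nf + c) + Pg" by (simp only: ef)
  also have "\<dots> = (Nf + Pg) + c" by (simp add: add_ac)
  finally have "c + (Ng + Pf) \<le> c + (Nf + Pg)" by (simp add: add.commute)
  then have "Ng + Pf \<le> Nf + Pg"
    using c by (auto simp: ennreal_add_left_cancel_le)
  then show ?thesis by (simp add: Ng_Nf_Pg_Pf_def)
qed

lemma log_inequality:
  fixes f :: "'a \<Rightarrow> 'v \<Rightarrow> ennreal" and g :: "'b \<Rightarrow> 'v \<Rightarrow> ennreal"
  assumes \<epsilon>: "\<epsilon> > 0" and mass: "emeasure M1 (space M1) = emeasure M2 (space M2)"
    and g: "(\<lambda>(t, x). g t x) \<in> borel_measurable (M2 \<Otimes>\<^sub>M borel)"
    and f: "(\<lambda>(s, x). f s x) \<in> borel_measurable (M1 \<Otimes>\<^sub>M borel)"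
    and dom: "dominated g f"
    and lsc: "\<And>t x a. t \<in> space M2 \<Longrightarrow> a < g t x \<Longrightarrow> \<forall>\<^sub>F y in nhds x. a < g t y"
    and fin: "(\<integral>\<^sup>+ s. nlog (weighted \<epsilon> (f s)) \<partial>M1) < \<infinity>"
  defines "Jg \<equiv> \<lambda>t. \<integral>\<^sup>+ x. en (g t x) \<partial>lborel" and "Jf \<equiv> \<lambda>s. \<integral>\<^sup>+ x. en (f s x) \<partial>lborel"
  shows "enn2ereal (\<integral>\<^sup>+ t. nlog (Jg t) \<partial>M2) - enn2ereal (\<integral>\<^sup>+ t. plog (Jg t) \<partial>M2)
    \<le> enn2ereal (\<integral>\<^sup>+ s. nlog (Jf s) \<partial>M1) - enn2ereal (\<integral>\<^sup>+ s. plog (Jf s) \<partial>M1)"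
proof -
  \<comment> \<open>Staying below \<open>\<epsilon>\<close> preserves the finiteness assumption, and
    staying below \<open>pi\<close> is required by \<open>weighted_log_inequality\<close>.\<close>
  define e where "e j = min \<epsilon> pi / real (Suc j)" for j
  have e: "e j > 0" "e j \<le> \<epsilon>" "e j \<le> pi" for j
  proof -
    have m: "min \<epsilon> pi > 0" using \<epsilon> by simp
    then have "min \<epsilon> pi / real (Suc j) \<le> min \<epsilon> pi / 1" by (intro divide_left_mono) auto
    then have "e j \<le> min \<epsilon> pi" by (simp add: e_def)
    then show "e j > 0" "e j \<le> \<epsilon>" "e j \<le> pi" using m by (auto simp: e_def)
  qed
  have dec: "decseq e"
    unfolding decseq_def e_def using \<epsilon> by (auto intro!: divide_left_mono)
  have lim: "e \<longlonglongrightarrow> 0"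
    using tendsto_mult[OF tendsto_const LIMSEQ_inverse_real_of_nat, of "min \<epsilon> pi"]
    by (simp add: e_def[abs_def] divide_inverse)
  define N P where "N j = (\<integral>\<^sup>+ s. nlog (weighted (e j) (f s)) \<partial>M1)" and "P j = (\<integral>\<^sup>+ s. plog (weighted (e j) (f s)) \<partial>M1)" for j
  define Ng Pg where "Ng = (\<integral>\<^sup>+ t. nlog (Jg t) \<partial>M2)" and "Pg = (\<integral>\<^sup>+ t. plog (Jg t) \<partial>M2)"
  have wm [measurable]: "(\<lambda>s. weighted \<delta> (f s)) \<in> borel_measurable M1" for \<delta> by (rule weighted_measurable[OF f])
  have weighted_Jg: "weighted \<delta> (g t) \<le> Jg t" if "\<delta> > 0" for \<delta> t
    unfolding Jg_def weighted_def
  proof (rule nn_integral_mono)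
    fix x :: 'v
    have "en (g t x) * ennreal (exp (- (\<delta> * (norm x)\<^sup>2))) \<le> en (g t x) * 1"
      using that by (intro mult_left_mono) (simp_all add: ennreal_le_1)
    then show "en (g t x) * ennreal (exp (- (\<delta> * (norm x)\<^sup>2))) \<le> en (g t x)" by simp
  qed
  have step: "(\<integral>\<^sup>+ t. nlog (weighted (e j) (g t)) \<partial>M2) + P j \<le> N j + (\<integral>\<^sup>+ t. plog (weighted (e j) (g t)) \<partial>M2)" for j
    unfolding N_def P_def
  proof (rule weighted_log_inequality[OF e(1) e(3) mass g f])
    show "(\<integral>\<^sup>+ t. soft_avg (1 / (2 * e j)) (g t) 0 \<partial>M2) \<le> (\<integral>\<^sup>+ s. soft_avg (1 / (2 * e j)) (f s) 0 \<partial>M1)"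
      by (rule nn_integral_soft_avg_le[OF _ \<epsilon> g f dom lsc]) (use e fin in \<open>auto simp: weighted_def\<close>)
  qed
  have Ng_le: "Ng \<le> (\<integral>\<^sup>+ t. nlog (weighted (e j) (g t)) \<partial>M2)" for j
    unfolding Ng_def by (intro nn_integral_mono nlog_antimono weighted_Jg e)
  have Pg_ge: "(\<integral>\<^sup>+ t. plog (weighted (e j) (g t)) \<partial>M2) \<le> Pg" for j
    unfolding Pg_def by (intro nn_integral_mono plog_mono weighted_Jg e)
  have N_dec: "N j \<le> N i" if "i \<le> j" for i j
    unfolding N_def using dec that by (intro nn_integral_mono nlog_antimono weighted_antimono) (auto simp: decseq_def)
  have P_inc: "P i \<le> P j" if "i \<le> j" for i j
    unfolding P_def using dec that by (intro nn_integral_mono plog_mono weighted_antimono) (auto simp: decseq_def)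
  have N_fin: "N j < \<infinity>" for j
  proof -
    have "N j \<le> (\<integral>\<^sup>+ s. nlog (weighted \<epsilon> (f s)) \<partial>M1)"
      unfolding N_def by (intro nn_integral_mono nlog_antimono weighted_antimono e)
    then show ?thesis using fin by (rule le_less_trans)
  qed
  \<comment> \<open>In the inequality for \<open>e 0\<close> the right-hand side is finite, since a
    weighted integral is bounded by a constant and \<open>M2\<close> has finite mass.\<close>
  have Ng_fin: "Ng < \<infinity>"
  proof -
    have "weighted (e 0) (g t) \<le> ennreal (sqrt (pi / e 0) ^ DIM('v))" for t by (rule weighted_le[OF e(1)])
    then have "(\<integral>\<^sup>+ t. plog (weighted (e 0) (g t)) \<partial>M2) \<le> (\<integral>\<^sup>+ t. plog (ennreal (sqrt (pi / e 0) ^ DIM('v))) \<partial>M2)"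
      by (intro nn_integral_mono plog_mono)
    also have "\<dots> < \<infinity>"
      by (simp add: plog_def ennreal_mult_less_top M2.emeasure_eq_measure)
    finally have "N 0 + (\<integral>\<^sup>+ t. plog (weighted (e 0) (g t)) \<partial>M2) < \<infinity>" using N_fin[of 0] by simp
    with step[of 0] have "(\<integral>\<^sup>+ t. nlog (weighted (e 0) (g t)) \<partial>M2) + P 0 < \<infinity>" by (rule le_less_trans)
    then have "(\<integral>\<^sup>+ t. nlog (weighted (e 0) (g t)) \<partial>M2) < \<infinity>" by simp
    with Ng_le[of 0] show ?thesis by (rule le_less_trans)
  qed
  \<comment> \<open>The larger index serves both sides, as \<open>P\<close> increases and
    \<open>N\<close> decreases. With independent indices the supremum over \<open>i\<close> and the
    infimum over \<open>j\<close> can be taken separately.\<close>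
  have ij: "Ng + P i \<le> N j + Pg" for i j
  proof -
    define m where "m = max i j"
    have "Ng + P i \<le> (\<integral>\<^sup>+ t. nlog (weighted (e m) (g t)) \<partial>M2) + P m"
      by (intro add_mono Ng_le P_inc) (simp add: m_def)
    also have "\<dots> \<le> N m + (\<integral>\<^sup>+ t. plog (weighted (e m) (g t)) \<partial>M2)" by (rule step)
    also have "\<dots> \<le> N j + Pg" by (intro add_mono N_dec Pg_ge) (simp add: m_def)
    finally show ?thesis .
  qed
  have Jf: "Jf s = (SUP j. weighted (e j) (f s))" if "s \<in> space M1" for s
    unfolding Jf_def by (rule weighted_SUP[OF measurable_section[OF f that] dec lim, symmetric])
  have "(INF j. N j) \<le> (\<integral>\<^sup>+ s. nlog (Jf s) \<partial>M1)"
  proof -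
    have "(INF j. N j) = (\<integral>\<^sup>+ s. (INF j. nlog (weighted (e j) (f s))) \<partial>M1)"
      unfolding N_def
    proof (rule nn_integral_monotone_convergence_INF_decseq[symmetric])
      show "decseq (\<lambda>j s. nlog (weighted (e j) (f s)))"
        using dec by (intro antimonoI le_funI nlog_antimono weighted_antimono) (auto simp: decseq_def)
      show "(\<integral>\<^sup>+ s. nlog (weighted (e 0) (f s)) \<partial>M1) < \<infinity>" using N_fin[of 0] by (simp add: N_def)
    qed simp
    also have "\<dots> \<le> (\<integral>\<^sup>+ s. nlog (Jf s) \<partial>M1)"
      by (intro nn_integral_mono) (simp add: Jf nlog_SUP)
    finally show ?thesis .
  qed
  moreover have "(\<integral>\<^sup>+ s. plog (Jf s) \<partial>M1) \<le> (SUP j. P j)"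
  proof -
    have "(\<integral>\<^sup>+ s. plog (Jf s) \<partial>M1) \<le> (\<integral>\<^sup>+ s. (SUP j. plog (weighted (e j) (f s))) \<partial>M1)"
      by (intro nn_integral_mono) (simp add: Jf plog_SUP)
    also have "\<dots> = (SUP j. P j)"
      unfolding P_def
    proof (rule nn_integral_monotone_convergence_SUP)
      show "incseq (\<lambda>j s. plog (weighted (e j) (f s)))"
        using dec by (intro monoI le_funI plog_mono weighted_antimono) (auto simp: decseq_def)
    qed simp
    finally show ?thesis .
  qed
  moreover have "Ng + (SUP i. P i) \<le> (INF j. N j) + Pg"
  proof -
    have "Ng + (SUP i. P i) = (SUP i. Ng + P i)" by (rule ennreal_SUP_add_right) simp
    also have "\<dots> \<le> (INF j. N j + Pg)" by (intro SUP_least INF_greatest ij)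
    finally show ?thesis by (simp add: INF_ennreal_add_const)
  qed
  ultimately have *: "Ng + (\<integral>\<^sup>+ s. plog (Jf s) \<partial>M1) \<le> (\<integral>\<^sup>+ s. nlog (Jf s) \<partial>M1) + Pg"
    by (meson add_left_mono add_right_mono order_trans)
  have "(\<integral>\<^sup>+ s. nlog (Jf s) \<partial>M1) \<le> N 0"
    unfolding N_def by (intro nn_integral_mono nlog_antimono) (auto simp: Jf intro: SUP_upper)
  then have "(\<integral>\<^sup>+ s. nlog (Jf s) \<partial>M1) < \<infinity>" using N_fin[of 0] by (rule le_less_trans)
  then show ?thesis
    using enn2ereal_diff_le[OF * _ Ng_fin] by (simp add: Ng_def Pg_def)
qed

end

section \<open>Contractions in the sense of the operator norm\<close>

text \<open>A real supremum bounds its members only if the set is bounded, so continuity at 0 is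
  first used to bound the quotients by \<open>2 / \<delta>\<close>. Functions of norm 0 escape the
  quotient because of \<open>r / 0 = 0\<close>; they vanish almost everywhere, and \<open>A\<close>
  respects this.\<close>

lemma L2_contractionI:
  fixes A :: "('a \<Rightarrow> 'v::euclidean_space) \<Rightarrow> 'b \<Rightarrow> 'v"
  assumes M1: "finite_measure M1" and M2: "finite_measure M2"
    and A: "L2_continuous_linear M1 M2 A" and norm: "L2_onorm M1 M2 A \<le> 1"
    and const: "\<And>v. AE t in M2. A (\<lambda>s. v) t = v"
  shows "L2_contraction M1 M2 A"
proof -
  interpret M1: finite_measure M1 by fact
  interpret M2: finite_measure M2 by fact
  have L2: "A \<alpha> \<in> L2_space M2" if "\<alpha> \<in> L2_space M1" for \<alpha>
    using A that by (simp add: L2_continuous_linear_def)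
  have cong: "AE t in M2. A \<alpha> t = A \<beta> t" if "\<alpha> \<in> L2_space M1" "\<beta> \<in> L2_space M1" "AE s in M1. \<alpha> s = \<beta> s" for \<alpha> \<beta>
    using A that by (simp add: L2_continuous_linear_def)
  have scale: "AE t in M2. A (\<lambda>s. c *\<^sub>R \<alpha> s) t = c *\<^sub>R A \<alpha> t" if "\<alpha> \<in> L2_space M1" for c \<alpha>
    using A that by (simp add: L2_continuous_linear_def)
  have z: "(\<lambda>s. 0) \<in> L2_space M1" by (rule L2_space_const[OF M1])
  have nn: "(\<integral>\<^sup>+ s. ennreal ((norm (\<alpha> s))\<^sup>2) \<partial>M) = ennreal ((L2_norm M \<alpha>)\<^sup>2)" if "\<alpha> \<in> L2_space M"
    for M :: "'c measure" and \<alpha> :: "'c \<Rightarrow> 'v"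
    using that by (simp add: L2_space_def L2_norm_def nn_integral_eq_integral)
  have nonneg: "L2_norm M \<alpha> \<ge> 0" for M :: "'c measure" and \<alpha> :: "'c \<Rightarrow> 'v" by (simp add: L2_norm_def)
  have norm_cong: "L2_norm M2 \<alpha> = L2_norm M2 \<beta>"
    if "AE t in M2. \<alpha> t = \<beta> t" "\<alpha> \<in> L2_space M2" "\<beta> \<in> L2_space M2" for \<alpha> \<beta> :: "'b \<Rightarrow> 'v"
  proof -
    have "(\<integral>t. (norm (\<alpha> t))\<^sup>2 \<partial>M2) = (\<integral>t. (norm (\<beta> t))\<^sup>2 \<partial>M2)"
      by (rule integral_cong_AE) (use that in \<open>auto simp: L2_space_def elim: eventually_mono\<close>)
    then show ?thesis by (simp add: L2_norm_def)
  qed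
  have norm_scale: "L2_norm M (\<lambda>x. c *\<^sub>R \<alpha> x) = \<bar>c\<bar> * L2_norm M \<alpha>"
    for M :: "'c measure" and \<alpha> :: "'c \<Rightarrow> 'v" and c
    by (simp add: L2_norm_def power_mult_distrib real_sqrt_mult)
  obtain \<delta> where \<delta>: "\<delta> > 0" "\<And>\<beta>. \<beta> \<in> L2_space M1 \<Longrightarrow> L2_norm M1 (\<lambda>s. \<beta> s - 0) < \<delta> \<Longrightarrow> L2_norm M2 (\<lambda>t. A \<beta> t - A (\<lambda>s. 0) t) < 1"
  proof -
    have "\<forall>\<alpha>\<in>L2_space M1. \<forall>e>0. \<exists>d>0. \<forall>\<beta>\<in>L2_space M1.
        L2_norm M1 (\<lambda>s. \<beta> s - \<alpha> s) < d \<longrightarrow> L2_norm M2 (\<lambda>t. A \<beta> t - A \<alpha> t) < e"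
      using A by (simp add: L2_continuous_linear_def)
    from bspec[OF this z, THEN spec[of _ 1]] show ?thesis using that by auto
  qed
  have small: "L2_norm M2 (A \<beta>) < 1" if "\<beta> \<in> L2_space M1" "L2_norm M1 \<beta> < \<delta>" for \<beta>
  proof -
    have "L2_norm M2 (\<lambda>t. A \<beta> t - A (\<lambda>s. 0) t) = L2_norm M2 (A \<beta>)"
      using const[of 0] by (intro norm_cong L2_space_diff L2 that z) (auto elim: eventually_mono)
    then show ?thesis using \<delta>(2)[OF that(1)] that(2) by simp
  qed
  have scaled: "L2_norm M2 (A (\<lambda>s. c *\<^sub>R \<beta> s)) = \<bar>c\<bar> * L2_norm M2 (A \<beta>)" if "\<beta> \<in> L2_space M1" for c \<beta>
    unfolding norm_scale[symmetric] using that by (intro norm_cong scale L2 L2_space_scale)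
  have bound: "L2_norm M2 (A \<beta>) / L2_norm M1 \<beta> \<le> 2 / \<delta>" if \<beta>: "\<beta> \<in> L2_space M1" for \<beta>
  proof (cases "L2_norm M1 \<beta> = 0")
    case False
    then have pos: "L2_norm M1 \<beta> > 0" using nonneg[of M1 \<beta>] by simp
    \<comment> \<open>This scaling gives the function norm \<open>\<delta> / 2\<close>, safely
      inside the ball on which the image has norm below 1.\<close>
    define c where "c = \<delta> / (2 * L2_norm M1 \<beta>)"
    have c: "c > 0" "c * L2_norm M1 \<beta> = \<delta> / 2" using \<delta>(1) pos by (auto simp: c_def)
    have "L2_norm M2 (A (\<lambda>s. c *\<^sub>R \<beta> s)) < 1"
      by (rule small) (use \<beta> c \<delta>(1) in \<open>auto simp: norm_scale intro: L2_space_scale\<close>)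
    then have "c * L2_norm M2 (A \<beta>) < 1" using scaled[OF \<beta>, of c] c by simp
    then show ?thesis using c pos \<delta>(1) by (simp add: c_def field_simps)
  qed (use \<delta>(1) in simp)
  have le: "L2_norm M2 (A \<beta>) \<le> L2_norm M1 \<beta>" if \<beta>: "\<beta> \<in> L2_space M1" for \<beta>
  proof (cases "L2_norm M1 \<beta> = 0")
    case True
    then have "(\<integral>s. (norm (\<beta> s))\<^sup>2 \<partial>M1) = 0" by (simp add: L2_norm_def)
    then have "AE s in M1. \<beta> s = 0"
      using \<beta> by (subst (asm) integral_nonneg_eq_0_iff_AE) (auto simp: L2_space_def)
    then have "AE t in M2. A \<beta> t = A (\<lambda>s. 0) t" by (intro cong \<beta> z)
    then have "AE t in M2. A \<beta> t = 0" using const[of 0] by eventually_elim simp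
    then have "L2_norm M2 (A \<beta>) = L2_norm M2 (\<lambda>t. 0 :: 'v)" by (rule norm_cong[OF _ L2[OF \<beta>] L2_space_const[OF M2]])
    then show ?thesis using True by (simp add: L2_norm_def)
  next
    case False
    then have pos: "L2_norm M1 \<beta> > 0" using nonneg[of M1 \<beta>] by simp
    have "L2_norm M2 (A \<beta>) / L2_norm M1 \<beta> \<le> L2_onorm M1 M2 A"
      unfolding L2_onorm_def by (intro cSUP_upper \<beta> bdd_aboveI2[of _ _ "2 / \<delta>"] bound)
    then have "L2_norm M2 (A \<beta>) / L2_norm M1 \<beta> \<le> 1" using norm by linarith
    then show ?thesis using pos by simp
  qed
  show ?thesis
  proof (intro L2_contraction.intro L2_contraction_axioms.intro M1 M2)
    fix \<alpha> :: "'a \<Rightarrow> 'v" assume \<alpha>: "\<alpha> \<in> L2_space M1"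
    show "(\<integral>\<^sup>+ t. ennreal ((norm (A \<alpha> t))\<^sup>2) \<partial>M2) \<le> (\<integral>\<^sup>+ s. ennreal ((norm (\<alpha> s))\<^sup>2) \<partial>M1)"
      unfolding nn[OF \<alpha>] nn[OF L2[OF \<alpha>]] by (intro ennreal_leI power_mono le \<alpha> nonneg)
  next
    fix \<alpha> \<beta> :: "'a \<Rightarrow> 'v" assume "\<alpha> \<in> L2_space M1" "\<beta> \<in> L2_space M1"
    then show "AE t in M2. A (\<lambda>s. \<alpha> s + \<beta> s) t = A \<alpha> t + A \<beta> t"
      using A by (simp add: L2_continuous_linear_def)
  qed (rule L2 scale const; assumption?)+
qed

theorem theorem1p3:
  fixes M1 :: "'a::polish_space measure" and M2 :: "'b measure"
    and A :: "('a \<Rightarrow> real ^ 'n) \<Rightarrow> ('b \<Rightarrow> real ^ 'n)"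
    and f :: "'a \<Rightarrow> real ^ 'n \<Rightarrow> ereal" and g :: "'b \<Rightarrow> real ^ 'n \<Rightarrow> ereal"
    and \<epsilon>0 :: real
  assumes M1_borel: "sets M1 = sets borel"
    and total_mass: "emeasure M1 (space M1) = emeasure M2 (space M2)"
    and finite_mass: "emeasure M1 (space M1) < \<infinity>"
    and A_operator: "L2_continuous_linear M1 M2 A"
    and A_norm: "L2_onorm M1 M2 A \<le> 1"
    and A_const: "\<And>v0. AE t in M2. A (\<lambda>s. v0) t = v0"
    and f_borel: "\<And>s. s \<in> space M1 \<Longrightarrow> f s \<in> borel_measurable borel"
    and g_borel: "\<And>t. t \<in> space M2 \<Longrightarrow> g t \<in> borel_measurable borel"
    and f_range: "\<And>s x. s \<in> space M1 \<Longrightarrow> f s x \<noteq> - \<infinity>"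
    and g_range: "\<And>t x. t \<in> space M2 \<Longrightarrow> g t x \<noteq> - \<infinity>"
    and f_meas: "(\<lambda>(s, x). f s x) \<in> borel_measurable (M1 \<Otimes>\<^sub>M borel)"
    and g_meas: "(\<lambda>(t, x). g t x) \<in> borel_measurable (M2 \<Otimes>\<^sub>M borel)"
    and f_semi: "semi_integrable M1 (\<lambda>s. log_ext (\<integral>\<^sup>+ x. exp_ext (- f s x) \<partial>lborel))"
    and g_semi: "semi_integrable M2 (\<lambda>t. log_ext (\<integral>\<^sup>+ x. exp_ext (- g t x) \<partial>lborel))"
    and f_nonneg: "\<And>s x. s \<in> space M1 \<Longrightarrow> 0 \<le> f s x"
    and g_nonneg: "\<And>t x. t \<in> space M2 \<Longrightarrow> 0 \<le> g t x"
    and g_lsc: "\<And>t. t \<in> space M2 \<Longrightarrow> lower_semicontinuous (g t)"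
    and eps_pos: "\<epsilon>0 > 0"
    and log_minus_finite:
      "semi_integral M1
         (\<lambda>s. log_minus (\<integral>\<^sup>+ x. exp_ext (- f s x - ereal (\<epsilon>0 * (norm x)\<^sup>2)) \<partial>lborel)) < \<infinity>"
    and main_ineq: "\<And>\<alpha>. \<alpha> \<in> L2_space M1 \<Longrightarrow>
      semi_integral M2 (\<lambda>t. g t (A \<alpha> t)) \<le> semi_integral M1 (\<lambda>s. f s (\<alpha> s))"
  shows "semi_integral M2 (\<lambda>t. - log_ext (\<integral>\<^sup>+ x. exp_ext (- g t x) \<partial>lborel))
       \<le> semi_integral M1 (\<lambda>s. - log_ext (\<integral>\<^sup>+ x. exp_ext (- f s x) \<partial>lborel))"
proof -
  have M1: "finite_measure M1" using finite_mass by (intro finite_measureI) simp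
  have M2: "finite_measure M2" using finite_mass total_mass by (intro finite_measureI) simp
  interpret L2_contraction M1 M2 A
    by (rule L2_contractionI[OF M1 M2 A_operator A_norm A_const])
  \<comment> \<open>Both families are nonnegative, so the passage to \<open>ennreal\<close> loses
    nothing and the semi-integrals of the hypothesis become nonnegative integrals.\<close>
  define F G where "F s x = e2ennreal (f s x)" and "G t x = e2ennreal (g t x)" for s t x
  have F: "(\<lambda>(s, x). F s x) \<in> borel_measurable (M1 \<Otimes>\<^sub>M borel)"
    using measurable_compose[OF f_meas measurable_e2ennreal] by (simp add: F_def case_prod_beta')
  have G: "(\<lambda>(t, x). G t x) \<in> borel_measurable (M2 \<Otimes>\<^sub>M borel)"
    using measurable_compose[OF g_meas measurable_e2ennreal] by (simp add: G_def case_prod_beta')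
  have "dominated G F"
    unfolding dominated_def
  proof
    fix \<alpha> :: "'a \<Rightarrow> real ^ 'n" assume "\<alpha> \<in> L2_space M1"
    from main_ineq[OF this] show "(\<integral>\<^sup>+ t. G t (A \<alpha> t) \<partial>M2) \<le> (\<integral>\<^sup>+ s. F s (\<alpha> s) \<partial>M1)"
      by (simp add: semi_integral_nonneg f_nonneg g_nonneg F_def G_def less_eq_ennreal.rep_eq)
  qed
  moreover have "\<forall>\<^sub>F y in nhds x. a < G t y" if t: "t \<in> space M2" and a: "a < G t x" for t x a
  proof -
    have G': "enn2ereal (G t y) = g t y" for y
      unfolding G_def by (rule enn2ereal_e2ennreal[OF g_nonneg[OF t]])
    then show ?thesis
      using g_lsc[OF t] a unfolding lower_semicontinuous_def less_ennreal.rep_eq G' by blast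
  qed
  moreover have "(\<integral>\<^sup>+ s. nlog (weighted \<epsilon>0 (F s)) \<partial>M1) < \<infinity>"
  proof -
    have "enn2ereal (\<integral>\<^sup>+ s. nlog (weighted \<epsilon>0 (F s)) \<partial>M1) = semi_integral M1
         (\<lambda>s. log_minus (\<integral>\<^sup>+ x. exp_ext (- f s x - ereal (\<epsilon>0 * (norm x)\<^sup>2)) \<partial>lborel))"
      by (subst semi_integral_nonneg)
        (auto simp: log_minus_def log_ext_pos_neg weighted_def F_def exp_ext_uminus_diff f_nonneg intro!: arg_cong[where f = enn2ereal] nn_integral_cong)
    then show ?thesis using log_minus_finite by (simp add: less_ennreal.rep_eq)
  qed
  ultimately have *: "enn2ereal (\<integral>\<^sup>+ t. nlog (\<integral>\<^sup>+ x. en (G t x) \<partial>lborel) \<partial>M2) - enn2ereal (\<integral>\<^sup>+ t. plog (\<integral>\<^sup>+ x. en (G t x) \<partial>lborel) \<partial>M2)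
    \<le> enn2ereal (\<integral>\<^sup>+ s. nlog (\<integral>\<^sup>+ x. en (F s x) \<partial>lborel) \<partial>M1) - enn2ereal (\<integral>\<^sup>+ s. plog (\<integral>\<^sup>+ x. en (F s x) \<partial>lborel) \<partial>M1)"
    by (rule log_inequality[OF eps_pos total_mass G F])
  have eqF: "(\<integral>\<^sup>+ x. exp_ext (- f s x) \<partial>lborel) = (\<integral>\<^sup>+ x. en (F s x) \<partial>lborel)" if "s \<in> space M1" for s
    using f_nonneg[OF that] by (simp add: F_def exp_ext_uminus)
  have eqG: "(\<integral>\<^sup>+ x. exp_ext (- g t x) \<partial>lborel) = (\<integral>\<^sup>+ x. en (G t x) \<partial>lborel)" if "t \<in> space M2" for t
    using g_nonneg[OF that] by (simp add: G_def exp_ext_uminus)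
  show ?thesis
    using * unfolding semi_integral_neg_log by (simp add: eqF eqG cong: nn_integral_cong)
qed

end
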